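(* Let $p$ be a prime, let $\chi$ be the character of the regular representation $\mathbb Q[\mathbb Z/p\mathbb Z]$ of $\mathbb Z/p\mathbb Z$ over $\mathbb Q$, and let $x=c_{p-1}(\chi)\in R^{p-1}_{\mathbb Q}(\mathbb Z/p\mathbb Z)$. Then $$R^*_{\mathbb Q}(\mathbb Z/p\mathbb Z)=\frac{\mathbb Z[x]}{(px)},$$ i.e. the homomorphism from the polynomial ring $\mathbb Z[x]$ to $R^*_{\mathbb Q}(\mathbb Z/p\mathbb Z)$ sending the variable to $c_{p-1}(\chi)$ is surjective with kernel $(px)$.
   Context: Let $G$ be a finite group. $R_{\mathbb Q}(G)$ is the ring of virtual characters of $G$ over $\mathbb Q$ (the free abelian group on the characters of irreducible $\mathbb Q$-representations, with product induced by tensor product), with augmentation $\epsilon:R_{\mathbb Q}(G)\to\mathbb Z$ the degree map and $I=\ker\epsilon$. Exterior powers of representations give maps $\lambda^n$ on characters, extended to $R_{\mathbb Q}(G)$ by requiring $\lambda^0=1$ and $\lambda^n(x+y)=\sum_{i+j=n}\lambda^i(x)\lambda^j(y)$. Put $\gamma^n(x)=\lambda^n(x+n-1)$. Let $\Gamma^n\subseteq R_{\mathbb Q}(G)$ be the additive subgroup generated by all products $\gamma^{i_1}(x_1)\cdots\gamma^{i_r}(x_r)$ with $x_j\in I$ and $\sum_j i_j\ge n$; then $\Gamma^m\Gamma^n\subseteq\Gamma^{m+n}$. The graded character ring is $R^*_{\mathbb Q}(G)=\bigoplus_{n\ge0}R^n_{\mathbb Q}(G)$ with $R^n_{\mathbb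 Q}(G)=\Gamma^n/\Gamma^{n+1}$. The $n$-th Chern class of $\rho\in R_{\mathbb Q}(G)$ is the class $c_n(\rho)\in R^n_{\mathbb Q}(G)$ of $\gamma^n(\rho-\epsilon(\rho))$. *)

theory Defs
  imports
    "HOL-Algebra.Algebra"
    "HOL-Computational_Algebra.Primes"
    "Jordan_Normal_Form.VS_Connect"
begin

section \<open>Rational representations and their characters\<close>

text \<open>A representation of \<open>G\<close> over the rationals of degree \<open>d\<close> is a homomorphism into
  the group of invertible \<open>d \<times> d\<close> matrices; \<open>d = 0\<close> is allowed.\<close>

definition rat_rep :: "('g, 'm) monoid_scheme \<Rightarrow> nat \<Rightarrow> ('g \<Rightarrow> rat mat) \<Rightarrow> bool" where
  "rat_rep G d \<rho> \<longleftrightarrow> \<rho> \<in> hom G (units_of (ring_mat TYPE(rat) d ()))"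

definition irreducible_rat_rep :: "('g, 'm) monoid_scheme \<Rightarrow> nat \<Rightarrow> ('g \<Rightarrow> rat mat) \<Rightarrow> bool" where
  "irreducible_rat_rep G d \<rho> \<longleftrightarrow> rat_rep G d \<rho> \<and> d > 0 \<and>
     (\<forall>W. VectorSpace.subspace class_ring W (module_vec TYPE(rat) d) \<and>
          (\<forall>g\<in>carrier G. \<forall>w\<in>W. \<rho> g *\<^sub>v w \<in> W)
        \<longrightarrow> W = {0\<^sub>v d} \<or> W = carrier_vec d)"

definition mat_trace :: "'a::comm_monoid_add mat \<Rightarrow> 'a" where
  "mat_trace A = (\<Sum>i<dim_row A. A $$ (i, i))"

text \<open>Characters are functions on \<open>carrier G\<close>, extended by 0 to the whole type so that equality
  of functions is equality on \<open>carrier G\<close>.\<close>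

definition rep_character :: "('g, 'm) monoid_scheme \<Rightarrow> ('g \<Rightarrow> rat mat) \<Rightarrow> ('g \<Rightarrow> rat)" where
  "rep_character G \<rho> = (\<lambda>g. if g \<in> carrier G then mat_trace (\<rho> g) else 0)"

text \<open>The \<open>k\<close>-th exterior power of an endomorphism of \<open>K\<^sup>d\<close>, in the basis of the wedge products
  \<open>e\<^sub>I = e\<^bsub>i1\<^esub> \<and> \<dots> \<and> e\<^bsub>ik\<^esub>\<close> indexed by the strictly increasing \<open>k\<close>-tuples \<open>I\<close> from
  \<open>{0..<d}\<close>: the coefficient of \<open>e\<^sub>I\<close> in \<open>A e\<^bsub>j1\<^esub> \<and> \<dots> \<and> A e\<^bsub>jk\<^esub>\<close> is the minor of \<open>A\<close> with
  rows \<open>I\<close> and columns \<open>J\<close>.\<close>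

definition wedge_indices :: "nat \<Rightarrow> nat \<Rightarrow> nat list list" where
  "wedge_indices d k = filter (\<lambda>I. length I = k) (subseqs [0..<d])"

definition exterior_power_mat :: "nat \<Rightarrow> 'a::comm_ring_1 mat \<Rightarrow> 'a mat" where
  "exterior_power_mat k A =
     (let Is = wedge_indices (dim_row A) k; N = length Is
      in mat N N (\<lambda>(a, b). det (mat k k (\<lambda>(i, j). A $$ (Is ! a ! i, Is ! b ! j)))))"

text \<open>The regular representation, in the basis of the group ring given by an enumeration \<open>es\<close>
  of the group.\<close>

definition regular_rep :: "('g, 'm) monoid_scheme \<Rightarrow> 'g list \<Rightarrow> 'g \<Rightarrow> rat mat" where
  "regular_rep G es g =
     mat (length es) (length es) (\<lambda>(i, j). if g \<otimes>\<^bsub>G\<^esub> es ! j = es ! i then 1 else 0)"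


section \<open>The ring of virtual characters\<close>

definition rat_fun_ring :: "('g, 'm) monoid_scheme \<Rightarrow> ('g \<Rightarrow> rat) ring" where
  "rat_fun_ring G =
     \<lparr>carrier = {f. \<forall>g. g \<notin> carrier G \<longrightarrow> f g = 0},
      monoid.mult = (\<lambda>x y g. x g * y g),
      monoid.one = (\<lambda>g. if g \<in> carrier G then 1 else 0),
      ring.zero = (\<lambda>g. 0),
      ring.add = (\<lambda>x y g. x g + y g)\<rparr>"

text \<open>For a finite group the irreducible characters are linearly independent, so the additive
  group they generate is free on them; the tensor product of representations corresponds to the
  pointwise product of characters.\<close>

definition virtual_char_ring :: "('g, 'm) monoid_scheme \<Rightarrow> ('g \<Rightarrow> rat) ring" where
  "virtual_char_ring G =
     (rat_fun_ring G)\<lparr>carrier :=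
        generate (add_monoid (rat_fun_ring G))
          {rep_character G \<rho> | d \<rho>. irreducible_rat_rep G d \<rho>}\<rparr>"

text \<open>The degree of a virtual character is its value at the identity, which is an integer; the
  floor only serves to land in type \<open>int\<close>.\<close>

definition augmentation :: "('g, 'm) monoid_scheme \<Rightarrow> ('g \<Rightarrow> rat) \<Rightarrow> int" where
  "augmentation G x = \<lfloor>x \<one>\<^bsub>G\<^esub>\<rfloor>"

definition augmentation_ideal :: "('g, 'm) monoid_scheme \<Rightarrow> ('g \<Rightarrow> rat) set" where
  "augmentation_ideal G = {x \<in> carrier (virtual_char_ring G). augmentation G x = 0}"

definition const_char :: "('g, 'm) monoid_scheme \<Rightarrow> int \<Rightarrow> ('g \<Rightarrow> rat)" where
  "const_char G k = [k] \<cdot>\<^bsub>virtual_char_ring G\<^esub> \<one>\<^bsub>virtual_char_ring G\<^esub>"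


section \<open>Lambda and gamma operations\<close>

definition is_lambda_operation ::
    "('g, 'm) monoid_scheme \<Rightarrow> (nat \<Rightarrow> ('g \<Rightarrow> rat) \<Rightarrow> ('g \<Rightarrow> rat)) \<Rightarrow> bool" where
  "is_lambda_operation G L \<longleftrightarrow>
     (let R = virtual_char_ring G in
       (\<forall>n. L n \<in> carrier R \<rightarrow>\<^sub>E carrier R) \<and>
       (\<forall>n d \<rho>. rat_rep G d \<rho> \<longrightarrow>
          L n (rep_character G \<rho>) = rep_character G (\<lambda>g. exterior_power_mat n (\<rho> g))) \<and>
       (\<forall>x\<in>carrier R. L 0 x = \<one>\<^bsub>R\<^esub>) \<and>
       (\<forall>n. \<forall>x\<in>carrier R. \<forall>y\<in>carrier R.
          L n (x \<oplus>\<^bsub>R\<^esub> y) = (\<Oplus>\<^bsub>R\<^esub>i\<in>{..n}. L i x \<otimes>\<^bsub>R\<^esub> L (n - i) y)))"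

text \<open>Virtual characters are differences of characters, so the conditions determine the
  operations on \<open>carrier (virtual_char_ring G)\<close>; outside they are \<open>undefined\<close>.\<close>

definition lambda_op :: "('g, 'm) monoid_scheme \<Rightarrow> nat \<Rightarrow> ('g \<Rightarrow> rat) \<Rightarrow> ('g \<Rightarrow> rat)" where
  "lambda_op G = (THE L. is_lambda_operation G L)"

definition gamma_op :: "('g, 'm) monoid_scheme \<Rightarrow> nat \<Rightarrow> ('g \<Rightarrow> rat) \<Rightarrow> ('g \<Rightarrow> rat)" where
  "gamma_op G n x = lambda_op G n (x \<oplus>\<^bsub>virtual_char_ring G\<^esub> const_char G (int n - 1))"

definition gamma_filtration :: "('g, 'm) monoid_scheme \<Rightarrow> nat \<Rightarrow> ('g \<Rightarrow> rat) set" where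
  "gamma_filtration G n =
     (let R = virtual_char_ring G in
       generate (add_monoid R)
         {foldr (\<lambda>(i, x) z. gamma_op G i x \<otimes>\<^bsub>R\<^esub> z) ps \<one>\<^bsub>R\<^esub> | ps.
            snd ` set ps \<subseteq> augmentation_ideal G \<and> n \<le> sum_list (map fst ps)})"


section \<open>The graded character ring\<close>

definition graded_piece :: "('g, 'm) monoid_scheme \<Rightarrow> nat \<Rightarrow> ('g \<Rightarrow> rat) set monoid" where
  "graded_piece G n =
     (add_monoid (virtual_char_ring G))\<lparr>carrier := gamma_filtration G n\<rparr>
       Mod gamma_filtration G (Suc n)"

definition graded_incl ::
    "('g, 'm) monoid_scheme \<Rightarrow> nat \<Rightarrow> ('g \<Rightarrow> rat) set \<Rightarrow> nat \<Rightarrow> ('g \<Rightarrow> rat) set" where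
  "graded_incl G n A = (\<lambda>i. if i = n then A else \<one>\<^bsub>graded_piece G i\<^esub>)"

text \<open>The underlying additive group is the direct sum of the graded pieces: families of cosets,
  almost all of them trivial. The product in degree \<open>n\<close> is the sum over \<open>i \<le> n\<close> of the cosets
  \<open>a b + \<Gamma>\<^bsup>n+1\<^esup>\<close> for representatives \<open>a\<close>, \<open>b\<close> of the components in degrees \<open>i\<close> and \<open>n - i\<close>.\<close>

definition graded_char_ring ::
    "('g, 'm) monoid_scheme \<Rightarrow> (nat \<Rightarrow> ('g \<Rightarrow> rat) set) ring" where
  "graded_char_ring G =
     (let R = virtual_char_ring G; S = sum_group UNIV (graded_piece G)
      in \<lparr>carrier = carrier S,
          monoid.mult = (\<lambda>u v n. finprod (graded_piece G n)
             (\<lambda>i. rcoset_mult R (gamma_filtration G (Suc n)) (u i) (v (n - i))) {..n}),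
          monoid.one = graded_incl G 0 (gamma_filtration G (Suc 0) +>\<^bsub>R\<^esub> \<one>\<^bsub>R\<^esub>),
          ring.zero = \<one>\<^bsub>S\<^esub>,
          ring.add = monoid.mult S\<rparr>)"

definition chern_class :: "('g, 'm) monoid_scheme \<Rightarrow> nat \<Rightarrow> ('g \<Rightarrow> rat) \<Rightarrow> ('g \<Rightarrow> rat) set" where
  "chern_class G n x =
     (let R = virtual_char_ring G in
       gamma_filtration G (Suc n) +>\<^bsub>R\<^esub> gamma_op G n (x \<ominus>\<^bsub>R\<^esub> const_char G (augmentation G x)))"

end

theory Submission
  imports Defs "Berlekamp_Zassenhaus.Factor_Bound" "Jordan_Normal_Form.Char_Poly"
    "HOL-Computational_Algebra.Polynomial_FPS"
begin

text \<open>Every rational matrix \<open>A\<close> with \<open>A\<^sup>p = 1\<close> has characteristic polynomial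
  \<open>(X - 1)\<^sup>i \<Phi>\<^sub>p\<^sup>j\<close>, and \<open>A\<close> and \<open>A\<^sup>k\<close> have the same one when \<open>p\<close> does not divide \<open>k\<close>. Hence
  \<open>R\<^sub>\<rat>(\<int>/p)\<close> consists of the \<open>u + b (\<chi> - p)\<close>, and \<open>\<Sum>\<^sub>n tr(\<Lambda>\<^sup>n A) t\<^sup>n = det(1 + t A)\<close> shows that
  the series of lambda operations at a nontrivial group element is \<open>(1 + t)\<^sup>i\<^sup>-\<^sup>j (1 - (-t)\<^sup>p)\<^sup>j\<close>.

  At a nontrivial element, the gamma series of \<open>\<chi> - p\<close> becomes the polynomial \<open>(1 - t)\<^sup>p - (-t)\<^sup>p\<close> of degree
  \<open>p - 1\<close>, whose nonconstant coefficients are divisible by \<open>p\<close> and whose top coefficient is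
  \<open>\<plusminus>p\<close>. So \<open>\<gamma>\<^sup>p\<^sup>-\<^sup>1(\<chi> - p) = \<plusminus>(\<chi> - p)\<close>, and \<open>\<gamma>\<^sup>n(b (\<chi> - p))\<close> takes values divisible by \<open>p\<close> to the
  power \<open>\<lceil>n / (p - 1)\<rceil>\<close>. As \<open>(\<chi> - p)\<^sup>2 = - p (\<chi> - p)\<close>, for \<open>n > 0\<close> the group \<open>\<Gamma>\<^sup>n\<close> consists of exactly
  the virtual characters that vanish at the identity and have such values elsewhere: the filtration
  drops by a factor \<open>p\<close> right after each positive multiple of \<open>p - 1\<close>, and the quotients there are
  generated by the powers of \<open>x\<close>.\<close>

section \<open>The cyclotomic polynomial of prime order\<close>

text \<open>The virtual character ring is squeezed between two bounds. Above: a representation of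
  degree d whose generator has Phi_p with multiplicity j in its characteristic polynomial has
  character \<open>vch d j\<close>, and the same j fixes the characters of all its exterior powers.
  Below: the trivial representation and Q[X]/(Phi_p) are irreducible and already span all
  \<open>vch u b\<close>. All later computations use the coordinates (u, b), where u is the degree
  and u - p b the common value off the identity. Two definitions have to be unlocked before they can
  be used. \<open>lambda_op\<close> is a definite description, so an explicit family is shown to
  satisfy the axioms and to be the only one that does. \<open>graded_char_ring\<close> is a bare
  record; its ring laws are carried over from Z[X] along the surjective evaluation map. Degree 0 is
  exceptional: the quotient of Gamma^0 by Gamma^1 is Z, detected by the degree, while every later
  nonzero quotient has order p. This is why the kernel is (p x) and not (p).\<close>

lemma eisenstein_int:
  fixes f g h :: "int poly" and q :: int
  assumes q: "Factorial_Ring.prime q"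
    and monic: "lead_coeff f = 1"
    and low: "\<And>i. i < Polynomial.degree f \<Longrightarrow> q dvd poly.coeff f i"
    and zero: "\<not> q ^ 2 dvd poly.coeff f 0"
    and fgh: "f = g * h"
  shows "Polynomial.degree g = 0 \<or> Polynomial.degree h = 0"
proof (rule ccontr)
  assume "\<not> ?thesis"
  then have pos: "Polynomial.degree g > 0" "Polynomial.degree h > 0"
    by auto
  have nz: "g \<noteq> 0" "h \<noteq> 0"
    using pos by auto
  have deg: "Polynomial.degree f = Polynomial.degree g + Polynomial.degree h"
    using fgh nz by (simp add: degree_mult_eq)
  \<comment> \<open>\<open>a\<close> is the factor whose constant term avoids q, and m is the first
    index at which \<open>b\<close> has a coefficient not divisible by q. As deg a > 0, m lies below
    deg f, so q divides the coefficient m of f; every term of that coefficient except a_0 b_m is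
    divisible by q.\<close>
  have key: False
    if ab: "f = a * b" "\<not> q dvd poly.coeff a 0" "lead_coeff a * lead_coeff b = 1"
      "Polynomial.degree f = Polynomial.degree a + Polynomial.degree b"
      "Polynomial.degree a > 0" for a b :: "int poly"
  proof -
    have "\<not> q dvd lead_coeff b"
      using ab(3) q by (metis dvd_mult not_prime_unit)
    define m where "m = (LEAST k. \<not> q dvd poly.coeff b k)"
    have m: "\<not> q dvd poly.coeff b m"
      unfolding m_def by (rule LeastI) fact
    have "m \<le> Polynomial.degree b"
      unfolding m_def by (rule Least_le) fact
    have below: "q dvd poly.coeff b k" if "k < m" for k
      using not_less_Least[of k "\<lambda>k. \<not> q dvd poly.coeff b k"] that by (auto simp: m_def)
    have "poly.coeff f m = (\<Sum>i\<le>m. poly.coeff a i * poly.coeff b (m - i))"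
      by (simp add: ab(1) coeff_mult)
    also have "\<dots> = poly.coeff a 0 * poly.coeff b m +
        (\<Sum>i\<in>{..m} - {0}. poly.coeff a i * poly.coeff b (m - i))"
      by (subst sum.remove[of _ 0]) auto
    finally have "poly.coeff a 0 * poly.coeff b m =
        poly.coeff f m - (\<Sum>i\<in>{..m} - {0}. poly.coeff a i * poly.coeff b (m - i))"
      by simp
    moreover have "q dvd poly.coeff f m"
      using \<open>m \<le> _\<close> ab(4,5) by (intro low) simp
    moreover have "q dvd (\<Sum>i\<in>{..m} - {0}. poly.coeff a i * poly.coeff b (m - i))"
      by (intro dvd_sum dvd_mult below) auto
    ultimately have "q dvd poly.coeff a 0 * poly.coeff b m"
      by simp
    then show False
      using q m ab(2) by (simp add: prime_dvd_mult_iff)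
  qed
  have lc: "lead_coeff g * lead_coeff h = 1"
    using monic fgh by (simp add: lead_coeff_mult)
  have "\<not> q dvd poly.coeff g 0 \<or> \<not> q dvd poly.coeff h 0"
  proof (rule ccontr)
    assume "\<not> ?thesis"
    then have "q * q dvd poly.coeff g 0 * poly.coeff h 0"
      by (intro mult_dvd_mono) auto
    then show False
      using zero by (simp add: fgh coeff_mult power2_eq_square)
  qed
  then show False
  proof
    assume "\<not> q dvd poly.coeff g 0"
    then show False
      using key[of g h] fgh lc deg pos by blast
  next
    assume "\<not> q dvd poly.coeff h 0"
    moreover have "f = h * g" "lead_coeff h * lead_coeff g = 1"
        "Polynomial.degree f = Polynomial.degree h + Polynomial.degree g"
      using fgh lc deg by (simp_all only: mult.commute add.commute)
    ultimately show False
      using key[of h g] pos by blast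
  qed
qed

text \<open>The quotient of X^p - 1 by X - 1. It is Phi_p for prime p; other indices k occur too, as
  the cofactor of X - 1 in X^k - 1.\<close>

definition cyclo_poly :: "nat \<Rightarrow> 'a::comm_ring_1 poly" where
  "cyclo_poly p = (\<Sum>i<p. Polynomial.monom 1 i)"

lemma cyclo_poly_mult: "cyclo_poly p * [:-1, 1:] = Polynomial.monom 1 p - (1 :: 'a::comm_ring_1 poly)"
proof -
  have x: "[:-1, 1:] = Polynomial.monom 1 1 - (1 :: 'a poly)"
    by (rule poly_eqI) (auto simp: coeff_pCons split: nat.split)
  show ?thesis
  proof (induction p)
    case (Suc p)
    have "cyclo_poly (Suc p) * [:-1, 1:] = cyclo_poly p * [:-1, 1:] + Polynomial.monom 1 p * ([:-1, 1:] :: 'a poly)"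
      by (simp only: cyclo_poly_def sum.lessThan_Suc distrib_right)
    also have "Polynomial.monom 1 p * ([:-1, 1:] :: 'a poly) = Polynomial.monom 1 (Suc p) - Polynomial.monom 1 p"
      by (simp only: x right_diff_distrib mult_monom mult_1_right) simp
    finally show ?case
      using Suc by simp
  qed (simp add: cyclo_poly_def)
qed

lemma coeff_cyclo_poly: "poly.coeff (cyclo_poly p) i = (if i < p then 1 else 0 :: 'a::comm_ring_1)"
  by (simp add: cyclo_poly_def coeff_sum)

lemma degree_cyclo_poly [simp]: "Polynomial.degree (cyclo_poly p :: 'a::comm_ring_1 poly) = p - 1"
proof (cases "p = 0")
  case False
  then show ?thesis
    by (intro antisym degree_le le_degree) (auto simp: coeff_cyclo_poly)
qed (simp add: cyclo_poly_def)

lemma poly_cyclo_poly_1: "poly (cyclo_poly p) 1 = (of_nat p :: 'a::comm_ring_1)"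
  by (simp add: cyclo_poly_def poly_sum poly_monom)

text \<open>Eisenstein applies after X is replaced by X + 1: the shifted polynomial is ((X + 1)^p -
  1) / X, with coefficients p choose i + 1 and constant term p. Gauss's lemma turns a rational
  factorisation into an integral one with the same degrees.\<close>

lemma irreducible_cyclo_poly:
  assumes p: "Factorial_Ring.prime p"
  shows "Factorial_Ring.irreducible (cyclo_poly p :: rat poly)"
proof -
  define C where "C = (cyclo_poly p :: int poly)"
  define s where "s = [:1, 1 :: int:]"
  have p1: "p > 1"
    using p prime_gt_1_nat by blast
  have s_alt: "s = Polynomial.monom 1 1 \<circ>\<^sub>p s"
    by (simp add: s_def monom_altdef pcompose_pCons)
  have pow_s: "Polynomial.monom 1 n \<circ>\<^sub>p s = s ^ n" for n
  proof (induction n)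
    case (Suc n)
    have "Polynomial.monom 1 (Suc n) \<circ>\<^sub>p s = (Polynomial.monom 1 1 * Polynomial.monom 1 n) \<circ>\<^sub>p s"
      by (simp add: mult_monom)
    then show ?case
      using Suc s_alt by (simp only: pcompose_mult power_Suc)
  qed (simp add: monom_0)
  have deg_s: "Polynomial.degree s = 1"
    by (simp add: s_def)
  have coeff_s: "poly.coeff (s ^ n) i = int (n choose i)" for n i
  proof (cases "i \<le> n")
    case True
    then show ?thesis
      unfolding s_def by (subst coeff_linear_poly_power) auto
  next
    case False
    have "s \<noteq> 0"
      using deg_s by auto
    then have "poly.coeff (s ^ n) i = 0"
      using False deg_s by (intro coeff_eq_0) (simp add: degree_power_eq)
    then show ?thesis
      using False by (simp add: binomial_eq_0)
  qed
  have shift: "poly.coeff (C \<circ>\<^sub>p s) i = int (p choose Suc i)" for i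
  proof -
    have "(C \<circ>\<^sub>p s) * ([:-1, 1:] \<circ>\<^sub>p s) = (Polynomial.monom 1 p - 1) \<circ>\<^sub>p s"
      unfolding C_def by (simp only: cyclo_poly_mult pcompose_mult [symmetric])
    also have "\<dots> = s ^ p - 1"
      by (simp add: pcompose_diff pow_s)
    also have "[:-1, 1:] \<circ>\<^sub>p s = [:0, 1:]"
      by (simp add: pcompose_pCons s_def)
    finally have "pCons 0 (C \<circ>\<^sub>p s) = s ^ p - 1"
      by simp
    then have "poly.coeff (C \<circ>\<^sub>p s) i = poly.coeff (s ^ p - 1) (Suc i)"
      by (metis coeff_pCons_Suc)
    then show ?thesis
      by (simp add: coeff_s)
  qed
  have deg_shift: "Polynomial.degree (a \<circ>\<^sub>p s) = Polynomial.degree a" for a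
    by (simp add: deg_s)
  have deg_C: "Polynomial.degree C = p - 1"
    by (simp add: C_def)
  have int: "Polynomial.degree a = 0 \<or> Polynomial.degree b = 0" if ab: "C = a * b" for a b
  proof -
    have "Polynomial.degree (a \<circ>\<^sub>p s) = 0 \<or> Polynomial.degree (b \<circ>\<^sub>p s) = 0"
    proof (rule eisenstein_int)
      show "Factorial_Ring.prime (int p)"
        using p by simp
      show "lead_coeff (C \<circ>\<^sub>p s) = 1"
        using p1 by (simp only: deg_shift deg_C shift) simp
      show "int p dvd poly.coeff (C \<circ>\<^sub>p s) i" if "i < Polynomial.degree (C \<circ>\<^sub>p s)" for i
        using that p by (auto simp: shift deg_shift deg_C deg_s intro!: dvd_choose_prime)
      have "\<not> int p * int p dvd int p"
        using p1 by auto
      then show "\<not> (int p)\<^sup>2 dvd poly.coeff (C \<circ>\<^sub>p s) 0"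
        by (simp only: shift power2_eq_square) simp
      show "C \<circ>\<^sub>p s = (a \<circ>\<^sub>p s) * (b \<circ>\<^sub>p s)"
        by (simp only: ab pcompose_mult)
    qed
    then show ?thesis
      by (simp only: deg_shift)
  qed
  have map: "of_int_poly C = (cyclo_poly p :: rat poly)"
    by (rule poly_eqI) (simp add: coeff_cyclo_poly C_def)
  have nz: "(cyclo_poly p :: rat poly) \<noteq> 0"
    using p1 degree_cyclo_poly[of p, where 'a = rat] by fastforce
  show ?thesis
  proof (rule Factorial_Ring.irreducibleI)
    show "\<not> (cyclo_poly p :: rat poly) dvd 1"
      using p1 by (simp add: poly_dvd_1)
    fix a b :: "rat poly"
    assume ab: "cyclo_poly p = a * b"
    have "\<exists>a' b'. C = a' * b' \<and> Polynomial.degree a' = Polynomial.degree a \<and>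
        Polynomial.degree b' = Polynomial.degree b"
      by (rule rat_to_int_factor) (simp only: map ab)
    then obtain a' b' where "C = a' * b'" "Polynomial.degree a' = Polynomial.degree a"
        "Polynomial.degree b' = Polynomial.degree b"
      by blast
    then have "Polynomial.degree a = 0 \<or> Polynomial.degree b = 0"
      using int[of a' b'] by simp
    moreover have "a \<noteq> 0" "b \<noteq> 0"
      using ab nz by auto
    ultimately show "a dvd 1 \<or> b dvd 1"
      using is_unit_iff_degree[of a] is_unit_iff_degree[of b] by blast
  qed (rule nz)
qed

section \<open>Rational matrices of prime order\<close>

lemma pow_mat_add:
  fixes A :: "'a::semiring_1 mat"
  assumes A: "A \<in> carrier_mat d d"
  shows "A ^\<^sub>m (k + l) = A ^\<^sub>m k * A ^\<^sub>m l"
proof (induction l)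
  case 0
  then show ?case
    using A by simp
next
  case (Suc l)
  then show ?case
    using A assoc_mult_mat[of "A ^\<^sub>m k" d d "A ^\<^sub>m l" d A d] by simp
qed

lemma pow_mat_mult:
  fixes A :: "'a::semiring_1 mat"
  assumes A: "A \<in> carrier_mat d d"
  shows "(A ^\<^sub>m k) ^\<^sub>m l = A ^\<^sub>m (k * l)"
proof (induction l)
  case 0
  then show ?case
    using A pow_carrier_mat[OF A, of k] by (simp add: carrier_matD)
next
  case (Suc l)
  then show ?case
    using pow_mat_add[OF A, of "k * l" k] by (simp add: add.commute)
qed

lemma one_pow_mat [simp]: "(1\<^sub>m d :: 'a::semiring_1 mat) ^\<^sub>m k = 1\<^sub>m d"
  by (induction k) auto

text \<open>B commutes with the scalar x, so x^k - B^k factors as Q (x - B) as for numbers, and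
  determinants are multiplicative.\<close>

lemma det_scalar_minus_dvd_power:
  fixes B :: "'a::comm_ring_1 mat"
  assumes B: "B \<in> carrier_mat d d"
  shows "det (x \<cdot>\<^sub>m 1\<^sub>m d - B) dvd det (x ^ k \<cdot>\<^sub>m 1\<^sub>m d - B ^\<^sub>m k)"
proof -
  let ?M = "x \<cdot>\<^sub>m 1\<^sub>m d - B"
  have M: "?M \<in> carrier_mat d d"
    using B by (rule minus_carrier_mat)
  have "\<exists>Q \<in> carrier_mat d d. x ^ k \<cdot>\<^sub>m 1\<^sub>m d - B ^\<^sub>m k = Q * ?M"
  proof (induction k)
    case 0
    show ?case
      using B by (intro bexI[of _ "0\<^sub>m d d"]) auto
  next
    case (Suc k)
    then obtain Q where Q: "Q \<in> carrier_mat d d" "x ^ k \<cdot>\<^sub>m 1\<^sub>m d - B ^\<^sub>m k = Q * ?M"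
      by blast
    have Bk: "B ^\<^sub>m k \<in> carrier_mat d d"
      using B by simp
    have "(x \<cdot>\<^sub>m Q + B ^\<^sub>m k) * ?M = x \<cdot>\<^sub>m (Q * ?M) + B ^\<^sub>m k * ?M"
      using Q Bk M mult_smult_assoc_mat[OF Q(1) M, of x]
        add_mult_distrib_mat[of "x \<cdot>\<^sub>m Q" d d "B ^\<^sub>m k" ?M d] by simp
    also have "B ^\<^sub>m k * ?M = x \<cdot>\<^sub>m B ^\<^sub>m k - B ^\<^sub>m Suc k"
    proof -
      have "B ^\<^sub>m k * (x \<cdot>\<^sub>m 1\<^sub>m d) = x \<cdot>\<^sub>m B ^\<^sub>m k"
        using mult_smult_distrib[OF Bk one_carrier_mat[of d], of x] right_mult_one_mat[OF Bk] by simp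
      then show ?thesis
        using mult_minus_distrib_mat[OF Bk, of "x \<cdot>\<^sub>m 1\<^sub>m d" d B] B by simp
    qed
    also have "x \<cdot>\<^sub>m (Q * ?M) + (x \<cdot>\<^sub>m B ^\<^sub>m k - B ^\<^sub>m Suc k) = x ^ Suc k \<cdot>\<^sub>m 1\<^sub>m d - B ^\<^sub>m Suc k"
      unfolding Q(2) [symmetric]
    proof -
      have "B ^\<^sub>m Suc k \<in> carrier_mat d d"
        using B by (rule pow_carrier_mat)
      then show "x \<cdot>\<^sub>m (x ^ k \<cdot>\<^sub>m 1\<^sub>m d - B ^\<^sub>m k) + (x \<cdot>\<^sub>m B ^\<^sub>m k - B ^\<^sub>m Suc k) =
          x ^ Suc k \<cdot>\<^sub>m 1\<^sub>m d - B ^\<^sub>m Suc k"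
        using Bk carrier_matD[OF Bk]
        by (intro eq_matI) (auto simp: algebra_simps simp del: pow_mat.simps(2) dest: carrier_matD)
    qed
    finally have "x ^ Suc k \<cdot>\<^sub>m 1\<^sub>m d - B ^\<^sub>m Suc k = (x \<cdot>\<^sub>m Q + B ^\<^sub>m k) * ?M"
      by simp
    then show ?case
      using Q Bk by (intro bexI[of _ "x \<cdot>\<^sub>m Q + B ^\<^sub>m k"]) auto
  qed
  then obtain Q where "Q \<in> carrier_mat d d" "x ^ k \<cdot>\<^sub>m 1\<^sub>m d - B ^\<^sub>m k = Q * ?M"
    by blast
  then show ?thesis
    using M by (simp add: det_mult[of _ d])
qed

definition const_poly_mat :: "'a::comm_ring_1 mat \<Rightarrow> 'a poly mat" where
  "const_poly_mat A = map_mat (\<lambda>a. [:a:]) A"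

lemma const_poly_mat_carrier [simp]:
  "const_poly_mat A \<in> carrier_mat n m \<longleftrightarrow> A \<in> carrier_mat n m"
  unfolding const_poly_mat_def by (rule map_carrier_mat)

lemma const_poly_mat_pow:
  assumes "A \<in> carrier_mat d d"
  shows "const_poly_mat (A ^\<^sub>m k) = const_poly_mat A ^\<^sub>m k"
proof -
  have h: "semiring_hom (\<lambda>a :: 'a. [:a:])"
    by unfold_locales auto
  show ?thesis
    unfolding const_poly_mat_def
    by (rule semiring_hom.mat_hom_pow [OF h assms])
qed

lemma char_poly_alt:
  assumes "A \<in> carrier_mat d d"
  shows "char_poly A = det ([:0, 1:] \<cdot>\<^sub>m 1\<^sub>m d - const_poly_mat A)"
proof -
  have "[:0, 1:] \<cdot>\<^sub>m 1\<^sub>m d + map_mat (\<lambda>a. [:- a:]) A = [:0, 1:] \<cdot>\<^sub>m 1\<^sub>m d - const_poly_mat A"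
    using assms by (intro eq_matI) (auto simp: const_poly_mat_def)
  then show ?thesis
    using assms by (simp add: char_poly_defs)
qed

lemma pcompose_char_poly:
  assumes A: "A \<in> carrier_mat d d"
  shows "char_poly A \<circ>\<^sub>p q = det (q \<cdot>\<^sub>m 1\<^sub>m d - const_poly_mat A)"
proof -
  have "map_mat (\<lambda>f. f \<circ>\<^sub>p q) ([:0, 1:] \<cdot>\<^sub>m 1\<^sub>m d - const_poly_mat A) = q \<cdot>\<^sub>m 1\<^sub>m d - const_poly_mat A"
    using A by (intro eq_matI) (auto simp: const_poly_mat_def pcompose_diff pcompose_pCons)
  then show ?thesis
    using comm_ring_hom.hom_det[OF pcompose_hom.comm_ring_hom_axioms, of q "[:0, 1:] \<cdot>\<^sub>m 1\<^sub>m d - const_poly_mat A"] char_poly_alt[OF A]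
    by simp
qed

text \<open>The divisibility form of the fact that k-th powers of eigenvalues of A are eigenvalues
  of A^k; it stays over the base ring.\<close>

lemma char_poly_dvd_char_poly_power:
  assumes A: "A \<in> carrier_mat d d"
  shows "char_poly A dvd char_poly (A ^\<^sub>m k) \<circ>\<^sub>p [:0, 1:] ^ k"
  using A det_scalar_minus_dvd_power[of "const_poly_mat A" d "[:0, 1:]" k]
  by (simp add: pcompose_char_poly[of _ d] const_poly_mat_pow char_poly_alt)

lemma linear_minus_one: "[:-1, 1:] = [:0, 1:] - (1 :: 'a::comm_ring_1 poly)"
  by (rule poly_eqI) (auto simp: coeff_pCons split: nat.split)

lemma char_poly_one_mat: "char_poly (1\<^sub>m d :: 'a::comm_ring_1 mat) = [:-1, 1:] ^ d"
proof -
  have "[:0, 1:] \<cdot>\<^sub>m 1\<^sub>m d - const_poly_mat (1\<^sub>m d :: 'a mat) = [:-1, 1:] \<cdot>\<^sub>m 1\<^sub>m d"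
    by (rule eq_matI) (auto simp: const_poly_mat_def linear_minus_one[symmetric, unfolded pCons_one])
  then show ?thesis
    by (simp add: char_poly_alt[of _ d])
qed

lemma pcompose_linear_minus_one:
  "[:-1, 1:] \<circ>\<^sub>p [:0, 1:] ^ k = Polynomial.monom 1 k - (1 :: 'a::comm_ring_1 poly)"
proof -
  have "[:0, 1:] \<circ>\<^sub>p q = q" for q :: "'a poly"
    by (simp add: pcompose_pCons)
  then show ?thesis
    by (simp only: linear_minus_one pcompose_diff pcompose_1 monom_altdef smult_1_left)
qed

text \<open>Monicity fixes the unit that divisibility of prime powers leaves open.\<close>

lemma monic_dvd_prime_powers:
  fixes g a b :: "'a::{field_gcd} poly"
  assumes g: "lead_coeff g = 1" "g dvd a ^ m * b ^ n"
    and a: "prime_elem a" "lead_coeff a = 1" and b: "prime_elem b" "lead_coeff b = 1"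
  obtains i j where "g = a ^ i * b ^ j"
proof -
  have norm: "normalize f = f" if "lead_coeff f = 1" for f :: "'a poly"
    using that by (simp add: normalize_poly_eq_map_poly map_poly_idI)
  have ab: "Factorial_Ring.prime a" "Factorial_Ring.prime b"
    using Factorial_Ring.primeI[OF a(1) norm[OF a(2)]] Factorial_Ring.primeI[OF b(1) norm[OF b(2)]] .
  obtain r s where rs: "g = r * s" "r dvd a ^ m" "s dvd b ^ n"
    using division_decomp[OF g(2)] by blast
  obtain i where i: "normalize r = a ^ i"
    using divides_primepow[OF ab(1) rs(2)] by blast
  obtain j where j: "normalize s = b ^ j"
    using divides_primepow[OF ab(2) rs(3)] by blast
  have "g = normalize (r * s)"
    using norm[OF g(1)] by (simp only: rs(1))
  also have "\<dots> = a ^ i * b ^ j"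
    by (simp only: normalize_mult i j)
  finally have "g = a ^ i * b ^ j" .
  then show ?thesis
    by (rule that)
qed

lemma prime_elem_cyclo_poly:
  assumes "Factorial_Ring.prime p"
  shows "prime_elem (cyclo_poly p :: rat poly)"
  using irreducible_cyclo_poly[OF assms] by (simp add: irreducible_imp_prime_elem_gcd)

text \<open>As A^p = 1, \<open>char_poly A\<close> divides (X^p - 1)^d = (X - 1)^d Phi_p^d, a
  product of powers of two primes; comparing degrees gives the formula for d.\<close>

lemma char_poly_of_order_p:
  fixes A :: "rat mat"
  assumes p: "Factorial_Ring.prime p" and A: "A \<in> carrier_mat d d" and Ap: "A ^\<^sub>m p = 1\<^sub>m d"
  obtains i j where "char_poly A = [:-1, 1:] ^ i * cyclo_poly p ^ j" "d = i + (p - 1) * j"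
proof -
  have p1: "p > 1"
    using p prime_gt_1_nat by blast
  have "char_poly A dvd char_poly (1\<^sub>m d :: rat mat) \<circ>\<^sub>p [:0, 1:] ^ p"
    using char_poly_dvd_char_poly_power[OF A, of p] by (simp add: Ap)
  also have "\<dots> = (Polynomial.monom 1 p - 1) ^ d"
    by (simp only: char_poly_one_mat pcompose_hom.hom_power pcompose_linear_minus_one)
  also have "\<dots> = cyclo_poly p ^ d * [:-1, 1:] ^ d"
    by (metis cyclo_poly_mult power_mult_distrib)
  finally have dvd: "char_poly A dvd [:-1, 1:] ^ d * cyclo_poly p ^ d"
    by (simp only: mult.commute)
  have deg: "Polynomial.degree (char_poly A) = d" and monic: "lead_coeff (char_poly A) = 1"
    using degree_monic_char_poly[OF A] by auto
  have "prime_elem ([:-1, 1:] :: rat poly)"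
    by (rule prime_elem_linear_field_poly) simp
  moreover have "lead_coeff ([:-1, 1:] :: rat poly) = 1"
    by simp
  moreover have "lead_coeff (cyclo_poly p :: rat poly) = 1"
    using p1 by (subst degree_cyclo_poly) (simp add: coeff_cyclo_poly)
  ultimately obtain i j where ij: "char_poly A = [:-1, 1:] ^ i * cyclo_poly p ^ j"
    using monic_dvd_prime_powers[OF monic dvd _ _ prime_elem_cyclo_poly[OF p]] by blast
  have "(cyclo_poly p :: rat poly) \<noteq> 0"
    using prime_elem_cyclo_poly[OF p] by auto
  moreover have "Polynomial.degree ([:-1, 1:] ^ i :: rat poly) = i"
    by (simp only: degree_linear_power)
  moreover have "([:-1, 1:] :: rat poly) ^ i \<noteq> 0"
    by simp
  ultimately have "Polynomial.degree ([:-1, 1:] ^ i * cyclo_poly p ^ j :: rat poly) = i + (p - 1) * j"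
    by (simp add: degree_mult_eq degree_power_eq mult.commute del: mult_pCons_left)
  then have "d = i + (p - 1) * j"
    using deg ij by simp
  with ij show ?thesis
    by (rule that)
qed

lemma le_of_linear_power_dvd:
  fixes q :: "'a::idom poly"
  assumes dvd: "[:-a, 1:] ^ i dvd [:-a, 1:] ^ k * q" and q: "poly q a \<noteq> 0"
  shows "i \<le> k"
proof (rule ccontr)
  assume "\<not> i \<le> k"
  define L where "L = [:-a, 1:]"
  have "L \<noteq> 0"
    by (simp add: L_def)
  have "L ^ k * L dvd L ^ i"
    using \<open>\<not> i \<le> k\<close> le_imp_power_dvd[of "Suc k" i L] by (simp add: mult.commute)
  also have "\<dots> dvd L ^ k * q"
    using dvd by (simp only: L_def)
  finally have "L dvd q"
    using \<open>L \<noteq> 0\<close> by simp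
  then show False
    using q by (simp add: L_def poly_eq_0_iff_dvd)
qed

text \<open>The multiplicity of the root 1 can only grow from \<open>A\<close> to \<open>A\<^sup>k\<close>, because 1 is a simple root
  of \<open>X\<^sup>k - 1\<close>; since \<open>A\<close> is itself a power of \<open>A\<^sup>k\<close>, it stays the same.\<close>

lemma char_poly_power_of_order_p:
  fixes A :: "rat mat"
  assumes p: "Factorial_Ring.prime p" and A: "A \<in> carrier_mat d d" and Ap: "A ^\<^sub>m p = 1\<^sub>m d"
    and k: "\<not> p dvd k"
  shows "char_poly (A ^\<^sub>m k) = char_poly A"
proof -
  have p1: "p > 1"
    using p prime_gt_1_nat by blast
  have le: "i \<le> i'"
    if B: "B \<in> carrier_mat d d" and k: "\<not> p dvd k"
      and ij: "char_poly B = [:-1, 1:] ^ i * cyclo_poly p ^ j"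
      and ij': "char_poly (B ^\<^sub>m k) = [:-1, 1:] ^ i' * cyclo_poly p ^ j'"
    for B :: "rat mat" and k i j i' j'
  proof -
    have k0: "k > 0"
      using k by (cases k) auto
    let ?X = "[:0, 1:] :: rat poly"
    have xk: "[:-1, 1:] \<circ>\<^sub>p ?X ^ k = [:-1, 1:] * cyclo_poly k"
      by (simp only: mult.commute[of "[:-1, 1:]"] cyclo_poly_mult pcompose_linear_minus_one)
    have "[:-1, 1:] ^ i dvd char_poly (B ^\<^sub>m k) \<circ>\<^sub>p ?X ^ k"
      using char_poly_dvd_char_poly_power[OF B, of k] ij by (metis dvd_mult_left)
    also have "\<dots> = [:-1, 1:] ^ i' * (cyclo_poly k ^ i' * (cyclo_poly p \<circ>\<^sub>p ?X ^ k) ^ j')"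
      by (simp only: ij' pcompose_hom.hom_mult pcompose_hom.hom_power xk power_mult_distrib mult.assoc)
    finally have "[:-1, 1:] ^ i dvd [:-1, 1:] ^ i' *
        (cyclo_poly k ^ i' * (cyclo_poly p \<circ>\<^sub>p ?X ^ k) ^ j')" .
    \<comment> \<open>\<open>cyclo_poly k\<close> and \<open>cyclo_poly p\<close> take the values k
      and p at 1, nonzero in characteristic 0, and X^k fixes 1.\<close>
    moreover have "poly (cyclo_poly k ^ i' * (cyclo_poly p \<circ>\<^sub>p ?X ^ k) ^ j') 1 \<noteq> 0"
      using k0 p1 by (simp add: poly_pcompose poly_cyclo_poly_1)
    ultimately show ?thesis
      by (rule le_of_linear_power_dvd)
  qed
  obtain i j where ij: "char_poly A = [:-1, 1:] ^ i * cyclo_poly p ^ j" "d = i + (p - 1) * j"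
    using char_poly_of_order_p[OF p A Ap] .
  have Ak: "A ^\<^sub>m k \<in> carrier_mat d d"
    using A by simp
  have "(A ^\<^sub>m k) ^\<^sub>m p = 1\<^sub>m d"
    using pow_mat_mult[OF A, of k p] pow_mat_mult[OF A, of p k] Ap by (simp add: mult.commute)
  then obtain i' j' where ij': "char_poly (A ^\<^sub>m k) = [:-1, 1:] ^ i' * cyclo_poly p ^ j'"
      "d = i' + (p - 1) * j'"
    using char_poly_of_order_p[OF p Ak] by blast
  have "Rings.coprime k p"
    using prime_imp_coprime[OF p k] by (simp only: Rings.coprime_commute)
  then obtain m where m: "[k * m = 1] (mod p)"
    using cong_solve_coprime_nat[of k p] by auto
  then have "k * m mod p = 1"
    using p1 by (simp add: cong_def)
  then have km: "k * m = p * (k * m div p) + 1"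
    by (metis mult_div_mod_eq)
  have "(A ^\<^sub>m k) ^\<^sub>m m = A ^\<^sub>m (p * (k * m div p) + 1)"
    using pow_mat_mult[OF A, of k m] km by simp
  also have "\<dots> = A"
    using A by (simp only: pow_mat_add[OF A] pow_mat_mult[OF A, symmetric] Ap) simp
  finally have Akm: "(A ^\<^sub>m k) ^\<^sub>m m = A" .
  have "\<not> p dvd m"
    using m p1 by (metis \<open>k * m mod p = 1\<close> dvd_mult dvd_imp_mod_0 zero_neq_one)
  then have "i' \<le> i"
    using le[OF Ak _ ij'(1), of m i j] Akm ij(1) by simp
  moreover have "i \<le> i'"
    using le[OF A k ij(1) ij'(1)] .
  ultimately have "i = i'"
    by simp
  moreover have "j = j'"
    using ij(2) ij'(2) \<open>i = i'\<close> p1 by simp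
  ultimately show ?thesis
    using ij(1) ij'(1) by simp
qed

section \<open>Traces of exterior powers\<close>

text \<open>The determinant of the submatrix with rows and columns \<open>S\<close>, without renumbering \<open>S\<close>.\<close>

definition principal_minor :: "'a::comm_ring_1 mat \<Rightarrow> nat set \<Rightarrow> 'a" where
  "principal_minor A S = (\<Sum>\<pi> | \<pi> permutes S. signof \<pi> * (\<Prod>i\<in>S. A $$ (i, \<pi> i)))"

text \<open>Conjugation with the enumeration \<open>I ! i\<close> identifies the permutations of the
  positions with those of \<open>set I\<close> and preserves signs.\<close>

lemma det_submatrix_eq_principal_minor:
  assumes I: "distinct I" "length I = k"
  shows "det (mat k k (\<lambda>(i, j). A $$ (I ! i, I ! j))) = principal_minor A (set I)"
proof -
  let ?f = "\<lambda>i. I ! i"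
  have bij: "bij_betw ?f {0..<k} (set I)"
    using I by (intro bij_betw_nth) auto
  then have inj: "inj_on ?f {0..<k}"
    by (simp add: bij_betw_def)
  let ?m = "map_permutation {0..<k} ?f"
  have "?m = (\<lambda>\<pi> x. if x \<in> set I then ?f (\<pi> (inv_into {0..<k} ?f x)) else x)"
    using bij by (auto simp: map_permutation_def restrict_id_def bij_betw_def fun_eq_iff)
  then have bij_m: "bij_betw ?m {\<pi>. \<pi> permutes {0..<k}} {\<pi>. \<pi> permutes set I}"
    using bij_betw_permutations[OF bij] by (simp only:)
  have "principal_minor A (set I) = (\<Sum>\<pi> | \<pi> permutes {0..<k}.
      signof (?m \<pi>) * (\<Prod>i\<in>set I. A $$ (i, ?m \<pi> i)))"
    unfolding principal_minor_def
    by (intro sum.reindex_bij_betw [symmetric] bij_m)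
  also have "\<dots> = (\<Sum>\<pi> | \<pi> permutes {0..<k}. signof \<pi> * (\<Prod>i=0..<k. A $$ (?f i, ?f (\<pi> i))))"
  proof (intro sum.cong refl arg_cong2[where f = "(*)"])
    fix \<pi> assume "\<pi> \<in> {\<pi>. \<pi> permutes {0..<k}}"
    then have \<pi>: "\<pi> permutes {0..<k}"
      by simp
    show "signof (?m \<pi>) = (signof \<pi> :: 'a)"
      using sign_map_permutation[OF inj \<pi>] by (simp add: sign_def)
    have "(\<Prod>i\<in>set I. A $$ (i, ?m \<pi> i)) = (\<Prod>i\<in>{0..<k}. A $$ (?f i, ?m \<pi> (?f i)))"
      using bij by (intro prod.reindex_bij_betw [symmetric])
    then show "(\<Prod>i\<in>set I. A $$ (i, ?m \<pi> i)) = (\<Prod>i=0..<k. A $$ (?f i, ?f (\<pi> i)))"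
      using inj by (simp add: map_permutation_apply)
  qed
  also have "\<dots> = det (mat k k (\<lambda>(i, j). A $$ (I ! i, I ! j)))"
    by (subst det_def'[of _ k])
      (auto intro!: sum.cong prod.cong simp: permutes_in_image[of _ "{0..<k}"] dest: permutes_in_image)
  finally show ?thesis
    by simp
qed

lemma wedge_indices_bij: "bij_betw set (set (wedge_indices d k)) {S. S \<subseteq> {0..<d} \<and> card S = k}"
proof -
  have inj: "inj_on set (set (subseqs [0..<d]))"
    using distinct_set_subseqs[of "[0..<d]"]
    by (simp add: distinct_map)
  have len: "length I = card (set I)" if "I \<in> set (subseqs [0..<d])" for I
    using subseqs_distinctD[OF that] by (simp add: distinct_card)
  have "set (wedge_indices d k) = {I \<in> set (subseqs [0..<d]). card (set I) = k}"
    using len by (auto simp: wedge_indices_def)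
  moreover have "set ` {I \<in> set (subseqs [0..<d]). card (set I) = k} = {S. S \<subseteq> {0..<d} \<and> card S = k}"
  proof -
    have "set ` set (subseqs [0..<d]) = Pow {0..<d}"
      using subseqs_powset[of "[0..<d]"] by simp
    moreover have "set ` {I \<in> set (subseqs [0..<d]). card (set I) = k} =
        {S \<in> set ` set (subseqs [0..<d]). card S = k}"
      by auto
    ultimately show ?thesis
      by (simp only:) auto
  qed
  ultimately show ?thesis
    using inj unfolding bij_betw_def inj_on_def by simp
qed

text \<open>The diagonal entries of the exterior power matrix are the minors whose row and column
  sets agree.\<close>

lemma trace_exterior_power_mat:
  assumes A: "A \<in> carrier_mat d d"
  shows "mat_trace (exterior_power_mat k A) = (\<Sum>S | S \<subseteq> {0..<d} \<and> card S = k. principal_minor A S)"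
proof -
  define Is where "Is = wedge_indices d k"
  have dist: "distinct Is"
    unfolding Is_def wedge_indices_def
    using distinct_set_subseqs[of "[0..<d]"] by (intro distinct_filter) (simp add: distinct_map)
  have "mat_trace (exterior_power_mat k A) =
      (\<Sum>a<length Is. det (mat k k (\<lambda>(i, j). A $$ (Is ! a ! i, Is ! a ! j))))"
    using A by (simp add: mat_trace_def exterior_power_mat_def Let_def Is_def)
  also have "\<dots> = (\<Sum>a<length Is. principal_minor A (set (Is ! a)))"
  proof (intro sum.cong refl det_submatrix_eq_principal_minor)
    fix a assume "a \<in> {..<length Is}"
    then have "Is ! a \<in> set Is"
      by simp
    then show "distinct (Is ! a)" "length (Is ! a) = k"
      by (auto simp: Is_def wedge_indices_def dest: subseqs_distinctD)
  qed
  also have "\<dots> = (\<Sum>I\<in>set Is. principal_minor A (set I))"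
    using bij_betw_nth[OF dist refl refl] by (intro sum.reindex_bij_betw)
  also have "\<dots> = (\<Sum>S | S \<subseteq> {0..<d} \<and> card S = k. principal_minor A S)"
    unfolding Is_def by (intro sum.reindex_bij_betw wedge_indices_bij)
  finally show ?thesis .
qed

text \<open>Each product of entries t A + delta is expanded over the set S of rows that contribute t
  A. The other rows contribute a delta, so only permutations fixing the complement of S
  survive.\<close>

lemma det_one_plus_expansion:
  fixes A :: "'a::comm_ring_1 mat"
  assumes A: "A \<in> carrier_mat d d"
  shows "det (1\<^sub>m d + t \<cdot>\<^sub>m A) = (\<Sum>S\<in>Pow {0..<d}. t ^ card S * principal_minor A S)"
proof -
  let ?P = "{\<pi>. \<pi> permutes {0..<d}}"
  have "det (1\<^sub>m d + t \<cdot>\<^sub>m A) =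
      (\<Sum>\<pi>\<in>?P. signof \<pi> * (\<Prod>i=0..<d. t * A $$ (i, \<pi> i) + (if \<pi> i = i then 1 else 0)))"
    using A by (subst det_def'[of _ d])
      (auto intro!: sum.cong prod.cong arg_cong2[where f = "(*)"] dest: permutes_in_image)
  also have "\<dots> = (\<Sum>\<pi>\<in>?P. signof \<pi> * (\<Sum>S\<in>Pow {0..<d}.
      (\<Prod>i\<in>S. t * A $$ (i, \<pi> i)) * (\<Prod>i\<in>{0..<d} - S. if \<pi> i = i then 1 else 0)))"
    by (intro sum.cong refl arg_cong2[where f = "(*)"] prod_add) simp
  also have "\<dots> = (\<Sum>S\<in>Pow {0..<d}. \<Sum>\<pi>\<in>?P. signof \<pi> *
      ((\<Prod>i\<in>S. t * A $$ (i, \<pi> i)) * (\<Prod>i\<in>{0..<d} - S. if \<pi> i = i then 1 else 0)))"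
    unfolding sum_distrib_left by (rule sum.swap)
  also have "\<dots> = (\<Sum>S\<in>Pow {0..<d}. t ^ card S * principal_minor A S)"
  proof (intro sum.cong refl)
    fix S assume "S \<in> Pow {0..<d}"
    then have S: "S \<subseteq> {0..<d}"
      by simp
    have "(\<Sum>\<pi>\<in>?P. signof \<pi> *
        ((\<Prod>i\<in>S. t * A $$ (i, \<pi> i)) * (\<Prod>i\<in>{0..<d} - S. if \<pi> i = i then 1 else 0)))
      = (\<Sum>\<pi> | \<pi> permutes S. signof \<pi> * (\<Prod>i\<in>S. t * A $$ (i, \<pi> i)))"
    proof (intro sum.mono_neutral_cong_right)
      show "finite ?P"
        by (simp add: finite_permutations)
      show "{\<pi>. \<pi> permutes S} \<subseteq> ?P"
        using S by (auto intro: permutes_subset)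
      show "\<forall>\<pi>\<in>?P - {\<pi>. \<pi> permutes S}. signof \<pi> *
        ((\<Prod>i\<in>S. t * A $$ (i, \<pi> i)) * (\<Prod>i\<in>{0..<d} - S. if \<pi> i = i then 1 else 0)) = 0"
      proof
        fix \<pi> assume "\<pi> \<in> ?P - {\<pi>. \<pi> permutes S}"
        then obtain i where "i \<in> {0..<d} - S" "\<pi> i \<noteq> i"
          using permutes_superset[of \<pi> "{0..<d}" S] by auto
        then have "(\<Prod>i\<in>{0..<d} - S. if \<pi> i = i then 1 else 0 :: 'a) = 0"
          by (intro prod_zero) auto
        then show "signof \<pi> * ((\<Prod>i\<in>S. t * A $$ (i, \<pi> i)) *
            (\<Prod>i\<in>{0..<d} - S. if \<pi> i = i then 1 else 0)) = 0"
          by (simp only: mult_zero_right)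
      qed
      fix \<pi> assume "\<pi> \<in> {\<pi>. \<pi> permutes S}"
      then have "\<pi> permutes S"
        by simp
      then have "(\<Prod>i\<in>{0..<d} - S. if \<pi> i = i then 1 else 0 :: 'a) = 1"
        by (intro prod.neutral) (auto simp: permutes_not_in)
      then show "signof \<pi> * ((\<Prod>i\<in>S. t * A $$ (i, \<pi> i)) *
          (\<Prod>i\<in>{0..<d} - S. if \<pi> i = i then 1 else 0)) = signof \<pi> * (\<Prod>i\<in>S. t * A $$ (i, \<pi> i))"
        by (simp only: mult_1_right)
    qed
    also have "\<dots> = t ^ card S * principal_minor A S"
      by (simp add: principal_minor_def prod.distrib sum_distrib_left mult_ac)
    finally show "(\<Sum>\<pi>\<in>?P. signof \<pi> *
        ((\<Prod>i\<in>S. t * A $$ (i, \<pi> i)) * (\<Prod>i\<in>{0..<d} - S. if \<pi> i = i then 1 else 0)))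
      = t ^ card S * principal_minor A S" .
  qed
  finally show ?thesis .
qed

section \<open>Lambda and gamma series\<close>

text \<open>For negative b, negating the upper index gives an ordinary binomial coefficient up to
  sign.\<close>

lemma gchoose_of_int_Ints: "(of_int b :: rat) gchoose k \<in> \<int>"
proof (cases "b \<ge> 0")
  case True
  then obtain n where "b = int n"
    using nonneg_int_cases by blast
  then show ?thesis
    by (simp add: binomial_gbinomial [symmetric])
next
  case False
  then obtain n where n: "int k - b - 1 = int n"
    using nonneg_int_cases[of "int k - b - 1"] by auto
  have "(of_int b :: rat) gchoose k = (-1) ^ k * ((of_nat k - of_int b - 1) gchoose k)"
    by (rule gbinomial_negated_upper)
  also have "of_nat k - of_int b - 1 = (of_nat n :: rat)"
    using arg_cong[OF n, of "of_int :: int \<Rightarrow> rat"] by simp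
  also have "(-1) ^ k * ((of_nat n :: rat) gchoose k) \<in> \<int>"
    by (simp add: binomial_gbinomial [symmetric])
  finally show ?thesis .
qed

section \<open>Divisibility of power series coefficients\<close>

definition coeffs_dvd :: "int \<Rightarrow> (nat \<Rightarrow> nat) \<Rightarrow> rat fps \<Rightarrow> bool" where
  "coeffs_dvd q c h \<longleftrightarrow> (\<forall>n. \<exists>z. fps_nth h n = of_int (z * q ^ c n))"

text \<open>Subadditivity of c makes the product of a coefficient divisible by q^(c i) and one
  divisible by q^(c j) good enough for degree i + j. It is applied with c n the ceiling of n / (p -
  1).\<close>

lemma coeffs_dvd_mult:
  assumes sub: "\<And>i j. c (i + j) \<le> c i + c j" and "coeffs_dvd q c g" "coeffs_dvd q c h"
  shows "coeffs_dvd q c (g * h)"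
proof -
  obtain y z where y: "\<And>n. fps_nth g n = of_int (y n * q ^ c n)"
    and z: "\<And>n. fps_nth h n = of_int (z n * q ^ c n)"
    using assms(2,3) unfolding coeffs_dvd_def by metis
  have "\<exists>w. fps_nth (g * h) n = of_int (w * q ^ c n)" for n
  proof -
    have "fps_nth (g * h) n = of_int (\<Sum>i=0..n. y i * q ^ c i * (z (n - i) * q ^ c (n - i)))"
      by (simp add: fps_mult_nth y z)
    moreover have dvd: "q ^ c n dvd (\<Sum>i=0..n. y i * q ^ c i * (z (n - i) * q ^ c (n - i)))"
    proof (rule dvd_sum)
      fix i assume "i \<in> {0..n}"
      then have "c n \<le> c i + c (n - i)"
        using sub[of i "n - i"] by simp
      then have "q ^ c n dvd q ^ c i * q ^ c (n - i)"
        by (simp add: le_imp_power_dvd power_add [symmetric])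
      then have "q ^ c n dvd (y i * z (n - i)) * (q ^ c i * q ^ c (n - i))"
        by (rule dvd_mult)
      then show "q ^ c n dvd y i * q ^ c i * (z (n - i) * q ^ c (n - i))"
        by (simp add: mult_ac)
    qed
    moreover obtain w where "(\<Sum>i=0..n. y i * q ^ c i * (z (n - i) * q ^ c (n - i))) = q ^ c n * w"
      using dvd by (rule dvdE)
    ultimately show ?thesis
      by (intro exI[of _ w]) (simp only: mult.commute)
  qed
  then show ?thesis
    by (simp add: coeffs_dvd_def)
qed

lemma coeffs_dvd_power:
  assumes "\<And>i j. c (i + j) \<le> c i + c j" "c 0 = 0" "coeffs_dvd q c h"
  shows "coeffs_dvd q c (h ^ k)"
proof (induction k)
  case 0
  have "\<exists>z. fps_nth 1 n = (of_int (z * q ^ c n) :: rat)" for n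
    using assms(2) by (intro exI[of _ "if n = 0 then 1 else 0"]) simp
  then show ?case
    by (simp only: coeffs_dvd_def power_0) blast
next
  case (Suc k)
  then show ?case
    using coeffs_dvd_mult[OF assms(1) assms(3)] by simp
qed

text \<open>For h without constant term this is (1 + h)^b, with b of either sign: the generalized
  binomial coefficients are integers, so the bound for the powers of h carries over.\<close>

lemma coeffs_dvd_binomial_compose:
  assumes "\<And>i j. c (i + j) \<le> c i + c j" "c 0 = 0" "coeffs_dvd q c h"
  shows "coeffs_dvd q c (fps_binomial (of_int b) oo h)"
proof -
  have "\<exists>z. fps_nth (h ^ k) n = of_int (z * q ^ c n)" for k n
    using coeffs_dvd_power[OF assms, of k] by (simp add: coeffs_dvd_def)
  then obtain z where z: "\<And>k n. fps_nth (h ^ k) n = of_int (z k n * q ^ c n)"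
    by metis
  have "\<exists>y. (of_int b :: rat) gchoose k = of_int y" for k
    using gchoose_of_int_Ints[of b k] by (auto elim: Ints_cases)
  then obtain y where y: "\<And>k. (of_int b :: rat) gchoose k = of_int (y k)"
    by metis
  have "fps_nth (fps_binomial (of_int b) oo h) n = of_int ((\<Sum>i=0..n. y i * z i n) * q ^ c n)" for n
    by (simp add: fps_compose_nth y z sum_distrib_right mult.assoc)
  then show ?thesis
    unfolding coeffs_dvd_def by blast
qed

definition ceil_div :: "nat \<Rightarrow> nat \<Rightarrow> nat" where
  "ceil_div n m = (n + m - 1) div m"

text \<open>This equivalence characterises the ceiling quotient; subadditivity and the jumps of
  \<open>level\<close> are read off from it.\<close>

lemma ceil_div_le_iff:
  assumes "m > 0"
  shows "ceil_div n m \<le> k \<longleftrightarrow> n \<le> k * m"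
proof -
  have "ceil_div n m \<le> k \<longleftrightarrow> ceil_div n m < Suc k"
    by auto
  also have "\<dots> \<longleftrightarrow> n + m - 1 < Suc k * m"
    unfolding ceil_div_def using assms by (simp only: div_less_iff_less_mult)
  also have "\<dots> \<longleftrightarrow> n \<le> k * m"
    using assms by auto
  finally show ?thesis .
qed

lemma ceil_div_0 [simp]: "m > 0 \<Longrightarrow> ceil_div 0 m = 0"
  by (simp add: ceil_div_def)

lemma ceil_div_add_le:
  assumes "m > 0"
  shows "ceil_div (i + j) m \<le> ceil_div i m + ceil_div j m"
  using ceil_div_le_iff[OF assms, of i "ceil_div i m"] ceil_div_le_iff[OF assms, of j "ceil_div j m"]
    ceil_div_le_iff[OF assms, of "i + j"] by (simp add: add_mult_distrib)

lemma ceil_div_mono: "i \<le> j \<Longrightarrow> ceil_div i m \<le> ceil_div j m"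
  by (simp add: ceil_div_def div_le_mono)

lemma ceil_div_pos: "m > 0 \<Longrightarrow> i > 0 \<Longrightarrow> ceil_div i m > 0"
  using ceil_div_le_iff[of m i 0] by simp

text \<open>With \<open>F = 1 + X\<close> and \<open>s = X / F\<close>, the gamma series is the lambda series with \<open>s\<close>
  substituted for \<open>X\<close>. The gamma series of \<open>\<chi> - p\<close> at a nontrivial group element is
  \<open>(1 - X)\<^sup>p - (-X)\<^sup>p\<close>, since \<open>\<chi>\<close> has the lambda series \<open>1 - (-X)\<^sup>p\<close> there.\<close>

definition gamma_base :: "nat \<Rightarrow> rat fps" where
  "gamma_base p = (1 - fps_X) ^ p - (- fps_X) ^ p"

definition gamma_series :: "nat \<Rightarrow> int \<Rightarrow> rat fps" where
  "gamma_series p b = fps_binomial (of_int b) oo (gamma_base p - 1)"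

text \<open>The series X / (1 + X), compositional inverse of X / (1 - X). A gamma series is the
  lambda series at X / (1 - X), so composing with \<open>moebius_fps\<close> recovers the lambda
  series from the gamma series.\<close>

definition moebius_fps :: "rat fps" where
  "moebius_fps = fps_X * fps_binomial (-1)"

text \<open>The lambda series at a nontrivial group element of the virtual character of degree \<open>u\<close>
  with value \<open>u - p b\<close> there.\<close>

definition lambda_series :: "nat \<Rightarrow> int \<Rightarrow> int \<Rightarrow> rat fps" where
  "lambda_series p u b = fps_binomial (of_int u) * (gamma_series p b oo moebius_fps)"

lemma moebius_fps_nth_0 [simp]: "fps_nth moebius_fps 0 = 0"
  by (simp add: moebius_fps_def)

lemma moebius_fps_power: "moebius_fps ^ i = fps_X ^ i * fps_binomial (- of_nat i)"
  by (simp add: moebius_fps_def power_mult_distrib fps_binomial_power)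

text \<open>Both terms of \<open>gamma_base p\<close> have the coefficient (-1)^p at X^p; their
  cancellation lowers the degree to p - 1.\<close>

lemma gamma_base_minus_one_nth:
  assumes "p > 0"
  shows "fps_nth (gamma_base p - 1) n =
    (if 0 < n \<and> n < p then (-1) ^ n * of_nat (p choose n) else 0)"
proof -
  have "(1 - fps_X :: rat fps) = fps_of_poly [:1, -1:]"
    by (rule fps_ext) (auto simp: fps_X_nth coeff_pCons split: nat.split)
  moreover have "poly.coeff ([:1, -1:] ^ p) n = (-1) ^ n * (of_nat (p choose n) :: rat)"
  proof (cases "n \<le> p")
    case True
    then show ?thesis
      by (subst coeff_linear_poly_power) auto
  next
    case False
    then have "poly.coeff ([:1, -1:] ^ p) n = (0 :: rat)"
      by (intro coeff_eq_0) simp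
    then show ?thesis
      using False by (simp add: binomial_eq_0)
  qed
  ultimately have "fps_nth ((1 - fps_X :: rat fps) ^ p) n = (-1) ^ n * of_nat (p choose n)"
    by (simp only: fps_of_poly_power [symmetric] fps_of_poly_nth)
  moreover have "(- fps_X :: rat fps) ^ p = fps_const ((-1) ^ p) * fps_X ^ p"
    by (simp add: power_minus[of fps_X] fps_const_power [symmetric] flip: fps_const_neg)
  then have "fps_nth ((- fps_X :: rat fps) ^ p) n = (-1) ^ p * (if n = p then 1 else 0)"
    by (simp add: fps_X_power_iff)
  ultimately have "fps_nth (gamma_base p - 1) n =
      (-1) ^ n * of_nat (p choose n) - (-1) ^ p * (if n = p then 1 else 0) - (if n = 0 then 1 else 0)"
    by (simp add: gamma_base_def)
  then show ?thesis
    using assms by (auto simp: binomial_eq_0)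
qed

text \<open>For 0 < n < p the bound asks for exactly one factor p, which p choose n supplies; all
  other coefficients vanish.\<close>

lemma coeffs_dvd_gamma_base:
  assumes p: "Factorial_Ring.prime p"
  shows "coeffs_dvd (int p) (\<lambda>n. ceil_div n (p - 1)) (gamma_base p - 1)"
proof -
  have p1: "p > 1"
    using p prime_gt_1_nat by blast
  have "\<exists>z. fps_nth (gamma_base p - 1) n = of_int (z * int p ^ ceil_div n (p - 1))" for n
  proof (cases "0 < n \<and> n < p")
    case True
    then have "n \<le> 1 * (p - 1)"
      by auto
    then have "ceil_div n (p - 1) \<le> 1"
      using p1 by (subst ceil_div_le_iff) auto
    moreover have "ceil_div n (p - 1) > 0"
      using True p1 by (intro ceil_div_pos) auto
    ultimately have "ceil_div n (p - 1) = 1"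
      by linarith
    moreover have "p dvd p choose n"
      using True p by (intro dvd_choose_prime) auto
    then obtain k where "p choose n = p * k"
      by blast
    ultimately have "fps_nth (gamma_base p - 1) n =
        of_int ((-1) ^ n * int k * int p ^ ceil_div n (p - 1))"
      using True p1 by (subst gamma_base_minus_one_nth) auto
    then show ?thesis
      by blast
  next
    case False
    then have "fps_nth (gamma_base p - 1) n = of_int (0 * int p ^ ceil_div n (p - 1))"
      using p1 by (subst gamma_base_minus_one_nth) auto
    then show ?thesis
      by blast
  qed
  then show ?thesis
    by (simp add: coeffs_dvd_def)
qed

lemma gamma_series_dvd:
  assumes p: "Factorial_Ring.prime p"
  shows "\<exists>z. fps_nth (gamma_series p b) n = of_int (z * int p ^ ceil_div n (p - 1))"
proof -
  have p1: "p > 1"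
    using p prime_gt_1_nat by blast
  have "coeffs_dvd (int p) (\<lambda>n. ceil_div n (p - 1)) (gamma_series p b)"
    unfolding gamma_series_def
    using p1 by (intro coeffs_dvd_binomial_compose coeffs_dvd_gamma_base p ceil_div_add_le) auto
  then show ?thesis
    by (simp add: coeffs_dvd_def)
qed

lemma gamma_series_nth_0 [simp]: "fps_nth (gamma_series p b) 0 = 1"
  by (simp add: gamma_series_def)

lemma gamma_base_minus_one_nth_0: "p > 0 \<Longrightarrow> fps_nth (gamma_base p - 1) 0 = 0"
  by (subst gamma_base_minus_one_nth) auto

lemma gamma_series_0 [simp]: "gamma_series p 0 = 1"
  by (simp add: gamma_series_def)

lemma gamma_series_add:
  assumes "p > 0"
  shows "gamma_series p (b + b') = gamma_series p b * gamma_series p b'"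
  unfolding gamma_series_def of_int_add fps_binomial_add_mult
  by (rule fps_compose_mult_distrib [OF gamma_base_minus_one_nth_0 [OF assms]])

lemma gamma_series_of_nat:
  assumes "p > 0"
  shows "gamma_series p (int j) = gamma_base p ^ j"
proof -
  have "fps_nth (gamma_base p - 1) 0 = 0"
    using gamma_base_minus_one_nth_0[OF assms] .
  then have "gamma_series p 1 = gamma_base p"
    by (simp add: gamma_series_def fps_binomial_1 fps_compose_add_distrib)
  then show ?thesis
    by (induction j) (simp_all add: gamma_series_add[OF assms])
qed

lemma gamma_series_nth_1:
  assumes "p > 1"
  shows "fps_nth (gamma_series p b) 1 = - of_int b * of_nat p"
proof -
  have "fps_nth (gamma_base p - 1) (Suc 0) = - of_nat p"
    using assms by (subst gamma_base_minus_one_nth) auto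
  then show ?thesis
    by (simp add: gamma_series_def fps_compose_nth)
qed

text \<open>The constant term of s is zero, so powers of s beyond n do not reach degree n and the
  composition may be cut off there.\<close>

lemma mult_compose_nth:
  fixes g h s :: "'a::comm_ring_1 fps"
  assumes "fps_nth s 0 = 0"
  shows "fps_nth (h * (g oo s)) n = (\<Sum>i=0..n. fps_nth g i * fps_nth (h * s ^ i) n)"
proof -
  have lift: "fps_nth (g oo s) m = (\<Sum>i=0..n. fps_nth g i * fps_nth (s ^ i) m)" if "m \<le> n" for m
    unfolding fps_compose_nth
    using that startsby_zero_power_prefix[OF assms] by (intro sum.mono_neutral_left) auto
  have "fps_nth (h * (g oo s)) n =
      (\<Sum>j=0..n. fps_nth h j * (\<Sum>i=0..n. fps_nth g i * fps_nth (s ^ i) (n - j)))"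
    by (simp add: fps_mult_nth lift)
  also have "\<dots> = (\<Sum>i=0..n. \<Sum>j=0..n. fps_nth h j * (fps_nth g i * fps_nth (s ^ i) (n - j)))"
    unfolding sum_distrib_left by (rule sum.swap)
  also have "\<dots> = (\<Sum>i=0..n. fps_nth g i * fps_nth (h * s ^ i) n)"
    unfolding fps_mult_nth sum_distrib_left by (intro sum.cong refl mult.left_commute)
  finally show ?thesis .
qed

text \<open>Series form of gamma^n(x) = lambda^n(x + n - 1). With s = \<open>moebius_fps\<close>, (1
  + X)^(n - 1) s^i is X^i (1 + X)^(n - 1 - i), whose coefficient in degree n is n - 1 - i choose n -
  i: zero for i < n, and one for i = n, where the exponent is -1.\<close>

lemma lambda_series_eq_gamma_series_nth:
  "fps_nth (lambda_series p (int n - 1) b) n = fps_nth (gamma_series p b) n"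
proof -
  have "fps_nth (fps_binomial (of_int (int n - 1)) * moebius_fps ^ i) n = (if i = n then 1 else 0)"
    if "i \<in> {0..n}" for i
  proof -
    have "fps_binomial (of_int (int n - 1)) * moebius_fps ^ i =
        fps_X ^ i * fps_binomial (of_int (int n - 1) - of_nat i)"
      by (simp add: moebius_fps_power fps_binomial_add_mult [symmetric] mult_ac)
    then have "fps_nth (fps_binomial (of_int (int n - 1)) * moebius_fps ^ i) n =
        (of_int (int n - 1) - of_nat i) gchoose (n - i)"
      using that by (simp add: fps_X_power_mult_nth)
    also have "\<dots> = (if i = n then 1 else 0)"
    proof (cases "i = n")
      case False
      then have eq: "of_int (int n - 1) - of_nat i = (of_nat (n - 1 - i) :: rat)"
        using that by (simp add: of_nat_diff)
      have "n - 1 - i choose (n - i) = 0"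
        using False that by (intro binomial_eq_0) auto
      then show ?thesis
        using False by (simp only: eq binomial_gbinomial [symmetric]) simp
    qed simp
    finally show ?thesis .
  qed
  then have "(\<Sum>i=0..n. fps_nth (gamma_series p b) i *
        fps_nth (fps_binomial (of_int (int n - 1)) * moebius_fps ^ i) n) =
      (\<Sum>i=0..n. fps_nth (gamma_series p b) i * (if i = n then 1 else 0))"
    by (intro sum.cong refl) simp
  also have "\<dots> = fps_nth (gamma_series p b) n"
    by (simp add: if_distrib[of "(*) _"] cong: if_cong)
  finally show ?thesis
    unfolding lambda_series_def by (subst mult_compose_nth) simp_all
qed

lemma lambda_series_add:
  assumes "p > 0"
  shows "lambda_series p (u + u') (b + b') = lambda_series p u b * lambda_series p u' b'"
  by (simp add: lambda_series_def gamma_series_add[OF assms] fps_compose_mult_distrib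
      fps_binomial_add_mult mult_ac)

lemma lambda_series_0: "lambda_series p u 0 = fps_binomial (of_int u)"
  by (simp add: lambda_series_def)

lemma lambda_series_nth_0 [simp]: "fps_nth (lambda_series p u b) 0 = 1"
  by (simp add: lambda_series_def)

lemma lambda_series_nth_1:
  assumes "p > 1"
  shows "fps_nth (lambda_series p u b) 1 = of_int (u - int p * b)"
proof -
  have "fps_nth (lambda_series p 0 b) 1 = - of_int b * of_nat p"
    using lambda_series_eq_gamma_series_nth[of p 1 b] gamma_series_nth_1[OF assms, of b] by simp
  moreover have "lambda_series p u b = fps_binomial (of_int u) * lambda_series p 0 b"
    by (simp add: lambda_series_def)
  ultimately show ?thesis
    by (simp add: fps_mult_nth)
qed

text \<open>Membership in R needs the value off the identity to be congruent modulo p to the one at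
  the identity. All gamma coefficients of positive degree are divisible by p, which leaves the term
  i = 0, the coefficient of (1 + X)^u.\<close>

lemma lambda_series_integral:
  assumes p: "Factorial_Ring.prime p"
  shows "\<exists>z w. fps_nth (fps_binomial (of_int u :: rat)) n = of_int z \<and>
    fps_nth (lambda_series p u b) n = of_int (z - int p * w)"
proof -
  have p1: "p > 1"
    using p prime_gt_1_nat by blast
  have int_binom: "fps_nth (fps_binomial (of_int a :: rat)) k \<in> \<int>" for a k
    using gchoose_of_int_Ints by simp
  have int_mult: "fps_nth (g * h) k \<in> \<int>"
    if "\<And>k. fps_nth g k \<in> \<int>" "\<And>k. fps_nth h k \<in> \<int>" for g h :: "rat fps" and k
    using that by (auto simp: fps_mult_nth intro!: Ints_sum Ints_mult)
  have "fps_nth (fps_binomial (of_int u) * moebius_fps ^ i) n \<in> \<int>" for i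
  proof -
    have "fps_nth (fps_X ^ i * fps_binomial (of_int (- int i)) :: rat fps) k \<in> \<int>" for k
      using int_binom[of "- int i"] by (simp add: fps_X_power_mult_nth)
    then show ?thesis
      using int_binom by (intro int_mult) (simp_all add: moebius_fps_power)
  qed
  then have "\<exists>y. fps_nth (fps_binomial (of_int u) * moebius_fps ^ i) n = of_int y" for i
    by (auto elim: Ints_cases)
  then obtain y where y: "\<And>i. fps_nth (fps_binomial (of_int u) * moebius_fps ^ i) n = of_int (y i)"
    by metis
  have "\<exists>w. fps_nth (gamma_series p b) i = of_int (w * int p)" if "i > 0" for i
  proof -
    obtain z where z: "fps_nth (gamma_series p b) i = of_int (z * int p ^ ceil_div i (p - 1))"
      using gamma_series_dvd[OF p] by blast
    have "ceil_div i (p - 1) > 0"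
      using that p1 by (intro ceil_div_pos) auto
    then obtain k where "ceil_div i (p - 1) = Suc k"
      using gr0_conv_Suc by blast
    with z show ?thesis
      by (intro exI[of _ "z * int p ^ k"]) (simp add: mult_ac)
  qed
  then obtain w where w: "\<And>i. i > 0 \<Longrightarrow> fps_nth (gamma_series p b) i = of_int (w i * int p)"
    by metis
  have "fps_nth (lambda_series p u b) n = (\<Sum>i=0..n. fps_nth (gamma_series p b) i * of_int (y i))"
    by (simp add: lambda_series_def mult_compose_nth y)
  also have "\<dots> = of_int (y 0) + (\<Sum>i\<in>{0<..n}. of_int (w i * int p) * of_int (y i))"
  proof -
    have "{0..n} = insert 0 {0<..n}"
      by auto
    then show ?thesis
      using w by (simp del: of_int_mult)
  qed
  also have "\<dots> = of_int (y 0 - int p * - (\<Sum>i\<in>{0<..n}. w i * y i))"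
    by (simp add: sum_distrib_left mult_ac)
  finally have "fps_nth (lambda_series p u b) n =
      of_int (y 0 - int p * - (\<Sum>i\<in>{0<..n}. w i * y i))" .
  moreover have "fps_nth (fps_binomial (of_int u :: rat)) n = of_int (y 0)"
    using y[of 0] by simp
  ultimately show ?thesis
    by blast
qed

text \<open>For s = X / (1 + X) one has 1 - s = 1 / (1 + X), so both terms have the denominator (1 +
  X)^p. The factor 1 - (-X)^p is the lambda series of the regular character, and (1 + X)^(-p)
  accounts for subtracting p.\<close>

lemma gamma_base_compose_moebius:
  "gamma_base p oo moebius_fps = fps_binomial (- of_nat p) * (1 - (- fps_X) ^ p)"
proof -
  have "(1 + fps_X) * fps_binomial (-1) = (1 :: rat fps)"
    using fps_binomial_add_mult[of 1 "-1 :: rat"] by (simp add: fps_binomial_1)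
  then have "1 - moebius_fps = fps_binomial (-1)"
    by (simp add: moebius_fps_def algebra_simps)
  moreover have "gamma_base p oo moebius_fps = (1 - moebius_fps) ^ p - (- moebius_fps) ^ p"
    by (simp add: gamma_base_def fps_compose_sub_distrib fps_compose_power [symmetric] fps_compose_uminus)
  moreover have "(- moebius_fps) ^ p = (- fps_X) ^ p * fps_binomial (- of_nat p)"
    by (simp add: power_minus[of moebius_fps] power_minus[of fps_X] moebius_fps_power)
  ultimately have "gamma_base p oo moebius_fps =
      fps_binomial (-1) ^ p - (- fps_X) ^ p * fps_binomial (- of_nat p)"
    by (simp only:)
  then show ?thesis
    by (simp add: fps_binomial_power algebra_simps)
qed

section \<open>Exterior powers and the characteristic polynomial\<close>

definition exterior_trace_poly :: "rat mat \<Rightarrow> rat poly" where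
  "exterior_trace_poly A = (\<Sum>S\<in>Pow {0..<dim_row A}. Polynomial.monom (principal_minor A S) (card S))"

lemma coeff_exterior_trace_poly:
  assumes A: "A \<in> carrier_mat d d"
  shows "poly.coeff (exterior_trace_poly A) n = mat_trace (exterior_power_mat n A)"
proof -
  have "poly.coeff (exterior_trace_poly A) n =
      (\<Sum>S\<in>Pow {0..<d}. if card S = n then principal_minor A S else 0)"
    using A by (simp add: exterior_trace_poly_def coeff_sum)
  also have "\<dots> = (\<Sum>S\<in>{S \<in> Pow {0..<d}. card S = n}. principal_minor A S)"
    by (rule sum.inter_filter [symmetric]) simp
  also have "{S \<in> Pow {0..<d}. card S = n} = {S. S \<subseteq> {0..<d} \<and> card S = n}"
    by auto
  finally show ?thesis
    by (simp only: trace_exterior_power_mat[OF A])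
qed

lemma poly_exterior_trace_poly:
  assumes A: "A \<in> carrier_mat d d"
  shows "poly (exterior_trace_poly A) t = det (1\<^sub>m d + t \<cdot>\<^sub>m A)"
  using A by (simp add: exterior_trace_poly_def poly_sum poly_monom det_one_plus_expansion mult.commute)

lemma mat_trace_eq_exterior:
  fixes A :: "rat mat"
  assumes A: "A \<in> carrier_mat d d"
  shows "mat_trace (exterior_power_mat 1 A) = mat_trace A"
proof -
  have "principal_minor A {i} = A $$ (i, i)" for i
    by (simp add: principal_minor_def)
  moreover have "{S. S \<subseteq> {0..<d} \<and> card S = 1} = (\<lambda>i. {i}) ` {0..<d}"
    by (auto simp: card_1_singleton_iff)
  moreover have "inj_on (\<lambda>i. {i}) {0..<d}"
    by simp
  ultimately have "mat_trace (exterior_power_mat 1 A) = (\<Sum>i\<in>{0..<d}. A $$ (i, i))"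
    by (simp only: trace_exterior_power_mat[OF A] sum.reindex o_def)
  then show ?thesis
    using A by (simp only: mat_trace_def carrier_matD atLeast0LessThan)
qed

lemma poly_exterior_trace_poly_char_poly:
  assumes A: "A \<in> carrier_mat d d" and t: "t \<noteq> 0"
  shows "poly (exterior_trace_poly A) t = (-t) ^ d * poly (char_poly A) (-1 / t)"
proof -
  let ?M = "(-1 / t) \<cdot>\<^sub>m 1\<^sub>m d - A"
  have "poly (char_poly A) (-1 / t) = det (map_mat (\<lambda>f. poly f (-1 / t)) ([:0, 1:] \<cdot>\<^sub>m 1\<^sub>m d - const_poly_mat A))"
    unfolding char_poly_alt[OF A]
    by (rule comm_ring_hom.hom_det[OF poly_hom.comm_ring_hom_axioms, symmetric])
  also have "map_mat (\<lambda>f. poly f (-1 / t)) ([:0, 1:] \<cdot>\<^sub>m 1\<^sub>m d - const_poly_mat A) = ?M"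
    using A by (intro eq_matI) (auto simp: const_poly_mat_def)
  finally have "(-t) ^ d * poly (char_poly A) (-1 / t) = det ((-t) \<cdot>\<^sub>m ?M)"
    using A by (simp add: det_smult)
  also have "(-t) \<cdot>\<^sub>m ?M = 1\<^sub>m d + t \<cdot>\<^sub>m A"
    using A t by (intro eq_matI) (auto simp: field_simps)
  finally show ?thesis
    using poly_exterior_trace_poly[OF A] by simp
qed

text \<open>Each factor X - 1 of the characteristic polynomial contributes 1 + t to det(1 + t A),
  each factor Phi_p contributes (1 - (-t)^p) / (1 + t). Multiplying by (1 + t)^j clears the
  denominators, and the exponents match because j + d - p j = i.\<close>

lemma exterior_trace_series:
  assumes p: "Factorial_Ring.prime p" and A: "A \<in> carrier_mat d d"
    and cp: "char_poly A = [:-1, 1:] ^ i * cyclo_poly p ^ j" and d: "d = i + (p - 1) * j"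
  shows "fps_nth (lambda_series p (int d) (int j)) n = mat_trace (exterior_power_mat n A)"
proof -
  have p1: "p > 1"
    using p prime_gt_1_nat by blast
  have "[:1, 1:] ^ j * exterior_trace_poly A = [:1, 1:] ^ i * (1 - (- [:0, 1:]) ^ p) ^ j"
  proof (rule poly_ext)
    fix t :: rat
    show "poly ([:1, 1:] ^ j * exterior_trace_poly A) t = poly ([:1, 1:] ^ i * (1 - (- [:0, 1:]) ^ p) ^ j) t"
    proof (cases "t = 0")
      \<comment> \<open>The substitution x = -1 / t excludes t = 0, where both sides are 1.\<close>
      case True
      have "1\<^sub>m d + 0 \<cdot>\<^sub>m A = 1\<^sub>m d"
        using A by (intro eq_matI) auto
      then show ?thesis
        using A p1 True by (simp add: poly_exterior_trace_poly zero_power)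
    next
      case False
      define x where "x = -1 / t"
      define C where "C = poly (cyclo_poly p) x"
      have tx: "(-t) * x = 1"
        using False by (simp add: x_def)
      have tx1: "(-t) * (x - 1) = 1 + t"
        using tx by (simp add: right_diff_distrib)
      have "poly (cyclo_poly p * [:-1, 1:]) x = x ^ p - 1"
        unfolding cyclo_poly_mult by (simp add: poly_monom)
      then have "C * (x - 1) = x ^ p - 1"
        by (simp add: C_def algebra_simps)
      then have "(-t) ^ p * (C * (x - 1)) = ((-t) * x) ^ p - (-t) ^ p"
        by (simp only: power_mult_distrib right_diff_distrib mult_1_right)
      moreover have "(-t) ^ p = (-t) ^ (p - 1) * (-t)"
        using p1 by (cases p) auto
      then have "(-t) ^ p * (C * (x - 1)) = ((-t) * (x - 1)) * ((-t) ^ (p - 1) * C)"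
        by (simp only: mult_ac)
      ultimately have *: "(1 + t) * ((-t) ^ (p - 1) * C) = 1 - (-t) ^ p"
        by (simp only: tx tx1 power_one)
      have "poly (char_poly A) x = (x - 1) ^ i * C ^ j"
        by (simp add: cp C_def)
      then have "poly (exterior_trace_poly A) t = (-t) ^ d * ((x - 1) ^ i * C ^ j)"
        using poly_exterior_trace_poly_char_poly[OF A False] by (simp only: x_def)
      also have "\<dots> = ((-t) * (x - 1)) ^ i * ((-t) ^ (p - 1) * C) ^ j"
        by (simp only: d power_add power_mult power_mult_distrib) (simp only: mult_ac)
      finally have "(1 + t) ^ j * poly (exterior_trace_poly A) t =
          (1 + t) ^ i * ((1 + t) * ((-t) ^ (p - 1) * C)) ^ j"
        by (simp only: tx1 power_mult_distrib mult_ac)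
      then show ?thesis
        unfolding * by simp
    qed
  qed
  then have "fps_of_poly ([:1, 1:] ^ j * exterior_trace_poly A) =
      fps_of_poly ([:1, 1:] ^ i * (1 - (- [:0, 1:]) ^ p) ^ j)"
    by simp
  moreover have "fps_of_poly [:1, 1:] = (1 + fps_X :: rat fps)"
    by (rule fps_ext) (auto simp: fps_X_nth coeff_pCons split: nat.split)
  ultimately have ext: "(1 + fps_X) ^ j * fps_of_poly (exterior_trace_poly A) =
      (1 + fps_X) ^ i * (1 - (- fps_X) ^ p) ^ j"
    by (simp add: fps_of_poly_mult fps_of_poly_power fps_of_poly_diff fps_of_poly_uminus)
  have "gamma_series p (int j) oo moebius_fps =
      fps_binomial (- of_nat (p * j)) * (1 - (- fps_X) ^ p) ^ j"
    using p1 gamma_series_of_nat[of p j] fps_compose_power[OF moebius_fps_nth_0, of "gamma_base p" j]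
    by (simp add: gamma_base_compose_moebius power_mult_distrib fps_binomial_power mult.commute)
  then have "fps_binomial (of_nat j) * lambda_series p (int d) (int j) =
      fps_binomial (of_nat j + of_nat d - of_nat (p * j)) * (1 - (- fps_X) ^ p) ^ j"
    by (simp only: lambda_series_def fps_binomial_add_mult diff_conv_add_uminus mult.assoc of_int_of_nat_eq)
  also have "of_nat j + of_nat d - of_nat (p * j) = (of_nat i :: rat)"
  proof -
    have "j + d = i + p * j"
      using d p1 by (cases p) auto
    then have "(of_nat (j + d) :: rat) = of_nat (i + p * j)"
      by simp
    then show ?thesis
      by simp
  qed
  finally have "(1 + fps_X) ^ j * lambda_series p (int d) (int j) =
      (1 + fps_X) ^ j * fps_of_poly (exterior_trace_poly A)"
    by (simp only: fps_binomial_of_nat ext)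
  moreover have "fps_nth ((1 + fps_X :: rat fps) ^ j) 0 = 1"
    by (simp flip: fps_binomial_of_nat)
  then have "(1 + fps_X :: rat fps) ^ j \<noteq> 0"
    by (metis fps_zero_nth zero_neq_one)
  ultimately have "lambda_series p (int d) (int j) = fps_of_poly (exterior_trace_poly A)"
    by (simp only: mult_cancel_left) blast
  then show ?thesis
    using coeff_exterior_trace_poly[OF A] by simp
qed

section \<open>Rational representations of the cyclic group\<close>

lemma rat_rep_mat:
  assumes "rat_rep G d \<rho>" "g \<in> carrier G"
  shows "\<rho> g \<in> carrier_mat d d"
  using assms by (auto simp: rat_rep_def hom_def units_of_def Units_def ring_mat_simps)

lemma rat_rep_mult:
  assumes "rat_rep G d \<rho>" "g \<in> carrier G" "h \<in> carrier G"
  shows "\<rho> (g \<otimes>\<^bsub>G\<^esub> h) = \<rho> g * \<rho> h"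
  using assms by (auto simp: rat_rep_def hom_def units_of_def ring_mat_simps)

lemma rat_rep_one:
  assumes G: "group G" and rep: "rat_rep G d \<rho>"
  shows "\<rho> \<one>\<^bsub>G\<^esub> = 1\<^sub>m d"
proof -
  have "group (units_of (ring_mat TYPE(rat) d ()))"
    by (rule monoid.units_group[OF ring.is_monoid[OF ring_mat]])
  then have "\<rho> \<one>\<^bsub>G\<^esub> = \<one>\<^bsub>units_of (ring_mat TYPE(rat) d ())\<^esub>"
    using hom_one[of \<rho> G "units_of (ring_mat TYPE(rat) d ())"] rep G by (simp add: rat_rep_def)
  then show ?thesis
    by (simp add: units_of_def ring_mat_simps)
qed

lemma rat_rep_pow:
  assumes G: "group G" and rep: "rat_rep G d \<rho>" and g: "g \<in> carrier G"
  shows "\<rho> (g [^]\<^bsub>G\<^esub> (k :: nat)) = \<rho> g ^\<^sub>m k"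
proof -
  interpret G: group G
    by fact
  show ?thesis
  proof (induction k)
    case 0
    then show ?case
      using rat_rep_mat[OF rep g] by (simp add: rat_rep_one[OF G rep] carrier_matD)
  next
    case (Suc k)
    then show ?case
      using g by (simp add: rat_rep_mult[OF rep])
  qed
qed

lemma rat_repI:
  assumes G: "group G"
    and mat: "\<And>g. g \<in> carrier G \<Longrightarrow> \<rho> g \<in> carrier_mat d d"
    and mult: "\<And>g h. g \<in> carrier G \<Longrightarrow> h \<in> carrier G \<Longrightarrow> \<rho> (g \<otimes>\<^bsub>G\<^esub> h) = \<rho> g * \<rho> h"
    and one: "\<rho> \<one>\<^bsub>G\<^esub> = 1\<^sub>m d"
  shows "rat_rep G d \<rho>"
proof -
  interpret G: group G
    by fact
  have "\<rho> g \<in> Units (ring_mat TYPE(rat) d ())" if g: "g \<in> carrier G" for g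
  proof -
    have "\<rho> (inv\<^bsub>G\<^esub> g) * \<rho> g = 1\<^sub>m d" "\<rho> g * \<rho> (inv\<^bsub>G\<^esub> g) = 1\<^sub>m d"
      using g one by (simp_all add: mult [symmetric])
    moreover have "\<rho> (inv\<^bsub>G\<^esub> g) \<in> carrier_mat d d" "\<rho> g \<in> carrier_mat d d"
      using g by (simp_all add: mat)
    ultimately show ?thesis
      unfolding Units_def ring_mat_simps by blast
  qed
  then show ?thesis
    using mult by (auto simp: rat_rep_def hom_def units_of_def ring_mat_simps)
qed

text \<open>The matrix of multiplication by \<open>q\<close> on \<open>\<rat>[X] / (\<Phi>)\<close> in the basis of the powers of \<open>X\<close>.\<close>

definition mult_mat :: "rat poly \<Rightarrow> rat poly \<Rightarrow> rat mat" where
  "mult_mat \<Phi> q = mat (Polynomial.degree \<Phi>) (Polynomial.degree \<Phi>)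
     (\<lambda>(i, j). poly.coeff ((q * Polynomial.monom 1 j) mod \<Phi>) i)"

definition coeff_vec :: "nat \<Rightarrow> rat poly \<Rightarrow> rat vec" where
  "coeff_vec n f = vec n (poly.coeff f)"

lemma mult_mat_carrier [simp]:
  "mult_mat \<Phi> q \<in> carrier_mat (Polynomial.degree \<Phi>) (Polynomial.degree \<Phi>)"
  by (simp add: mult_mat_def)

lemma sum_poly_mod: "finite A \<Longrightarrow> (\<Sum>i\<in>A. f i) mod q = (\<Sum>i\<in>A. f i mod (q :: 'a::field poly))"
  by (induction A rule: finite_induct) (simp_all add: poly_mod_add_left)

lemma poly_eq_sum_monom:
  assumes "Polynomial.degree f < n"
  shows "f = (\<Sum>i<n. Polynomial.monom (poly.coeff f i) i)"
proof (rule poly_eqI)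
  fix k
  show "poly.coeff f k = poly.coeff (\<Sum>i<n. Polynomial.monom (poly.coeff f i) i) k"
    using assms by (simp add: coeff_sum coeff_eq_0)
qed

lemma mult_mat_coeff_vec:
  assumes f: "Polynomial.degree f < Polynomial.degree \<Phi>"
  shows "mult_mat \<Phi> q *\<^sub>v coeff_vec (Polynomial.degree \<Phi>) f = coeff_vec (Polynomial.degree \<Phi>) ((q * f) mod \<Phi>)"
proof (rule eq_vecI)
  let ?n = "Polynomial.degree \<Phi>"
  fix i assume "i < dim_vec (coeff_vec ?n ((q * f) mod \<Phi>))"
  then have i: "i < ?n"
    by (simp add: coeff_vec_def)
  have "(mult_mat \<Phi> q *\<^sub>v coeff_vec ?n f) $ i =
      (\<Sum>j<?n. poly.coeff ((q * Polynomial.monom 1 j) mod \<Phi>) i * poly.coeff f j)"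
    using i by (simp add: mult_mat_def coeff_vec_def scalar_prod_def atLeast0LessThan)
  also have "\<dots> = poly.coeff (\<Sum>j<?n. (q * Polynomial.monom (poly.coeff f j) j) mod \<Phi>) i"
  proof -
    have *: "q * Polynomial.monom c j = smult c (q * Polynomial.monom 1 j)" for c j
      by (simp only: mult_smult_right [symmetric] smult_monom mult_1_right)
    have "smult c ((q * Polynomial.monom 1 j) mod \<Phi>) = (q * Polynomial.monom c j) mod \<Phi>" for c j
      by (subst *) (rule mod_smult_left [symmetric])
    then show ?thesis
      unfolding coeff_sum by (intro sum.cong refl) (metis coeff_smult mult.commute)
  qed
  also have "(\<Sum>j<?n. (q * Polynomial.monom (poly.coeff f j) j) mod \<Phi>) = (q * f) mod \<Phi>"
    using arg_cong[OF poly_eq_sum_monom[OF f], of "\<lambda>h. (q * h) mod \<Phi>"]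
    by (simp add: sum_poly_mod sum_distrib_left)
  finally show "(mult_mat \<Phi> q *\<^sub>v coeff_vec ?n f) $ i = coeff_vec ?n ((q * f) mod \<Phi>) $ i"
    using i by (simp add: coeff_vec_def)
qed (simp add: mult_mat_def coeff_vec_def)

lemma mult_mat_mult:
  assumes "Polynomial.degree \<Phi> > 0"
  shows "mult_mat \<Phi> (q * r) = mult_mat \<Phi> q * mult_mat \<Phi> r"
proof (rule eq_matI)
  let ?n = "Polynomial.degree \<Phi>"
  fix i j assume "i < dim_row (mult_mat \<Phi> q * mult_mat \<Phi> r)" "j < dim_col (mult_mat \<Phi> q * mult_mat \<Phi> r)"
  then have ij: "i < ?n" "j < ?n"
    by (simp_all add: mult_mat_def)
  let ?f = "(r * Polynomial.monom 1 j) mod \<Phi>"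
  have "\<Phi> \<noteq> 0"
    using assms by auto
  then have deg: "Polynomial.degree ?f < ?n"
    using degree_mod_less[of \<Phi> "r * Polynomial.monom 1 j"] assms by auto
  have "col (mult_mat \<Phi> r) j = coeff_vec ?n ?f"
    using ij by (intro eq_vecI) (auto simp: mult_mat_def coeff_vec_def)
  then have "(mult_mat \<Phi> q * mult_mat \<Phi> r) $$ (i, j) = (mult_mat \<Phi> q *\<^sub>v coeff_vec ?n ?f) $ i"
    using ij by (simp add: mult_mat_def)
  also have "\<dots> = poly.coeff ((q * ?f) mod \<Phi>) i"
    using ij by (simp add: mult_mat_coeff_vec[OF deg]) (simp add: coeff_vec_def)
  also have "(q * ?f) mod \<Phi> = (q * r * Polynomial.monom 1 j) mod \<Phi>"
    by (simp add: mod_mult_right_eq mult.assoc)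
  finally show "mult_mat \<Phi> (q * r) $$ (i, j) = (mult_mat \<Phi> q * mult_mat \<Phi> r) $$ (i, j)"
    using ij by (simp add: mult_mat_def)
qed (simp_all add: mult_mat_def)

lemma mult_mat_cong:
  assumes "q mod \<Phi> = r mod \<Phi>"
  shows "mult_mat \<Phi> q = mult_mat \<Phi> r"
proof -
  have "(q * h) mod \<Phi> = (r * h) mod \<Phi>" for h
    using assms by (metis mod_mult_left_eq)
  then show ?thesis
    by (simp add: mult_mat_def)
qed

lemma mult_mat_one: "mult_mat \<Phi> 1 = 1\<^sub>m (Polynomial.degree \<Phi>)"
proof (rule eq_matI)
  fix i j assume "i < dim_row (1\<^sub>m (Polynomial.degree \<Phi>) :: rat mat)" "j < dim_col (1\<^sub>m (Polynomial.degree \<Phi>) :: rat mat)"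
  then show "mult_mat \<Phi> 1 $$ (i, j) = 1\<^sub>m (Polynomial.degree \<Phi>) $$ (i, j)"
    by (auto simp: mult_mat_def mod_poly_less degree_monom_eq)
qed (simp_all add: mult_mat_def)

text \<open>Under \<open>coeff_vec\<close>, an invariant subspace is an ideal of the field \<open>\<rat>[X] / (\<Phi>)\<close>.\<close>

lemma mult_mat_X_irreducible:
  assumes prime: "prime_elem \<Phi>"
    and W: "VectorSpace.subspace class_ring W (module_vec TYPE(rat) (Polynomial.degree \<Phi>))"
    and inv: "\<And>w. w \<in> W \<Longrightarrow> mult_mat \<Phi> [:0, 1:] *\<^sub>v w \<in> W"
  shows "W = {0\<^sub>v (Polynomial.degree \<Phi>)} \<or> W = carrier_vec (Polynomial.degree \<Phi>)"
proof (cases "W = {0\<^sub>v (Polynomial.degree \<Phi>)}")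
  case False
  let ?n = "Polynomial.degree \<Phi>" and ?V = "module_vec TYPE(rat) (Polynomial.degree \<Phi>)"
  have sub: "submodule class_ring W ?V"
    using W by (simp add: subspace_def)
  have W_sub: "W \<subseteq> carrier_vec ?n" and W0: "0\<^sub>v ?n \<in> W"
    using submodule.subset[OF sub] submodule.zero_closed[OF sub] by (simp_all add: module_vec_simps)
  have W_add: "v + w \<in> W" if "v \<in> W" "w \<in> W" for v w
    using submodule.m_closed[OF sub] that by (simp add: module_vec_simps)
  have W_smult: "c \<cdot>\<^sub>v w \<in> W" if "w \<in> W" for c w
    using submodule.smult_closed[OF sub, of c w] that by (simp add: module_vec_simps class_ring_simps)
  have deg_pos: "?n > 0"
    using prime prime_elem_not_unit[of \<Phi>] by (metis is_unit_iff_degree neq0_conv not_prime_elem_zero)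
  have vec: "\<exists>f. Polynomial.degree f < ?n \<and> w = coeff_vec ?n f" if "w \<in> carrier_vec ?n" for w
  proof -
    let ?f = "\<Sum>i<?n. Polynomial.monom (w $ i) i"
    have coeff: "poly.coeff ?f k = (if k < ?n then w $ k else 0)" for k
      by (simp add: coeff_sum)
    have "Polynomial.degree ?f < ?n"
      using deg_pos by (intro degree_lessI) (auto simp: coeff)
    moreover have "w = coeff_vec ?n ?f"
      using that by (intro eq_vecI) (auto simp: coeff_vec_def coeff)
    ultimately show ?thesis
      by blast
  qed
  obtain w where w: "w \<in> W" "w \<noteq> 0\<^sub>v ?n"
    using False W0 by blast
  then obtain f where f: "Polynomial.degree f < ?n" "w = coeff_vec ?n f"
    using vec W_sub by blast
  have "f \<noteq> 0"
    using w(2) unfolding f(2) by (auto simp: coeff_vec_def)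
  then have "\<not> \<Phi> dvd f"
    using f(1) by (auto dest: dvd_imp_degree_le)
  then have "Rings.coprime \<Phi> f"
    by (rule prime_elem_imp_coprime[OF prime])
  then have "gcd f \<Phi> = 1"
    by (simp add: gcd.commute coprime_iff_gcd_eq_1)
  \<comment> \<open>Thus f is invertible modulo Phi with inverse a, and g is the remainder of (g a)
    f, a multiple of f, for every g of smaller degree.\<close>
  then obtain a b where ab: "a * f + b * \<Phi> = 1"
    using bezout_coefficients_fst_snd[of f \<Phi>] by metis
  have ideal: "coeff_vec ?n ((h * f) mod \<Phi>) \<in> W" for h
  proof (induction h)
    case 0
    have "coeff_vec ?n 0 = 0\<^sub>v ?n"
      by (intro eq_vecI) (auto simp: coeff_vec_def)
    then show ?case
      using W0 by simp
  next
    case (pCons c h)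
    have less: "Polynomial.degree ((h * f) mod \<Phi>) < ?n"
      using degree_mod_less[of \<Phi> "h * f"] deg_pos by fastforce
    have "(pCons c h * f) mod \<Phi> = smult c f + ([:0, 1:] * ((h * f) mod \<Phi>)) mod \<Phi>"
      using f(1) by (simp add: poly_mod_add_left mod_poly_less mod_mult_right_eq
          del: mult_pCons_left) (simp add: poly_mod_add_left mod_smult_left mod_poly_less)
    then have "coeff_vec ?n ((pCons c h * f) mod \<Phi>) =
        c \<cdot>\<^sub>v coeff_vec ?n f + mult_mat \<Phi> [:0, 1:] *\<^sub>v coeff_vec ?n ((h * f) mod \<Phi>)"
      unfolding mult_mat_coeff_vec[OF less] by (intro eq_vecI) (auto simp: coeff_vec_def)
    then show ?case
      using W_add W_smult inv pCons w(1) f(2) by simp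
  qed
  have "v \<in> W" if "v \<in> carrier_vec ?n" for v
  proof -
    obtain g where g: "Polynomial.degree g < ?n" "v = coeff_vec ?n g"
      using vec \<open>v \<in> carrier_vec ?n\<close> by blast
    have "g * a * f = g - g * b * \<Phi>"
      using arg_cong[OF ab, of "\<lambda>h. g * h"] by (simp add: algebra_simps)
    then have "(g * a * f) mod \<Phi> = g"
      using g(1) by (simp add: poly_mod_diff_left mod_poly_less)
    then show ?thesis
      using ideal[of "g * a"] g(2) by simp
  qed
  then show ?thesis
    using W_sub by blast
qed simp

lemma irreducible_trivial_rep:
  assumes "group G"
  shows "irreducible_rat_rep G 1 (\<lambda>_. 1\<^sub>m 1)"
proof -
  have "W = {0\<^sub>v 1} \<or> W = carrier_vec 1"
    if W: "VectorSpace.subspace class_ring W (module_vec TYPE(rat) 1)" for W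
  proof (cases "W = {0\<^sub>v 1}")
    case False
    have sub: "submodule class_ring W (module_vec TYPE(rat) 1)"
      using W by (simp add: subspace_def)
    have W_sub: "W \<subseteq> carrier_vec 1" and "0\<^sub>v 1 \<in> W"
      using submodule.subset[OF sub] submodule.zero_closed[OF sub] by (simp_all add: module_vec_simps)
    then obtain w where w: "w \<in> W" "w \<noteq> 0\<^sub>v 1"
      using False by blast
    then have w1: "w $ 0 \<noteq> 0"
      using W_sub by (auto simp: vec_eq_iff)
    have "v \<in> W" if "v \<in> carrier_vec 1" for v
    proof -
      have "v = (v $ 0 / w $ 0) \<cdot>\<^sub>v w"
        using that w W_sub w1 by (intro eq_vecI) auto
      then show ?thesis
        using submodule.smult_closed[OF sub, of "v $ 0 / w $ 0" w] w(1)
        by (simp add: module_vec_simps class_ring_simps)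
    qed
    then show ?thesis
      using W_sub by blast
  qed simp
  moreover have "rat_rep G 1 (\<lambda>_. 1\<^sub>m 1)"
    by (rule rat_repI[OF assms]) auto
  ultimately show ?thesis
    by (simp add: irreducible_rat_rep_def)
qed

locale prime_cyclic_group =
  fixes p :: nat
  assumes prime: "Factorial_Ring.prime p"
begin

abbreviation G :: "int monoid" where
  "G \<equiv> integer_mod_group p"

lemma p_gt_1: "p > 1"
  using prime prime_gt_1_nat by blast

lemma carrier_G: "carrier G = {0..<int p}"
  using p_gt_1 by (simp add: carrier_integer_mod_group)

lemma group_G: "group G"
  by simp

text \<open>The action on Q[X]/(Phi_p) in which the generator 1 multiplies by X. Group elements are
  the residues from 0 to p - 1, so \<open>nat\<close> loses nothing.\<close>

definition cyclo_rep :: "int \<Rightarrow> rat mat" where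
  "cyclo_rep g = mult_mat (cyclo_poly p) (Polynomial.monom 1 (nat g))"

text \<open>X^p is 1 modulo Phi_p, so exponents only matter modulo p.\<close>

lemma monom_mod_cyclo:
  "(Polynomial.monom 1 (k mod p) :: rat poly) mod cyclo_poly p = Polynomial.monom 1 k mod cyclo_poly p"
proof -
  have "(Polynomial.monom 1 p :: rat poly) = [:-1, 1:] * cyclo_poly p + 1"
    using cyclo_poly_mult[of p, where 'a = rat] by (simp add: mult.commute del: mult_pCons_left)
  then have "(Polynomial.monom 1 p :: rat poly) mod cyclo_poly p = 1 mod cyclo_poly p"
    by (simp del: mult_pCons_left)
  then have "(Polynomial.monom 1 p ^ q :: rat poly) mod cyclo_poly p = 1 mod cyclo_poly p" for q
    by (metis power_mod power_one)
  then have "(Polynomial.monom 1 p ^ (k div p) * Polynomial.monom 1 (k mod p) :: rat poly) mod cyclo_poly p =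
      (1 * Polynomial.monom 1 (k mod p)) mod cyclo_poly p"
    by (metis mod_mult_left_eq)
  moreover have "(Polynomial.monom 1 p ^ (k div p) * Polynomial.monom 1 (k mod p) :: rat poly) = Polynomial.monom 1 k"
    by (simp add: monom_power mult_monom)
  ultimately show ?thesis
    by simp
qed

lemma irreducible_cyclo_rep: "irreducible_rat_rep G (p - 1) cyclo_rep"
proof -
  have deg: "Polynomial.degree (cyclo_poly p :: rat poly) = p - 1"
    by simp
  have "rat_rep G (p - 1) cyclo_rep"
  proof (rule rat_repI[OF group_G])
    show "cyclo_rep g \<in> carrier_mat (p - 1) (p - 1)" for g
      using mult_mat_carrier[of "cyclo_poly p"] by (simp add: cyclo_rep_def)
    show "cyclo_rep \<one>\<^bsub>G\<^esub> = 1\<^sub>m (p - 1)"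
      using mult_mat_one[of "cyclo_poly p"] by (simp add: cyclo_rep_def monom_0)
    fix g h assume "g \<in> carrier G" "h \<in> carrier G"
    then have gh: "0 \<le> g" "0 \<le> h"
      by (auto simp: carrier_G)
    then have "nat ((g + h) mod int p) = (nat g + nat h) mod p"
      by (simp add: nat_mod_distrib nat_add_distrib)
    then have "cyclo_rep (g \<otimes>\<^bsub>G\<^esub> h) = mult_mat (cyclo_poly p) (Polynomial.monom 1 (nat g + nat h))"
      unfolding cyclo_rep_def by (intro mult_mat_cong) (simp add: monom_mod_cyclo)
    also have "Polynomial.monom 1 (nat g + nat h) = Polynomial.monom 1 (nat g) * (Polynomial.monom 1 (nat h) :: rat poly)"
      by (simp add: mult_monom)
    also have "mult_mat (cyclo_poly p) \<dots> = cyclo_rep g * cyclo_rep h"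
      unfolding cyclo_rep_def using p_gt_1 by (intro mult_mat_mult) simp
    finally show "cyclo_rep (g \<otimes>\<^bsub>G\<^esub> h) = cyclo_rep g * cyclo_rep h" .
  qed
  moreover have "W = {0\<^sub>v (p - 1)} \<or> W = carrier_vec (p - 1)"
    if W: "VectorSpace.subspace class_ring W (module_vec TYPE(rat) (p - 1))"
      and inv: "\<forall>g\<in>carrier G. \<forall>w\<in>W. cyclo_rep g *\<^sub>v w \<in> W" for W
  proof -
    have "1 \<in> carrier G"
      using p_gt_1 by (simp add: carrier_G)
    moreover have "cyclo_rep 1 = mult_mat (cyclo_poly p) [:0, 1:]"
      by (simp add: cyclo_rep_def monom_altdef)
    ultimately show ?thesis
      using mult_mat_X_irreducible[OF prime_elem_cyclo_poly[OF prime], of W] W inv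
      unfolding deg by metis
  qed
  ultimately show ?thesis
    using p_gt_1 by (simp add: irreducible_rat_rep_def)
qed

text \<open>Multiplication by X shifts the basis off the diagonal, except that X^(p - 2) goes to
  X^(p - 1) = -(1 + ... + X^(p - 2)), which puts -1 in the last diagonal entry.\<close>

lemma trace_cyclo_rep: "mat_trace (cyclo_rep 1) = -1"
proof -
  have entry: "cyclo_rep 1 $$ (i, i) = (if i = p - 2 then -1 else 0)" if i: "i < p - 1" for i
  proof -
    have "cyclo_rep 1 $$ (i, i) = poly.coeff (Polynomial.monom 1 (Suc i) mod cyclo_poly p) i"
      using i by (simp add: cyclo_rep_def mult_mat_def mult_monom)
    also have "\<dots> = (if i = p - 2 then -1 else 0)"
    proof (cases "i = p - 2")
      case True
      let ?r = "Polynomial.monom 1 (Suc i) - cyclo_poly p :: rat poly"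
      have coeff: "poly.coeff ?r k = (if k < p - 1 then -1 else 0)" for k
        using True p_gt_1 by (simp only: coeff_diff coeff_monom coeff_cyclo_poly) auto
      have "Polynomial.degree ?r < p - 1"
        using p_gt_1 by (intro degree_lessI) (auto simp: coeff simp del: coeff_diff)
      then have "?r mod cyclo_poly p = ?r"
        by (intro mod_poly_less) simp
      then have "Polynomial.monom 1 (Suc i) mod cyclo_poly p = ?r"
        by (simp add: poly_mod_diff_left)
      then show ?thesis
        using coeff[of i] True i by simp
    next
      case False
      then have "Polynomial.degree (Polynomial.monom 1 (Suc i) :: rat poly) < p - 1"
        using i by (simp add: degree_monom_eq)
      then show ?thesis
        using False by (subst mod_poly_less) simp_all
    qed
    finally show ?thesis .
  qed
  have "dim_row (cyclo_rep 1) = p - 1"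
    by (simp add: cyclo_rep_def mult_mat_def)
  then have "mat_trace (cyclo_rep 1) = (\<Sum>i<p - 1. if i = p - 2 then -1 else 0)"
    unfolding mat_trace_def using entry by (intro sum.cong) auto
  also have "\<dots> = -1"
    using p_gt_1 by simp
  finally show ?thesis .
qed

end

section \<open>Virtual characters of the cyclic group\<close>

lemma cring_rat_fun_subring:
  assumes sub: "C \<subseteq> carrier (rat_fun_ring G)"
    and zero: "(\<lambda>g. 0) \<in> C" and one: "(\<lambda>g. if g \<in> carrier G then 1 else 0) \<in> C"
    and add: "\<And>x y. x \<in> C \<Longrightarrow> y \<in> C \<Longrightarrow> (\<lambda>g. x g + y g) \<in> C"
    and uminus: "\<And>x. x \<in> C \<Longrightarrow> (\<lambda>g. - x g) \<in> C"
    and mult: "\<And>x y. x \<in> C \<Longrightarrow> y \<in> C \<Longrightarrow> (\<lambda>g. x g * y g) \<in> C"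
  shows "cring (rat_fun_ring G\<lparr>carrier := C\<rparr>)"
proof (rule cringI)
  have out: "x g = 0" if "x \<in> C" "g \<notin> carrier G" for x g
    using sub that by (auto simp: rat_fun_ring_def)
  show "abelian_group (rat_fun_ring G\<lparr>carrier := C\<rparr>)"
  proof (rule abelian_groupI)
    fix x assume "x \<in> carrier (rat_fun_ring G\<lparr>carrier := C\<rparr>)"
    then show "\<exists>y\<in>carrier (rat_fun_ring G\<lparr>carrier := C\<rparr>).
        y \<oplus>\<^bsub>rat_fun_ring G\<lparr>carrier := C\<rparr>\<^esub> x = \<zero>\<^bsub>rat_fun_ring G\<lparr>carrier := C\<rparr>\<^esub>"
      using uminus by (intro bexI[of _ "\<lambda>g. - x g"]) (auto simp: rat_fun_ring_def)
  qed (use zero add in \<open>auto simp: rat_fun_ring_def fun_eq_iff algebra_simps\<close>)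
  show "Group.comm_monoid (rat_fun_ring G\<lparr>carrier := C\<rparr>)"
    by (rule comm_monoidI) (use one mult out in \<open>auto simp: rat_fun_ring_def fun_eq_iff algebra_simps\<close>)
qed (auto simp: rat_fun_ring_def fun_eq_iff algebra_simps)

lemma virtual_char_ring_simps [simp]:
  "x \<otimes>\<^bsub>virtual_char_ring G\<^esub> y = (\<lambda>g. x g * y g)"
  "x \<oplus>\<^bsub>virtual_char_ring G\<^esub> y = (\<lambda>g. x g + y g)"
  "\<one>\<^bsub>virtual_char_ring G\<^esub> = (\<lambda>g. if g \<in> carrier G then 1 else 0)"
  "\<zero>\<^bsub>virtual_char_ring G\<^esub> = (\<lambda>g. 0)"
  by (simp_all add: virtual_char_ring_def rat_fun_ring_def)

context prime_cyclic_group
begin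

abbreviation R :: "(int \<Rightarrow> rat) ring" where
  "R \<equiv> virtual_char_ring G"

text \<open>The virtual character \<open>u + b (\<chi> - p)\<close>, where \<open>\<chi>\<close> is the regular character.\<close>

definition vch :: "int \<Rightarrow> int \<Rightarrow> int \<Rightarrow> rat" where
  "vch u b = (\<lambda>g. if g \<in> carrier G then of_int (if g = 0 then u else u - int p * b) else 0)"

lemma zero_in_G: "0 \<in> carrier G" and one_in_G: "1 \<in> carrier G"
  using p_gt_1 by (simp_all add: carrier_G)

lemma vch_at_0 [simp]: "vch u b 0 = of_int u"
  by (simp add: vch_def zero_in_G)

lemma vch_at_1: "vch u b 1 = of_int (u - int p * b)"
  unfolding vch_def using one_in_G by simp

lemma vch_eq_iff [simp]: "vch u b = vch u' b' \<longleftrightarrow> u = u' \<and> b = b'"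
proof
  assume eq: "vch u b = vch u' b'"
  have u: "u = u'"
    using arg_cong[OF eq, of "\<lambda>x. x 0"] unfolding vch_at_0 of_int_eq_iff .
  have "(of_int (u - int p * b) :: rat) = of_int (u' - int p * b')"
    using arg_cong[OF eq, of "\<lambda>x. x 1"] by (simp only: vch_at_1)
  then have "u - int p * b = u' - int p * b'"
    by (simp only: of_int_eq_iff)
  then have "int p * b = int p * b'"
    using u by simp
  then show "u = u' \<and> b = b'"
    using u p_gt_1 by simp
qed simp

lemma vch_add: "(\<lambda>g. vch u b g + vch u' b' g) = vch (u + u') (b + b')"
  by (auto simp: vch_def fun_eq_iff algebra_simps)

lemma vch_uminus: "(\<lambda>g. - vch u b g) = vch (-u) (-b)"
  by (auto simp: vch_def fun_eq_iff)

lemma vch_mult: "(\<lambda>g. vch u b g * vch u' b' g) = vch (u * u') (u * b' + b * u' - int p * b * b')"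
  by (auto simp: vch_def fun_eq_iff algebra_simps)

lemma vch_0: "vch 0 0 = (\<lambda>g. 0)" and vch_1: "vch 1 0 = (\<lambda>g. if g \<in> carrier G then 1 else 0)"
  by (auto simp: vch_def)

lemma cring_vch: "cring (rat_fun_ring G\<lparr>carrier := {vch u b | u b. True}\<rparr>)"
  by (rule cring_rat_fun_subring)
    (auto simp: vch_add vch_uminus vch_mult vch_0 [symmetric] vch_1 [symmetric],
     auto simp: vch_def rat_fun_ring_def)

definition lambda_char :: "nat \<Rightarrow> int \<Rightarrow> int \<Rightarrow> int \<Rightarrow> rat" where
  "lambda_char n u b = (\<lambda>g. if g \<in> carrier G then
     (if g = 0 then fps_nth (fps_binomial (of_int u)) n else fps_nth (lambda_series p u b) n) else 0)"

text \<open>One j serves the character and all exterior powers: it is the multiplicity of Phi_p in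
  the characteristic polynomial of the image of the generator 1. All nontrivial elements share that
  polynomial, being multiples of 1 by numbers prime to p.\<close>

lemma rep_exterior_characters:
  assumes rep: "rat_rep G d \<rho>"
  shows "\<exists>j :: nat. (\<forall>n. rep_character G (\<lambda>g. exterior_power_mat n (\<rho> g)) = lambda_char n (int d) (int j)) \<and>
    rep_character G \<rho> = vch (int d) (int j)"
proof -
  let ?A = "\<rho> 1"
  have A: "?A \<in> carrier_mat d d"
    by (rule rat_rep_mat[OF rep one_in_G])
  have pow: "\<rho> (int (k mod p)) = ?A ^\<^sub>m k" for k
    using rat_rep_pow[OF group_G rep one_in_G, of k] by (simp add: zmod_int)
  have zero: "\<rho> 0 = 1\<^sub>m d"
    using rat_rep_one[OF group_G rep] by simp
  have Ap: "?A ^\<^sub>m p = 1\<^sub>m d"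
    using pow[of p] zero by simp
  obtain i j where ij: "char_poly ?A = [:-1, 1:] ^ i * cyclo_poly p ^ j" "d = i + (p - 1) * j"
    using char_poly_of_order_p[OF prime A Ap] .
  have ext_0: "mat_trace (exterior_power_mat n (\<rho> 0)) = fps_nth (fps_binomial (of_int (int d))) n" for n
  proof -
    \<comment> \<open>The identity matrix fits the same pattern with i = d and j = 0.\<close>
    have "fps_nth (lambda_series p (int d) (int 0)) n = mat_trace (exterior_power_mat n (\<rho> 0))"
      by (rule exterior_trace_series[OF prime, of _ d d])
        (simp_all add: zero char_poly_one_mat)
    then show ?thesis
      by (simp add: lambda_series_0)
  qed
  have ext_g: "mat_trace (exterior_power_mat n (\<rho> g)) = fps_nth (lambda_series p (int d) (int j)) n"
    if g: "g \<in> carrier G" "g \<noteq> 0" for n g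
  proof -
    have "nat g mod p = nat g" "\<not> p dvd nat g"
      using g by (auto simp: carrier_G nat_less_iff dest: dvd_imp_le)
    then have \<rho>g: "\<rho> g = ?A ^\<^sub>m nat g" "char_poly (?A ^\<^sub>m nat g) = char_poly ?A"
      using pow[of "nat g"] char_poly_power_of_order_p[OF prime A Ap, of "nat g"] g
      by (auto simp: carrier_G)
    show ?thesis
      unfolding \<rho>g(1)
      by (rule exterior_trace_series[OF prime pow_carrier_mat[OF A] _ ij(2), symmetric])
        (simp only: \<rho>g(2) ij(1))
  qed
  have lam: "rep_character G (\<lambda>g. exterior_power_mat n (\<rho> g)) = lambda_char n (int d) (int j)" for n
    using ext_0 ext_g by (auto simp: rep_character_def lambda_char_def fun_eq_iff)
  have "rep_character G \<rho> = rep_character G (\<lambda>g. exterior_power_mat 1 (\<rho> g))"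
    unfolding rep_character_def
    by (intro ext if_cong refl mat_trace_eq_exterior[OF rat_rep_mat[OF rep], symmetric])
  also have "\<dots> = vch (int d) (int j)"
    unfolding lam using lambda_series_nth_1[OF p_gt_1, of "int d" "int j"]
    by (auto simp: lambda_char_def vch_def fun_eq_iff)
  finally show ?thesis
    using lam by blast
qed

text \<open>The carrier C is left open because this is applied both in the ring of all functions on
  G and in R.\<close>

lemma generate_vch_multiple:
  assumes C: "group (add_monoid (rat_fun_ring G\<lparr>carrier := C\<rparr>))"
    and H: "subgroup H (add_monoid (rat_fun_ring G\<lparr>carrier := C\<rparr>))"
    and mem: "vch u b \<in> H"
  shows "vch (k * u) (k * b) \<in> H"
proof -
  let ?M = "add_monoid (rat_fun_ring G\<lparr>carrier := C\<rparr>)"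
  have add: "(\<lambda>g. x g + y g) \<in> H" if "x \<in> H" "y \<in> H" for x y
    using subgroup.m_closed[OF H that] by (simp add: rat_fun_ring_def)
  have zero: "vch 0 0 \<in> H"
    using subgroup.one_closed[OF H] by (simp add: rat_fun_ring_def vch_0)
  have uminus: "(\<lambda>g. - x g) \<in> H" if x: "x \<in> H" for x
  proof -
    let ?y = "inv\<^bsub>?M\<^esub> x"
    have "x \<in> carrier ?M"
      using subgroup.mem_carrier[OF H x] .
    then have "?y \<otimes>\<^bsub>?M\<^esub> x = \<one>\<^bsub>?M\<^esub>"
      using group.l_inv[OF C] by blast
    then have "?y = (\<lambda>g. - x g)"
      by (auto simp: rat_fun_ring_def fun_eq_iff eq_neg_iff_add_eq_0)
    then show ?thesis
      using subgroup.m_inv_closed[OF H x] by simp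
  qed
  show ?thesis
  proof (induction k rule: int_induct[of _ 0])
    case base
    then show ?case
      using zero by simp
  next
    case (step1 k)
    then show ?case
      using add[OF step1(2) mem] by (simp add: vch_add algebra_simps)
  next
    case (step2 k)
    then show ?case
      using add[OF step2(2) uminus[OF mem, unfolded vch_uminus]] by (simp add: vch_add algebra_simps)
  qed
qed

lemma irreducible_vch: "\<exists>\<rho>. irreducible_rat_rep G 1 \<rho> \<and> rep_character G \<rho> = vch 1 0"
  and irreducible_vch_cyclo: "\<exists>\<rho>. irreducible_rat_rep G (p - 1) \<rho> \<and> rep_character G \<rho> = vch (int (p - 1)) 1"
proof -
  have "rep_character G (\<lambda>_. 1\<^sub>m 1) = vch 1 0"
    by (auto simp: rep_character_def mat_trace_def vch_def fun_eq_iff)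
  then show "\<exists>\<rho>. irreducible_rat_rep G 1 \<rho> \<and> rep_character G \<rho> = vch 1 0"
    using irreducible_trivial_rep[OF group_G] by blast
  have irr: "irreducible_rat_rep G (p - 1) cyclo_rep"
    by (rule irreducible_cyclo_rep)
  then have "rat_rep G (p - 1) cyclo_rep"
    by (simp add: irreducible_rat_rep_def)
  then obtain j where j: "rep_character G cyclo_rep = vch (int (p - 1)) (int j)"
    using rep_exterior_characters by blast
  \<comment> \<open>The trace at the generator decides j through p - 1 - p j = -1.\<close>
  have "rep_character G cyclo_rep 1 = -1"
    unfolding rep_character_def using one_in_G trace_cyclo_rep by simp
  then have "(of_int (int (p - 1) - int p * int j) :: rat) = of_int (-1)"
    unfolding j vch_at_1 by simp
  then have "int (p - 1) - int p * int j = -1"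
    by (simp only: of_int_eq_iff)
  then have "int p * int j = int p * 1"
    using p_gt_1 by (simp add: of_nat_diff)
  then have "j = 1"
    using p_gt_1 by simp
  then show "\<exists>\<rho>. irreducible_rat_rep G (p - 1) \<rho> \<and> rep_character G \<rho> = vch (int (p - 1)) 1"
    using irr j by auto
qed

lemma carrier_R: "carrier R = {vch u b | u b. True}"
proof -
  let ?F = "rat_fun_ring G" and ?S = "{rep_character G \<rho> | d \<rho>. irreducible_rat_rep G d \<rho>}"
  let ?V = "{vch u b | u b. True}"
  have F: "?F\<lparr>carrier := carrier ?F\<rparr> = ?F"
    by simp
  have "cring (?F\<lparr>carrier := carrier ?F\<rparr>)"
    by (rule cring_rat_fun_subring) (auto simp: rat_fun_ring_def)
  then interpret F: cring ?F
    by simp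
  have S: "?S \<subseteq> ?V"
    using rep_exterior_characters unfolding irreducible_rat_rep_def by fastforce
  have V: "?V \<subseteq> carrier ?F"
    by (auto simp: vch_def rat_fun_ring_def)
  have H: "subgroup (generate (add_monoid ?F) ?S) (add_monoid ?F)"
    using S V by (intro F.add.generate_is_subgroup) auto
  have "vch u b \<in> generate (add_monoid ?F) ?S" for u b
  proof -
    have gens: "vch 1 0 \<in> generate (add_monoid ?F) ?S" "vch (int (p - 1)) 1 \<in> generate (add_monoid ?F) ?S"
      using irreducible_vch irreducible_vch_cyclo by (metis (mono_tags, lifting) generate.incl mem_Collect_eq)+
    \<comment> \<open>\<open>vch (p - 1) 1\<close> has degree p - 1, so b copies of it leave this
      multiple of the trivial character.\<close>
    let ?k = "u - b * int (p - 1)"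
    have "vch (?k * 1) (?k * 0) \<in> generate (add_monoid ?F) ?S"
        "vch (b * int (p - 1)) (b * 1) \<in> generate (add_monoid ?F) ?S"
      using generate_vch_multiple[of "carrier ?F", unfolded F, OF _ H] gens F.add.is_group by blast+
    then have "(\<lambda>g. vch (?k * 1) (?k * 0) g + vch (b * int (p - 1)) (b * 1) g) \<in> generate (add_monoid ?F) ?S"
      using subgroup.m_closed[OF H] by (fastforce simp: rat_fun_ring_def)
    then show ?thesis
      by (simp add: vch_add)
  qed
  moreover have "generate (add_monoid ?F) ?S \<subseteq> ?V"
  proof -
    have "subgroup ?V (add_monoid ?F)"
    proof (rule F.add.subgroupI)
      show "\<ominus>\<^bsub>?F\<^esub> x \<in> ?V" if x: "x \<in> ?V" for x
      proof -
        obtain u b where "x = vch u b"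
          using x by blast
        moreover have "\<ominus>\<^bsub>?F\<^esub> vch u b = vch (-u) (-b)"
          using V by (intro F.minus_equality) (auto simp: rat_fun_ring_def vch_add vch_0)
        ultimately show ?thesis
          by blast
      qed
    qed (use V in \<open>auto simp: rat_fun_ring_def vch_add\<close>)
    then show ?thesis
      using S F.add.generate_subgroup_incl by blast
  qed
  ultimately show ?thesis
    unfolding virtual_char_ring_def by auto
qed

lemma R_alt: "R = rat_fun_ring G\<lparr>carrier := {vch u b | u b. True}\<rparr>"
proof -
  have "R = rat_fun_ring G\<lparr>carrier := carrier R\<rparr>"
    by (simp add: virtual_char_ring_def)
  then show ?thesis
    by (simp only: carrier_R)
qed

lemma cring_R: "cring R"
  unfolding R_alt by (rule cring_vch)

sublocale R: cring R
  by (rule cring_R)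

lemma vch_in_R [simp]: "vch u b \<in> carrier R"
  by (auto simp: carrier_R)

lemma in_R_cases:
  assumes "x \<in> carrier R"
  obtains u b where "x = vch u b"
  using assms by (auto simp: carrier_R)

lemma finsum_R:
  assumes "finite A" "\<And>i. i \<in> A \<Longrightarrow> f i \<in> carrier R"
  shows "finsum R f A = (\<lambda>g. \<Sum>i\<in>A. f i g)"
  using assms
proof (induction A rule: finite_induct)
  case (insert a A)
  then show ?case
    by (subst R.finsum_insert) auto
qed simp

lemma a_inv_vch: "\<ominus>\<^bsub>R\<^esub> vch u b = vch (-u) (-b)"
  by (rule R.minus_equality) (simp_all add: vch_add vch_0)

lemma const_char_eq: "const_char G k = vch k 0"
proof -
  have one: "\<one>\<^bsub>R\<^esub> = vch 1 0"
    by (simp add: vch_1)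
  have nat: "[(n :: nat)] \<cdot>\<^bsub>R\<^esub> \<one>\<^bsub>R\<^esub> = vch (int n) 0" for n
  proof (induction n)
    case (Suc n)
    then show ?case
      by (simp only: R.add.nat_pow_Suc one virtual_char_ring_simps(2) vch_add) simp
  qed (simp add: vch_0)
  show ?thesis
  proof (cases "k \<ge> 0")
    case True
    then show ?thesis
      by (simp only: const_char_def add_pow_int_ge nat) simp
  next
    case False
    then have "[k] \<cdot>\<^bsub>R\<^esub> \<one>\<^bsub>R\<^esub> = \<ominus>\<^bsub>R\<^esub> ([nat (-k)] \<cdot>\<^bsub>R\<^esub> \<one>\<^bsub>R\<^esub>)"
      by (simp add: add_pow_int_lt)
    then show ?thesis
      using False by (simp only: nat const_char_def a_inv_vch) simp
  qed
qed


section \<open>Lambda operations and the gamma filtration\<close>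

lemma lambda_char_in_R: "lambda_char n u b \<in> carrier R"
proof -
  obtain z w where "fps_nth (fps_binomial (of_int u :: rat)) n = of_int z"
      "fps_nth (lambda_series p u b) n = of_int (z - int p * w)"
    using lambda_series_integral[OF prime] by blast
  then have "lambda_char n u b = vch z w"
    unfolding lambda_char_def vch_def by (intro ext) simp
  then show ?thesis
    by simp
qed

lemma lambda_char_0: "lambda_char 0 u b = \<one>\<^bsub>R\<^esub>"
  by (auto simp: lambda_char_def)

lemma lambda_char_add:
  "lambda_char n (u + u') (b + b') g = (\<Sum>i\<le>n. lambda_char i u b g * lambda_char (n - i) u' b' g)"
proof -
  have "p > 0"
    using p_gt_1 by simp
  then show ?thesis
    by (simp add: lambda_char_def lambda_series_add fps_binomial_add_mult fps_mult_nth atLeast0AtMost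
        del: fps_binomial_nth)
qed

text \<open>The coordinates u and b are recovered from the values at 0 and at the generator; on R
  both floors are taken of integers. The restriction to \<open>carrier R\<close> matches the
  extensional function space in \<open>is_lambda_operation\<close>.\<close>

definition explicit_lambda :: "nat \<Rightarrow> (int \<Rightarrow> rat) \<Rightarrow> int \<Rightarrow> rat" where
  "explicit_lambda n = (\<lambda>x\<in>carrier R. lambda_char n \<lfloor>x 0\<rfloor> \<lfloor>(x 0 - x 1) / of_nat p\<rfloor>)"

lemma explicit_lambda_vch [simp]: "explicit_lambda n (vch u b) = lambda_char n u b"
proof -
  have "(vch u b 0 - vch u b 1) / of_nat p = (of_int b :: rat)"
    unfolding vch_at_1 using p_gt_1 by simp
  then show ?thesis
    unfolding explicit_lambda_def by simp
qed

lemma is_lambda_explicit: "is_lambda_operation G explicit_lambda"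
  unfolding is_lambda_operation_def Let_def
proof (intro conjI allI impI ballI)
  show "explicit_lambda n \<in> carrier R \<rightarrow>\<^sub>E carrier R" for n
    by (auto simp: lambda_char_in_R explicit_lambda_def)
  show "explicit_lambda n (rep_character G \<rho>) = rep_character G (\<lambda>g. exterior_power_mat n (\<rho> g))"
    if "rat_rep G d \<rho>" for n d \<rho>
    using rep_exterior_characters[OF that] by auto
  show "explicit_lambda 0 x = \<one>\<^bsub>R\<^esub>" if "x \<in> carrier R" for x
    using that by (auto elim!: in_R_cases simp: lambda_char_0)
  fix n x y assume "x \<in> carrier R" "y \<in> carrier R"
  then obtain u b u' b' where xy: "x = vch u b" "y = vch u' b'"
    by (auto elim!: in_R_cases)
  have "(\<Oplus>\<^bsub>R\<^esub>i\<in>{..n}. explicit_lambda i x \<otimes>\<^bsub>R\<^esub> explicit_lambda (n - i) y) =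
      (\<lambda>g. \<Sum>i\<le>n. (explicit_lambda i x \<otimes>\<^bsub>R\<^esub> explicit_lambda (n - i) y) g)"
    by (rule finsum_R) (simp_all only: xy explicit_lambda_vch R.m_closed lambda_char_in_R finite_atMost)
  then show "explicit_lambda n (x \<oplus>\<^bsub>R\<^esub> y) =
      (\<Oplus>\<^bsub>R\<^esub>i\<in>{..n}. explicit_lambda i x \<otimes>\<^bsub>R\<^esub> explicit_lambda (n - i) y)"
    by (simp add: xy vch_add fun_eq_iff lambda_char_add)
qed

text \<open>The axioms fix L on characters of representations, the addition law spreads this to
  sums, and a recursion on n to negatives; from \<open>vch 1 0\<close> and
  \<open>vch (p - 1) 1\<close> all of R is reached.\<close>

lemma lambda_operation_unique:
  assumes L: "is_lambda_operation G L"
  shows "L = explicit_lambda"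
proof -
  have L_ext: "L n \<in> carrier R \<rightarrow>\<^sub>E carrier R" for n
    using L by (simp add: is_lambda_operation_def Let_def)
  have rep: "L n (rep_character G \<rho>) = rep_character G (\<lambda>g. exterior_power_mat n (\<rho> g))"
    if "rat_rep G d \<rho>" for n d \<rho>
    using L that by (auto simp only: is_lambda_operation_def Let_def)
  have add: "L n (\<lambda>g. x g + y g) g = (\<Sum>i\<le>n. L i x g * L (n - i) y g)"
    if xy: "x \<in> carrier R" "y \<in> carrier R" for n x y g
  proof -
    have "L n (x \<oplus>\<^bsub>R\<^esub> y) = (\<Oplus>\<^bsub>R\<^esub>i\<in>{..n}. L i x \<otimes>\<^bsub>R\<^esub> L (n - i) y)"
      using L xy by (simp only: is_lambda_operation_def Let_def)
    also have "\<dots> = (\<lambda>g. \<Sum>i\<le>n. (L i x \<otimes>\<^bsub>R\<^esub> L (n - i) y) g)"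
      using L_ext xy by (intro finsum_R R.m_closed) blast+
    finally show ?thesis
      by simp
  qed
  define P where "P x \<longleftrightarrow> x \<in> carrier R \<and> (\<forall>n. L n x = explicit_lambda n x)" for x
  have P_rep: "P (rep_character G \<rho>)" if "rat_rep G d \<rho>" for d \<rho>
    using rep_exterior_characters[OF that] rep[OF that] by (auto simp: P_def)
  have P_1: "P (vch 1 0)" and P_V: "P (vch (int (p - 1)) 1)"
    using irreducible_vch irreducible_vch_cyclo P_rep unfolding irreducible_rat_rep_def by metis+
  \<comment> \<open>The zero-dimensional representation provides the value of L at the zero
    character, which the recursion for negatives needs.\<close>
  have P_0: "P (vch 0 0)"
  proof -
    have "rat_rep G 0 (\<lambda>_. 1\<^sub>m 0)"
      by (rule rat_repI[OF group_G]) auto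
    moreover have "rep_character G (\<lambda>_. 1\<^sub>m 0) = vch 0 0"
      by (auto simp: rep_character_def mat_trace_def vch_0)
    ultimately show ?thesis
      using P_rep by metis
  qed
  have P_add: "P (vch (u + u') (b + b'))" if "P (vch u b)" "P (vch u' b')" for u b u' b'
    using that add[of "vch u b" "vch u' b'"]
    by (auto simp: P_def vch_add lambda_char_add fun_eq_iff)
  have P_uminus: "P (vch (-u) (-b))" if P: "P (vch u b)" for u b
  proof -
    \<comment> \<open>In the addition law for x + (-x) the term i = 0 is L n at -x, as L 0 x = 1;
      all other terms involve L at -x in lower degree and are known by induction.\<close>
    have "L n (vch (-u) (-b)) = lambda_char n (-u) (-b)" for n
    proof (induction n rule: less_induct)
      case (less n)
      show ?case
      proof
        fix g
        have split: "(\<Sum>i\<le>n. h i) = h 0 + (\<Sum>i\<in>{0<..n}. h i)" for h :: "nat \<Rightarrow> rat"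
        proof -
          have "{..n} = insert 0 {0<..n}"
            by auto
          then show ?thesis
            by simp
        qed
        let ?S = "\<Sum>i\<in>{0<..n}. lambda_char i u b g * lambda_char (n - i) (-u) (-b) g"
        have "L n (vch 0 0) g = (\<Sum>i\<le>n. L i (vch u b) g * L (n - i) (vch (-u) (-b)) g)"
          using add[of "vch u b" "vch (-u) (-b)" n g] by (simp add: vch_add)
        also have "\<dots> = lambda_char 0 u b g * L n (vch (-u) (-b)) g + ?S"
          using P less by (simp add: split P_def)
        also have "L n (vch 0 0) g = lambda_char n (u + - u) (b + - b) g"
          using P_0 by (simp add: P_def)
        also have "\<dots> = lambda_char 0 u b g * lambda_char n (-u) (-b) g + ?S"
          by (simp only: lambda_char_add split diff_zero)
        finally have "lambda_char 0 u b g * lambda_char n (-u) (-b) g = lambda_char 0 u b g * L n (vch (-u) (-b)) g"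
          by simp
        \<comment> \<open>Off the carrier the factor \<open>lambda_char 0 u b g\<close> is 0 and
          cannot be cancelled; there both sides vanish.\<close>
        moreover have "L n (vch (-u) (-b)) g = 0" if "g \<notin> carrier G"
        proof -
          have "L n (vch (-u) (-b)) \<in> carrier R"
            using L_ext[of n] vch_in_R[of "-u" "-b"] by blast
          then show ?thesis
            using that by (auto elim!: in_R_cases simp: vch_def)
        qed
        ultimately show "L n (vch (-u) (-b)) g = lambda_char n (-u) (-b) g"
          by (cases "g \<in> carrier G") (auto simp: lambda_char_0 lambda_char_def[of n])
      qed
    qed
    then show ?thesis
      by (simp add: P_def)
  qed
  have P_mult: "P (vch (k * u) (k * b))" if P: "P (vch u b)" for k u b
  proof (induction k rule: int_induct[of _ 0])
    case base
    then show ?case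
      using P_0 by simp
  next
    case (step1 k)
    then show ?case
      using P_add[OF step1(2) P] by (simp add: algebra_simps)
  next
    case (step2 k)
    then show ?case
      using P_add[OF step2(2) P_uminus[OF P]] by (simp add: algebra_simps)
  qed
  have "P (vch u b)" for u b
    using P_add[OF P_mult[OF P_1, of "u - b * int (p - 1)"] P_mult[OF P_V, of b]] by simp
  then have "L n x = explicit_lambda n x" if "x \<in> carrier R" for n x
    using that by (auto elim!: in_R_cases simp: P_def)
  moreover have "L n x = explicit_lambda n x" if "x \<notin> carrier R" for n x
    using that L_ext[of n] by (auto simp: explicit_lambda_def PiE_def extensional_def)
  ultimately have "L n x = explicit_lambda n x" for n x
    by (cases "x \<in> carrier R") simp_all
  then show ?thesis
    by (simp only: fun_eq_iff) simp
qed

lemma lambda_op_vch: "lambda_op G n (vch u b) = lambda_char n u b"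
proof -
  have "lambda_op G = explicit_lambda"
    unfolding lambda_op_def
    using is_lambda_explicit lambda_operation_unique by (rule the_equality)
  then show ?thesis
    by simp
qed

text \<open>The shift makes the degree n - 1, so the value at the identity is n - 1 choose n, which
  is 0 for n > 0 and 1 for n = 0. The assumption puts the value elsewhere into the matching shape u
  - p c.\<close>

lemma gamma_op_vch:
  assumes "fps_nth (gamma_series p b) n = of_int ((if n = 0 then 1 else 0) - int p * c)"
  shows "gamma_op G n (vch 0 b) = vch (if n = 0 then 1 else 0) c"
proof -
  have "gamma_op G n (vch 0 b) = lambda_char n (int n - 1) b"
    by (simp add: gamma_op_def const_char_eq vch_add lambda_op_vch)
  moreover have binom: "fps_nth (fps_binomial (of_int (int n - 1) :: rat)) n = of_int (if n = 0 then 1 else 0)"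
  proof (cases n)
    case (Suc m)
    have "(of_nat m :: rat) gchoose Suc m = of_nat (m choose Suc m)"
      by (rule binomial_gbinomial [symmetric])
    then show ?thesis
      using Suc by simp
  qed simp
  ultimately show ?thesis
    unfolding lambda_char_def lambda_series_eq_gamma_series_nth assms binom
    by (auto simp: vch_def fun_eq_iff)
qed

lemma augmentation_ideal_eq: "augmentation_ideal G = {vch 0 b | b. True}"
  by (auto simp: augmentation_ideal_def augmentation_def carrier_R)

definition level :: "nat \<Rightarrow> nat" where
  "level n = ceil_div n (p - 1)"

text \<open>Explicit form of the filtration, with u - p b the value off the identity. As
  \<open>level 0\<close> is 0, the case n = 0 imposes no condition and gives all of R.\<close>

definition gamma_level :: "nat \<Rightarrow> (int \<Rightarrow> rat) set" where
  "gamma_level n = {vch u b | u b. (n > 0 \<longrightarrow> u = 0) \<and> int p ^ level n dvd u - int p * b}"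

lemma level_add: "level (i + j) \<le> level i + level j"
  using p_gt_1 by (simp add: level_def ceil_div_add_le)

lemma level_mono: "i \<le> j \<Longrightarrow> level i \<le> level j"
  by (simp add: level_def ceil_div_mono)

lemma level_0 [simp]: "level 0 = 0"
  using p_gt_1 by (simp add: level_def)

lemma level_pos: "i > 0 \<Longrightarrow> level i > 0"
  using p_gt_1 by (simp add: level_def ceil_div_pos)

lemma gamma_level_0: "gamma_level 0 = carrier R"
  by (auto simp: gamma_level_def carrier_R)

lemma vch_in_gamma_level:
  "vch u b \<in> gamma_level n \<longleftrightarrow> (n > 0 \<longrightarrow> u = 0) \<and> int p ^ level n dvd u - int p * b"
  by (auto simp: gamma_level_def)

lemma gamma_level_mult:
  assumes "x \<in> gamma_level i" "y \<in> gamma_level j"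
  shows "(\<lambda>g. x g * y g) \<in> gamma_level (i + j)"
proof -
  obtain u b u' b' where xy: "x = vch u b" "y = vch u' b'"
    and d: "i > 0 \<longrightarrow> u = 0" "j > 0 \<longrightarrow> u' = 0"
      "int p ^ level i dvd u - int p * b" "int p ^ level j dvd u' - int p * b'"
    using assms by (auto simp: gamma_level_def)
  have "int p ^ level (i + j) dvd int p ^ (level i + level j)"
    by (intro le_imp_power_dvd level_add)
  also have "\<dots> dvd (u - int p * b) * (u' - int p * b')"
    unfolding power_add using d by (intro mult_dvd_mono) auto
  also have "\<dots> = u * u' - int p * (u * b' + b * u' - int p * b * b')"
    by (simp add: algebra_simps)
  finally show ?thesis
    using d by (auto simp: xy vch_mult vch_in_gamma_level)
qed

lemma gamma_level_antimono:
  assumes "i \<le> j"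
  shows "gamma_level j \<subseteq> gamma_level i"
  using assms le_imp_power_dvd[OF level_mono[OF assms], of "int p"]
  by (auto simp: gamma_level_def intro: dvd_trans)

lemma gamma_op_in_level: "gamma_op G n (vch 0 b) \<in> gamma_level n"
proof -
  obtain z where z: "fps_nth (gamma_series p b) n = of_int (z * int p ^ level n)"
    using gamma_series_dvd[OF prime] unfolding level_def by blast
  show ?thesis
  proof (cases "n = 0")
    case True
    then have "gamma_op G n (vch 0 b) = vch 1 0"
      using gamma_op_vch[of b n 0] by simp
    then show ?thesis
      using True by (simp add: gamma_level_0)
  next
    case False
    then obtain k where k: "level n = Suc k"
      using level_pos gr0_conv_Suc by blast
    \<comment> \<open>One factor p of the value is absorbed by the coordinate: 0 - p (- z p^k) = z
      p^(k + 1).\<close>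
    have "gamma_op G n (vch 0 b) = vch (if n = 0 then 1 else 0) (- z * int p ^ k)"
      using False by (intro gamma_op_vch) (simp add: z k)
    then show ?thesis
      using False by (simp add: vch_in_gamma_level k)
  qed
qed

lemma gamma_level_subgroup: "subgroup (gamma_level n) (add_monoid R)"
proof (rule R.add.subgroupI)
  show "gamma_level n \<subseteq> carrier R"
    by (auto simp: gamma_level_def)
  have "vch 0 0 \<in> gamma_level n"
    by (simp add: vch_in_gamma_level)
  then show "gamma_level n \<noteq> {}"
    by blast
  show "\<ominus>\<^bsub>R\<^esub> x \<in> gamma_level n" if x_in: "x \<in> gamma_level n" for x
  proof -
    obtain u b where x: "x = vch u b"
      using x_in unfolding gamma_level_def by blast
    have "- u - int p * - b = - (u - int p * b)"
      by simp
    then show ?thesis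
      using x_in unfolding x a_inv_vch vch_in_gamma_level by (metis dvd_minus_iff neg_equal_0_iff_equal)
  qed
  show "x \<oplus>\<^bsub>R\<^esub> y \<in> gamma_level n" if xy: "x \<in> gamma_level n" "y \<in> gamma_level n" for x y
  proof -
    obtain u b u' b' where x: "x = vch u b" "y = vch u' b'"
      using xy by (auto simp: gamma_level_def)
    have "u + u' - int p * (b + b') = (u - int p * b) + (u' - int p * b')"
      by (simp add: algebra_simps)
    then show ?thesis
      using xy by (auto simp: x vch_add vch_in_gamma_level)
  qed
qed

text \<open>The sign with \<open>\<gamma>\<^sup>p\<^sup>-\<^sup>1(\<chi> - p) = \<plusminus>(\<chi> - p)\<close>.\<close>

definition chern_sign :: int where
  "chern_sign = (-1) ^ p"

lemma gamma_op_top: "gamma_op G (p - 1) (vch 0 1) = vch 0 chern_sign"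
proof -
  have gamma: "fps_nth (gamma_series p 1) n = fps_nth (gamma_base p) n" for n
    using gamma_series_of_nat[of p 1] p_gt_1 by simp
  have "fps_nth (gamma_base p) (p - 1) = fps_nth (gamma_base p - 1) (p - 1)"
    using p_gt_1 by simp
  also have "\<dots> = (-1) ^ (p - 1) * of_nat (p choose (p - 1))"
    using p_gt_1 by (subst gamma_base_minus_one_nth) auto
  also have "p choose (p - 1) = p"
    using p_gt_1 binomial_symmetric[of 1 p] by simp
  also have "(-1) ^ (p - 1) * of_nat p = (of_int (0 - int p * chern_sign) :: rat)"
  proof -
    have "p = Suc (p - 1)"
      using p_gt_1 by simp
    then have "chern_sign = - ((-1) ^ (p - 1))"
      unfolding chern_sign_def by (metis mult_minus1 power_Suc)
    then show ?thesis
      by simp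
  qed
  finally have "fps_nth (gamma_series p 1) (p - 1) = of_int ((if p - 1 = 0 then 1 else 0) - int p * chern_sign)"
    using p_gt_1 by (simp only: gamma) simp
  then show ?thesis
    using gamma_op_vch[of 1 "p - 1" chern_sign] p_gt_1 by simp
qed

lemma gamma_filtration_eq: "gamma_filtration G n = gamma_level n"
proof -
  let ?prod = "\<lambda>ps. foldr (\<lambda>(i, x) z. gamma_op G i x \<otimes>\<^bsub>R\<^esub> z) ps \<one>\<^bsub>R\<^esub>"
  let ?S = "{?prod ps | ps. snd ` set ps \<subseteq> augmentation_ideal G \<and> n \<le> sum_list (map fst ps)}"
  have def: "gamma_filtration G n = generate (add_monoid R) ?S"
    unfolding gamma_filtration_def Let_def by (rule refl)
  have prod: "?prod ps \<in> gamma_level (sum_list (map fst ps))" if "snd ` set ps \<subseteq> augmentation_ideal G" for ps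
    using that
  proof (induction ps)
    case Nil
    then show ?case
      using R.one_closed by (simp add: gamma_level_0)
  next
    case (Cons q ps)
    obtain i b where q: "q = (i, vch 0 b)"
      using Cons.prems by (cases q) (auto simp: augmentation_ideal_eq)
    have "?prod ps \<in> gamma_level (sum_list (map fst ps))"
      using Cons by simp
    then show ?case
      using gamma_level_mult[OF gamma_op_in_level[of i b]] by (simp add: q)
  qed
  have S: "?S \<subseteq> gamma_level n"
    using prod gamma_level_antimono by blast
  have sub: "subgroup (generate (add_monoid R) ?S) (add_monoid R)"
    using S subgroup.subset[OF gamma_level_subgroup] by (intro R.add.generate_is_subgroup) auto
  have mult: "vch (k * u) (k * b) \<in> generate (add_monoid R) ?S" if "vch u b \<in> ?S" for u b k
  proof -
    have "group (add_monoid R)"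
      by (rule R.add.is_group)
    moreover have "vch u b \<in> generate (add_monoid R) ?S"
      using that by (rule generate.incl)
    ultimately show ?thesis
      using generate_vch_multiple[of "{vch u b | u b. True}" "generate (add_monoid R) ?S"] sub
      unfolding R_alt [symmetric] by blast
  qed
  have add: "vch (u + u') (b + b') \<in> generate (add_monoid R) ?S"
    if "vch u b \<in> generate (add_monoid R) ?S" "vch u' b' \<in> generate (add_monoid R) ?S" for u u' b b'
    using subgroup.m_closed[OF sub that] by (simp add: vch_add)
  have "vch u b \<in> generate (add_monoid R) ?S" if mem: "vch u b \<in> gamma_level n" for u b
  proof (cases "n = 0")
    case True
    \<comment> \<open>Additive generators of R are 1, the empty product, and chi - p, which equals
      gamma^1(chi - p).\<close>
    have "?prod [] \<in> ?S"
      using True by fastforce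
    then have "vch 1 0 \<in> ?S"
      by (simp only: foldr.simps id_apply virtual_char_ring_simps(3) vch_1)
    moreover have "?prod [(1, vch 0 1)] \<in> ?S"
      using True by (fastforce simp: augmentation_ideal_eq)
    moreover have "?prod [(1, vch 0 1)] = vch 0 1"
    proof -
      have "gamma_op G 1 (vch 0 1) = vch 0 1"
        using gamma_series_nth_1[OF p_gt_1, of 1] gamma_op_vch[of 1 1 1] by simp
      then have "?prod [(1, vch 0 1)] = vch 0 1 \<otimes>\<^bsub>R\<^esub> \<one>\<^bsub>R\<^esub>"
        by (simp only: foldr.simps o_apply prod.case id_apply)
      then show ?thesis
        by (simp only: R.r_one vch_in_R)
    qed
    ultimately show ?thesis
      using add[OF mult[of 1 0 u] mult[of 0 1 b]] by simp
  next
    case False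
    then obtain m where m: "level n = Suc m"
      using level_pos gr0_conv_Suc by blast
    have u: "u = 0"
      using mem False by (simp add: vch_in_gamma_level)
    then have "int p * int p ^ m dvd int p * b"
      using mem by (simp add: vch_in_gamma_level m)
    then have "int p ^ m dvd b"
      using p_gt_1 by simp
    then obtain k where k: "b = int p ^ m * k"
      by blast
    let ?ps = "replicate (Suc m) (p - 1, vch 0 1)"
    \<comment> \<open>Each further factor multiplies by -p \<open>chern_sign\<close>, because (chi -
      p)^2 = -p (chi - p). Only the sign e is left open, being a unit.\<close>
    have pow: "\<exists>e :: int. (e = 1 \<or> e = -1) \<and> ?prod (replicate (Suc l) (p - 1, vch 0 1)) = vch 0 (e * int p ^ l)" for l
    proof (induction l)
      case 0
      have "?prod [(p - 1, vch 0 1)] = vch 0 chern_sign"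
        by (simp only: foldr.simps o_apply prod.case id_apply gamma_op_top R.r_one vch_in_R)
      moreover have "chern_sign = 1 \<or> chern_sign = -1"
        by (auto simp: chern_sign_def minus_one_power_iff)
      ultimately show ?case
        by auto
    next
      case (Suc l)
      then obtain e where e: "e = 1 \<or> e = -1"
          "?prod (replicate (Suc l) (p - 1, vch 0 1)) = vch 0 (e * int p ^ l)"
        by blast
      have "?prod (replicate (Suc (Suc l)) (p - 1, vch 0 1)) =
          gamma_op G (p - 1) (vch 0 1) \<otimes>\<^bsub>R\<^esub> ?prod (replicate (Suc l) (p - 1, vch 0 1))"
        by (simp only: replicate.simps foldr.simps o_apply prod.case)
      also have "\<dots> = vch 0 (- chern_sign * e * int p ^ Suc l)"
        unfolding e(2) gamma_op_top by (simp add: vch_mult algebra_simps)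
      finally have "?prod (replicate (Suc (Suc l)) (p - 1, vch 0 1)) = vch 0 (- chern_sign * e * int p ^ Suc l)" .
      moreover have "- chern_sign * e = 1 \<or> - chern_sign * e = -1"
        using e(1) by (auto simp: chern_sign_def minus_one_power_iff)
      ultimately show ?case
        by blast
    qed
    obtain e :: int where e: "e = 1 \<or> e = -1" "?prod ?ps = vch 0 (e * int p ^ m)"
      using pow[of m] by blast
    \<comment> \<open>m + 1 is the ceiling of n / (p - 1), so m + 1 factors of weight p - 1 have
      total weight at least n.\<close>
    have "n \<le> Suc m * (p - 1)"
      using ceil_div_le_iff[of "p - 1" n "Suc m"] m p_gt_1 by (simp add: level_def)
    then have "n \<le> sum_list (map fst ?ps)"
      by (simp only: map_replicate fst_conv sum_list_replicate of_nat_id)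
    moreover have "snd ` set ?ps \<subseteq> augmentation_ideal G"
      by (auto simp: augmentation_ideal_eq)
    ultimately have "vch 0 (e * int p ^ m) \<in> ?S"
      unfolding e(2) [symmetric] by blast
    \<comment> \<open>The extra factor e cancels the unknown sign, as e e = 1.\<close>
    then have "vch (e * k * 0) (e * k * (e * int p ^ m)) \<in> generate (add_monoid R) ?S"
      by (rule mult)
    moreover have "e * k * (e * int p ^ m) = b"
      using e(1) by (auto simp: k)
    ultimately show ?thesis
      by (simp add: u)
  qed
  then have "gamma_level n \<subseteq> generate (add_monoid R) ?S"
    by (auto simp: gamma_level_def)
  moreover have "generate (add_monoid R) ?S \<subseteq> gamma_level n"
    using S gamma_level_subgroup by (rule R.add.generate_subgroup_incl)
  ultimately show ?thesis
    unfolding def by blast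
qed

end

section \<open>The graded ring\<close>

text \<open>S is a bare record here: each ring law holds among images under h because it holds in R,
  and surjectivity makes every element an image.\<close>

lemma ring_hom_cring_surjI:
  assumes R: "cring R" and surj: "h ` carrier R = carrier S"
    and mult: "\<And>x y. x \<in> carrier R \<Longrightarrow> y \<in> carrier R \<Longrightarrow> h (x \<otimes>\<^bsub>R\<^esub> y) = h x \<otimes>\<^bsub>S\<^esub> h y"
    and add: "\<And>x y. x \<in> carrier R \<Longrightarrow> y \<in> carrier R \<Longrightarrow> h (x \<oplus>\<^bsub>R\<^esub> y) = h x \<oplus>\<^bsub>S\<^esub> h y"
    and one: "h \<one>\<^bsub>R\<^esub> = \<one>\<^bsub>S\<^esub>" and zero: "h \<zero>\<^bsub>R\<^esub> = \<zero>\<^bsub>S\<^esub>"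
  shows "ring_hom_cring R S h"
proof -
  interpret R: cring R
    by fact
  have S: "\<exists>x\<in>carrier R. s = h x" if "s \<in> carrier S" for s
    using that surj by blast
  have closed: "h x \<in> carrier S" if "x \<in> carrier R" for x
    using that surj by blast
  have "abelian_group S"
  proof (rule abelian_groupI)
    fix x y z assume "x \<in> carrier S" "y \<in> carrier S" "z \<in> carrier S"
    then obtain a b c where abc: "a \<in> carrier R" "b \<in> carrier R" "c \<in> carrier R"
        "x = h a" "y = h b" "z = h c"
      using S by metis
    show "x \<oplus>\<^bsub>S\<^esub> y \<oplus>\<^bsub>S\<^esub> z = x \<oplus>\<^bsub>S\<^esub> (y \<oplus>\<^bsub>S\<^esub> z)"
      using abc by (simp add: add [symmetric] R.a_assoc)
  next
    fix x y assume "x \<in> carrier S" "y \<in> carrier S"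
    then obtain a b where ab: "a \<in> carrier R" "b \<in> carrier R" "x = h a" "y = h b"
      using S by metis
    show "x \<oplus>\<^bsub>S\<^esub> y \<in> carrier S"
      using ab closed[of "a \<oplus>\<^bsub>R\<^esub> b"] by (simp add: add)
    show "x \<oplus>\<^bsub>S\<^esub> y = y \<oplus>\<^bsub>S\<^esub> x"
      using ab by (simp add: add [symmetric] R.a_comm)
  next
    show "\<zero>\<^bsub>S\<^esub> \<in> carrier S"
      using closed[OF R.zero_closed] zero by simp
  next
    fix x assume "x \<in> carrier S"
    then obtain a where a: "a \<in> carrier R" "x = h a"
      using S by metis
    show "\<zero>\<^bsub>S\<^esub> \<oplus>\<^bsub>S\<^esub> x = x"
      using a by (simp add: add [symmetric] zero [symmetric])
    show "\<exists>y\<in>carrier S. y \<oplus>\<^bsub>S\<^esub> x = \<zero>\<^bsub>S\<^esub>"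
      using a closed[of "\<ominus>\<^bsub>R\<^esub> a"]
      by (intro bexI[of _ "h (\<ominus>\<^bsub>R\<^esub> a)"]) (simp_all add: add [symmetric] zero [symmetric] R.l_neg)
  qed
  moreover have "Group.comm_monoid S"
  proof (rule comm_monoidI)
    fix x y z assume "x \<in> carrier S" "y \<in> carrier S" "z \<in> carrier S"
    then obtain a b c where abc: "a \<in> carrier R" "b \<in> carrier R" "c \<in> carrier R"
        "x = h a" "y = h b" "z = h c"
      using S by metis
    show "x \<otimes>\<^bsub>S\<^esub> y \<otimes>\<^bsub>S\<^esub> z = x \<otimes>\<^bsub>S\<^esub> (y \<otimes>\<^bsub>S\<^esub> z)"
      using abc by (simp add: mult [symmetric] R.m_assoc)
  next
    fix x y assume "x \<in> carrier S" "y \<in> carrier S"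
    then obtain a b where ab: "a \<in> carrier R" "b \<in> carrier R" "x = h a" "y = h b"
      using S by metis
    show "x \<otimes>\<^bsub>S\<^esub> y \<in> carrier S"
      using ab closed[of "a \<otimes>\<^bsub>R\<^esub> b"] by (simp add: mult)
    show "x \<otimes>\<^bsub>S\<^esub> y = y \<otimes>\<^bsub>S\<^esub> x"
      using ab by (simp add: mult [symmetric] R.m_comm)
  next
    show "\<one>\<^bsub>S\<^esub> \<in> carrier S"
      using closed[OF R.one_closed] one by simp
  next
    fix x assume "x \<in> carrier S"
    then obtain a where a: "a \<in> carrier R" "x = h a"
      using S by metis
    show "\<one>\<^bsub>S\<^esub> \<otimes>\<^bsub>S\<^esub> x = x"
      using a by (simp add: mult [symmetric] one [symmetric])
  qed
  moreover have "(x \<oplus>\<^bsub>S\<^esub> y) \<otimes>\<^bsub>S\<^esub> z = x \<otimes>\<^bsub>S\<^esub> z \<oplus>\<^bsub>S\<^esub> y \<otimes>\<^bsub>S\<^esub> z"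
    if xyz: "x \<in> carrier S" "y \<in> carrier S" "z \<in> carrier S" for x y z
  proof -
    obtain a b c where "a \<in> carrier R" "b \<in> carrier R" "c \<in> carrier R"
        "x = h a" "y = h b" "z = h c"
      using S[OF xyz(1)] S[OF xyz(2)] S[OF xyz(3)] by blast
    then show ?thesis
      by (simp add: mult [symmetric] add [symmetric] R.l_distr)
  qed
  ultimately have "cring S"
    by (rule cringI)
  moreover have "h \<in> Ring.ring_hom R S"
    using mult add one closed by (intro ring_hom_memI)
  ultimately show ?thesis
    using R by (simp add: ring_hom_cring_def ring_hom_cring_axioms_def)
qed

context prime_cyclic_group
begin

section \<open>Cosets of the filtration and graded pieces\<close>

definition gcoset :: "nat \<Rightarrow> (int \<Rightarrow> rat) \<Rightarrow> (int \<Rightarrow> rat) set" where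
  "gcoset n a = gamma_level (Suc n) +>\<^bsub>R\<^esub> a"

lemma gcoset_alt: "gcoset n a = (\<lambda>z g. z g + a g) ` gamma_level (Suc n)"
  by (auto simp: gcoset_def a_r_coset_def r_coset_def)

lemma gamma_level_zero: "(\<lambda>g. 0) \<in> gamma_level n"
  using subgroup.one_closed[OF gamma_level_subgroup[of n]] by simp

lemma gamma_level_add: "x \<in> gamma_level n \<Longrightarrow> y \<in> gamma_level n \<Longrightarrow> (\<lambda>g. x g + y g) \<in> gamma_level n"
  using subgroup.m_closed[OF gamma_level_subgroup[of n]] by simp

lemma gamma_level_uminus: "x \<in> gamma_level n \<Longrightarrow> (\<lambda>g. - x g) \<in> gamma_level n"
proof -
  assume x: "x \<in> gamma_level n"
  then obtain u b where "x = vch u b"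
    unfolding gamma_level_def by blast
  then have "\<ominus>\<^bsub>R\<^esub> x = (\<lambda>g. - x g)"
    by (simp add: a_inv_vch vch_uminus)
  then show ?thesis
    using subgroup.m_inv_closed[OF gamma_level_subgroup x] by (simp add: a_inv_def)
qed

lemma gamma_level_diff: "x \<in> gamma_level n \<Longrightarrow> y \<in> gamma_level n \<Longrightarrow> (\<lambda>g. x g - y g) \<in> gamma_level n"
  using gamma_level_add[OF _ gamma_level_uminus] by fastforce

lemma gcoset_memI: "(\<lambda>g. x g - a g) \<in> gamma_level (Suc n) \<Longrightarrow> x \<in> gcoset n a"
  unfolding gcoset_alt by (rule image_eqI) (auto simp: fun_eq_iff)

lemma gcoset_mem_iff: "x \<in> gcoset n a \<longleftrightarrow> (\<lambda>g. x g - a g) \<in> gamma_level (Suc n)"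
  by (auto simp: gcoset_alt intro: gcoset_memI[unfolded gcoset_alt])

lemma gcoset_self: "a \<in> gcoset n a"
  by (simp add: gcoset_mem_iff gamma_level_zero)

lemma gcoset_eqI:
  assumes "(\<lambda>g. a g - b g) \<in> gamma_level (Suc n)"
  shows "gcoset n a = gcoset n b"
proof -
  have "x \<in> gcoset n a \<longleftrightarrow> x \<in> gcoset n b" for x
    using gamma_level_add[OF _ assms, of "\<lambda>g. x g - a g"] gamma_level_diff[OF _ assms, of "\<lambda>g. x g - b g"]
    by (auto simp: gcoset_mem_iff)
  then show ?thesis
    by blast
qed

lemma gcoset_zero: "gcoset n (\<lambda>g. 0) = gamma_level (Suc n)"
  by (auto simp: gcoset_mem_iff)

lemma gcoset_eq_zero_iff: "gcoset n a = gamma_level (Suc n) \<longleftrightarrow> a \<in> gamma_level (Suc n)"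
  using gcoset_self[of a n] gcoset_eqI[of a "\<lambda>g. 0" n] by (auto simp: gcoset_zero)

lemma graded_piece_carrier: "carrier (graded_piece G n) = gcoset n ` gamma_level n"
  by (auto simp: graded_piece_def FactGroup_def RCOSETS_def gamma_filtration_eq gcoset_def
      a_r_coset_def r_coset_def)

lemma graded_piece_one: "\<one>\<^bsub>graded_piece G n\<^esub> = gamma_level (Suc n)"
  by (simp add: graded_piece_def FactGroup_def gamma_filtration_eq)

lemma graded_piece_mult: "gcoset n a \<otimes>\<^bsub>graded_piece G n\<^esub> gcoset n b = gcoset n (\<lambda>g. a g + b g)"
proof -
  have "gcoset n a \<otimes>\<^bsub>graded_piece G n\<^esub> gcoset n b = (\<Union>x\<in>gcoset n a. \<Union>y\<in>gcoset n b. {\<lambda>g. x g + y g})"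
    by (simp add: graded_piece_def FactGroup_def set_mult_def)
  also have "\<dots> = gcoset n (\<lambda>g. a g + b g)"
  proof (intro equalityI subsetI)
    fix z assume "z \<in> (\<Union>x\<in>gcoset n a. \<Union>y\<in>gcoset n b. {\<lambda>g. x g + y g})"
    then obtain x y where xy: "x \<in> gcoset n a" "y \<in> gcoset n b" "z = (\<lambda>g. x g + y g)"
      by blast
    have "(\<lambda>g. (x g - a g) + (y g - b g)) \<in> gamma_level (Suc n)"
      using xy gamma_level_add by (simp add: gcoset_mem_iff)
    then show "z \<in> gcoset n (\<lambda>g. a g + b g)"
      by (simp add: gcoset_mem_iff xy(3) algebra_simps)
  next
    fix z assume z: "z \<in> gcoset n (\<lambda>g. a g + b g)"
    have "(\<lambda>g. z g - b g) \<in> gcoset n a"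
      using z by (simp add: gcoset_mem_iff algebra_simps)
    moreover have "z = (\<lambda>g. (z g - b g) + b g)"
      by simp
    ultimately show "z \<in> (\<Union>x\<in>gcoset n a. \<Union>y\<in>gcoset n b. {\<lambda>g. x g + y g})"
      using gcoset_self[of b n] by blast
  qed
  finally show ?thesis .
qed

lemma comm_group_graded_piece: "comm_group (graded_piece G n)"
proof (rule comm_groupI)
  fix x assume "x \<in> carrier (graded_piece G n)"
  then obtain a where a: "a \<in> gamma_level n" "x = gcoset n a"
    by (auto simp: graded_piece_carrier)
  show "\<one>\<^bsub>graded_piece G n\<^esub> \<otimes>\<^bsub>graded_piece G n\<^esub> x = x"
    by (simp add: a graded_piece_one gcoset_zero [symmetric] graded_piece_mult)
  show "\<exists>y\<in>carrier (graded_piece G n). y \<otimes>\<^bsub>graded_piece G n\<^esub> x = \<one>\<^bsub>graded_piece G n\<^esub>"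
    using gamma_level_uminus[OF a(1)]
    by (intro bexI[of _ "gcoset n (\<lambda>g. - a g)"])
      (auto simp: a(2) graded_piece_mult graded_piece_one gcoset_zero graded_piece_carrier)
qed (auto simp: graded_piece_carrier graded_piece_mult add_ac graded_piece_one gcoset_zero [symmetric]
    intro!: imageI gamma_level_add gamma_level_zero)

lemma finprod_gcoset:
  assumes "finite A" "\<And>i. i \<in> A \<Longrightarrow> a i \<in> gamma_level n"
  shows "finprod (graded_piece G n) (\<lambda>i. gcoset n (a i)) A = gcoset n (\<lambda>g. \<Sum>i\<in>A. a i g)"
proof -
  interpret P: comm_group "graded_piece G n"
    by (rule comm_group_graded_piece)
  show ?thesis
    using assms
  proof (induction A rule: finite_induct)
    case empty
    then show ?case
      by (simp add: graded_piece_one gcoset_zero)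
  next
    case (insert j A)
    then show ?case
      by (subst P.finprod_insert) (auto simp: graded_piece_carrier graded_piece_mult)
  qed
qed

text \<open>Independence of representatives: x y - a b = (x - a) b + (x - a) (y - b) + a (y - b),
  with every summand in level i + j + 1. The union over representatives in
  \<open>rcoset_mult\<close> is then a single coset.\<close>

lemma rcoset_mult_gcoset:
  assumes a: "a \<in> gamma_level i" and b: "b \<in> gamma_level j"
  shows "rcoset_mult R (gamma_level (Suc (i + j))) (gcoset i a) (gcoset j b) = gcoset (i + j) (\<lambda>g. a g * b g)"
proof -
  have "gcoset (i + j) (\<lambda>g. x g * y g) = gcoset (i + j) (\<lambda>g. a g * b g)"
    if "x \<in> gcoset i a" "y \<in> gcoset j b" for x y
  proof (rule gcoset_eqI)
    have x: "(\<lambda>g. x g - a g) \<in> gamma_level (Suc i)" and y: "(\<lambda>g. y g - b g) \<in> gamma_level (Suc j)"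
      using that by (simp_all add: gcoset_mem_iff)
    have "(\<lambda>g. (x g - a g) * b g) \<in> gamma_level (Suc (i + j))"
      using gamma_level_mult[OF x b] by simp
    moreover have "(\<lambda>g. (x g - a g) * (y g - b g)) \<in> gamma_level (Suc (i + j))"
      using gamma_level_mult[OF x y] gamma_level_antimono[of "Suc (i + j)" "Suc i + Suc j"] by auto
    moreover have "(\<lambda>g. a g * (y g - b g)) \<in> gamma_level (Suc (i + j))"
      using gamma_level_mult[OF a y] by simp
    ultimately have "(\<lambda>g. (x g - a g) * b g + ((x g - a g) * (y g - b g) + a g * (y g - b g)))
        \<in> gamma_level (Suc (i + j))"
      by (intro gamma_level_add)
    then show "(\<lambda>g. x g * y g - a g * b g) \<in> gamma_level (Suc (i + j))"
      by (simp add: algebra_simps)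
  qed
  then have "(\<Union>x\<in>gcoset i a. \<Union>y\<in>gcoset j b. gcoset (i + j) (\<lambda>g. x g * y g)) =
      gcoset (i + j) (\<lambda>g. a g * b g)"
    using gcoset_self[of a i] gcoset_self[of b j] by blast
  then show ?thesis
    by (simp add: rcoset_mult_def gcoset_def)
qed

lemma level_multiple: "level (m * (p - 1)) = m"
proof -
  have q: "p - 1 > 0"
    using p_gt_1 by simp
  have "level (m * (p - 1)) \<le> k \<longleftrightarrow> m \<le> k" for k
    using q by (simp add: level_def ceil_div_le_iff)
  then show ?thesis
    by (meson le_antisym order_refl)
qed

lemma level_Suc_multiple: "level (Suc (m * (p - 1))) = Suc m"
proof -
  have q: "p - 1 > 0"
    using p_gt_1 by simp
  have "level (Suc (m * (p - 1))) \<le> k \<longleftrightarrow> Suc m \<le> k" for k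
    using q by (simp only: level_def ceil_div_le_iff Suc_le_eq mult_less_cancel2) simp
  then show ?thesis
    by (meson le_antisym order_refl)
qed

lemma level_Suc_not_multiple:
  assumes "\<not> (p - 1) dvd n"
  shows "level (Suc n) = level n"
proof -
  have q: "p - 1 > 0"
    using p_gt_1 by simp
  have "n \<noteq> k * (p - 1)" for k
    using assms by auto
  then have "level (Suc n) \<le> k \<longleftrightarrow> level n \<le> k" for k
    using q by (simp add: level_def ceil_div_le_iff Suc_le_eq order_less_le)
  then show ?thesis
    by (meson le_antisym order_refl)
qed

text \<open>\<open>k (\<gamma>\<^sup>p\<^sup>-\<^sup>1(\<chi> - p))\<^sup>m\<close>, representing \<open>k x\<^sup>m\<close> in degree \<open>m (p - 1)\<close>.\<close>

definition chern_power :: "int \<Rightarrow> nat \<Rightarrow> int \<Rightarrow> rat" where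
  "chern_power k m = (\<lambda>g. if g \<in> carrier G then of_int k * vch 0 chern_sign g ^ m else 0)"

lemma chern_sign_square: "chern_sign * chern_sign = 1"
  by (simp add: chern_sign_def power_mult_distrib [symmetric])

text \<open>With exponent 0 the value at the identity is k, as 0^0 = 1, while it is 0 for positive
  exponents; hence the separate formulas.\<close>

lemma chern_power_0: "chern_power k 0 = vch k 0"
  by (auto simp: chern_power_def vch_def)

lemma chern_power_Suc: "chern_power k (Suc m) = vch 0 (k * chern_sign * (- int p * chern_sign) ^ m)"
  by (auto simp: chern_power_def vch_def fun_eq_iff)

lemma chern_power_zero [simp]: "chern_power 0 m = (\<lambda>g. 0)"
  by (auto simp: chern_power_def)

lemma chern_power_1: "chern_power 1 1 = vch 0 chern_sign"
  using chern_power_Suc[of 1 0] by simp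

lemma chern_power_mult: "chern_power k m g * chern_power l n g = chern_power (k * l) (m + n) g"
  by (simp add: chern_power_def power_add mult_ac)

lemma chern_power_add: "chern_power k m g + chern_power l m g = chern_power (k + l) m g"
  by (simp add: chern_power_def algebra_simps)

lemma chern_power_sum: "(\<Sum>i\<in>A. chern_power (k i) m g) = chern_power (\<Sum>i\<in>A. k i) m g"
  by (simp add: chern_power_def sum_distrib_right)

text \<open>The left side is the value of \<open>chern_power k (Suc m)\<close> off the identity.
  Since \<open>chern_sign\<close> is a unit, its divisibility by powers of p is that of k p^(m +
  1).\<close>

lemma chern_power_value: "0 - int p * (k * chern_sign * (- int p * chern_sign) ^ m) =
    k * (- chern_sign) ^ Suc m * int p ^ Suc m"
proof -
  have "(- int p * chern_sign) ^ m = (- chern_sign) ^ m * int p ^ m"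
    by (simp add: power_mult_distrib [symmetric] mult.commute)
  then show ?thesis
    by simp
qed

lemma chern_power_in_level: "chern_power k m \<in> gamma_level (m * (p - 1))"
proof (cases m)
  case 0
  then show ?thesis
    by (simp add: chern_power_0 gamma_level_0)
next
  case (Suc l)
  then show ?thesis
    unfolding Suc chern_power_Suc vch_in_gamma_level level_multiple chern_power_value by simp
qed

text \<open>Source of the relation p x = 0: for m > 0 the next level asks for one factor p beyond
  p^m, which k must supply. For m = 0 it asks for degree 0, so the constants stay torsion
  free.\<close>

lemma chern_power_in_next_level_iff:
  "chern_power k m \<in> gamma_level (Suc (m * (p - 1))) \<longleftrightarrow> (if m = 0 then k = 0 else int p dvd k)"
proof (cases m)
  case 0
  then show ?thesis
    using level_Suc_multiple[of 0] by (auto simp: chern_power_0 vch_in_gamma_level)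
next
  case (Suc l)
  have unit: "(- chern_sign) ^ n dvd 1" for n
    using chern_sign_square by (metis dvd_triv_left is_unit_power_iff minus_mult_minus)
  have "chern_power k m \<in> gamma_level (Suc (m * (p - 1))) \<longleftrightarrow>
      int p * int p ^ Suc l dvd k * (- chern_sign) ^ Suc l * int p ^ Suc l"
    unfolding Suc chern_power_Suc vch_in_gamma_level level_Suc_multiple chern_power_value
    by (simp only: power_Suc[of "int p" "Suc l"]) simp
  also have "\<dots> \<longleftrightarrow> int p dvd k * (- chern_sign) ^ Suc l"
    using p_gt_1 by (intro dvd_mult_cancel_right[THEN trans]) auto
  also have "\<dots> \<longleftrightarrow> int p dvd k"
    using unit[of "Suc l"] by (rule dvd_mult_unit_iff)
  finally show ?thesis
    using Suc by simp
qed

lemma graded_piece_multiple: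
  assumes "A \<in> carrier (graded_piece G (m * (p - 1)))"
  shows "\<exists>k. A = gcoset (m * (p - 1)) (chern_power k m)"
proof -
  obtain a where a: "a \<in> gamma_level (m * (p - 1))" "A = gcoset (m * (p - 1)) a"
    using assms by (auto simp: graded_piece_carrier)
  show ?thesis
  proof (cases m)
    case 0
    obtain u b where "a = vch u b"
      using a(1) unfolding gamma_level_def by blast
    moreover have "(\<lambda>g. vch u b g - vch u 0 g) = vch 0 b"
      by (auto simp: vch_def fun_eq_iff)
    \<comment> \<open>Level 1 is the augmentation ideal, so in degree 0 only u matters.\<close>
    moreover have "vch 0 b \<in> gamma_level (Suc 0)"
      using level_Suc_multiple[of 0] by (simp add: vch_in_gamma_level)
    ultimately have "gcoset 0 a = gcoset 0 (vch u 0)"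
      by (intro gcoset_eqI) simp
    then show ?thesis
      using a(2) 0 by (intro exI[of _ u]) (simp add: chern_power_0)
  next
    case (Suc l)
    then have "m * (p - 1) > 0"
      using p_gt_1 by simp
    then obtain b where b: "a = vch 0 b" "int p ^ m dvd 0 - int p * b"
      using a(1) unfolding gamma_level_def level_multiple by blast
    then have "int p * int p ^ l dvd int p * b"
      using Suc by simp
    then have "int p ^ l dvd b"
      using p_gt_1 by simp
    then obtain c where c: "b = int p ^ l * c"
      by blast
    \<comment> \<open>The signs are chosen to cancel: \<open>chern_sign\<close> squares to 1, so k
      \<open>chern_sign\<close> (-p \<open>chern_sign\<close>)^l = c p^l = b.\<close>
    define k where "k = c * chern_sign * (- chern_sign) ^ l"
    have "k * chern_sign * (- int p * chern_sign) ^ l =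
        c * (chern_sign * chern_sign) * ((- chern_sign) * (- int p * chern_sign)) ^ l"
      by (simp only: k_def power_mult_distrib mult_ac)
    also have "(- chern_sign) * (- int p * chern_sign) = int p * (chern_sign * chern_sign)"
      by simp
    finally have "a = chern_power k m"
      unfolding Suc chern_power_Suc b(1) c by (simp only: chern_sign_square) simp
    then show ?thesis
      using a(2) by blast
  qed
qed

lemma graded_piece_not_multiple:
  assumes "A \<in> carrier (graded_piece G n)" "\<not> (p - 1) dvd n"
  shows "A = gamma_level (Suc n)"
proof -
  have "n > 0"
    using assms(2) by (cases n) auto
  then have "gamma_level (Suc n) = gamma_level n"
    by (simp add: gamma_level_def level_Suc_not_multiple[OF assms(2)])
  then show ?thesis
    using assms(1) gcoset_eq_zero_iff by (auto simp: graded_piece_carrier)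
qed

section \<open>The graded ring and evaluation at x\<close>

abbreviation gr :: "(nat \<Rightarrow> (int \<Rightarrow> rat) set) ring" where
  "gr \<equiv> graded_char_ring G"

lemma group_graded_piece: "group (graded_piece G n)"
  using comm_group_graded_piece comm_group.axioms(2) by blast

lemma gr_carrier: "carrier gr = {u. (\<forall>n. u n \<in> carrier (graded_piece G n)) \<and>
    finite {n. u n \<noteq> gamma_level (Suc n)}}"
  using group_graded_piece
  by (simp add: graded_char_ring_def Let_def carrier_sum_group graded_piece_one PiE_def Pi_def)

lemma gr_zero: "\<zero>\<^bsub>gr\<^esub> = (\<lambda>n. gamma_level (Suc n))"
  by (simp add: graded_char_ring_def Let_def restrict_def graded_piece_one)

lemma gr_add: "x \<oplus>\<^bsub>gr\<^esub> y = (\<lambda>n. x n \<otimes>\<^bsub>graded_piece G n\<^esub> y n)"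
  by (simp add: graded_char_ring_def Let_def restrict_def)

lemma gr_one: "\<one>\<^bsub>gr\<^esub> = (\<lambda>n. gcoset n (if n = 0 then vch 1 0 else (\<lambda>g. 0)))"
  by (auto simp: graded_char_ring_def Let_def graded_incl_def gamma_filtration_eq graded_piece_one
      gcoset_def vch_1 fun_eq_iff gcoset_zero [unfolded gcoset_def])

lemma gr_mult: "u \<otimes>\<^bsub>gr\<^esub> v = (\<lambda>n. finprod (graded_piece G n)
    (\<lambda>i. rcoset_mult R (gamma_level (Suc n)) (u i) (v (n - i))) {..n})"
  by (simp add: graded_char_ring_def Let_def gamma_filtration_eq)

text \<open>A representative in degree n of the sum of the f_m x^m: x sits in degree p - 1, so only
  the degrees m (p - 1) are hit.\<close>

definition poly_part :: "(nat \<Rightarrow> int) \<Rightarrow> nat \<Rightarrow> int \<Rightarrow> rat" where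
  "poly_part f n = (if (p - 1) dvd n then chern_power (f (n div (p - 1))) (n div (p - 1)) else (\<lambda>g. 0))"

text \<open>Evaluation of an integer polynomial at x; as in \<open>UP\<close>, a polynomial is its
  coefficient function.\<close>

definition chern_hom :: "(nat \<Rightarrow> int) \<Rightarrow> nat \<Rightarrow> (int \<Rightarrow> rat) set" where
  "chern_hom f n = gcoset n (poly_part f n)"

lemma poly_part_multiple: "poly_part f (m * (p - 1)) = chern_power (f m) m"
  using p_gt_1 by (simp add: poly_part_def)

lemma poly_part_in_level: "poly_part f n \<in> gamma_level n"
proof (cases "(p - 1) dvd n")
  case True
  then obtain m where m: "n = m * (p - 1)"
    by (metis dvd_def mult.commute)
  show ?thesis
    unfolding m poly_part_multiple by (rule chern_power_in_level)
qed (simp add: poly_part_def gamma_level_zero)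

lemma chern_hom_eq_zero_iff:
  "chern_hom f = \<zero>\<^bsub>gr\<^esub> \<longleftrightarrow> f 0 = 0 \<and> (\<forall>m. int p dvd f m)"
proof -
  have "chern_hom f = \<zero>\<^bsub>gr\<^esub> \<longleftrightarrow> (\<forall>n. poly_part f n \<in> gamma_level (Suc n))"
    by (simp add: fun_eq_iff gr_zero chern_hom_def gcoset_eq_zero_iff)
  also have "\<dots> \<longleftrightarrow> (\<forall>m. chern_power (f m) m \<in> gamma_level (Suc (m * (p - 1))))"
  proof
    assume "\<forall>n. poly_part f n \<in> gamma_level (Suc n)"
    then show "\<forall>m. chern_power (f m) m \<in> gamma_level (Suc (m * (p - 1)))"
      by (metis poly_part_multiple)
  next
    assume *: "\<forall>m. chern_power (f m) m \<in> gamma_level (Suc (m * (p - 1)))"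
    show "\<forall>n. poly_part f n \<in> gamma_level (Suc n)"
    proof
      fix n
      show "poly_part f n \<in> gamma_level (Suc n)"
        using * [rule_format, of "n div (p - 1)"] gamma_level_zero by (auto simp: poly_part_def)
    qed
  qed
  also have "\<dots> \<longleftrightarrow> (\<forall>m. if m = 0 then f m = 0 else int p dvd f m)"
    unfolding chern_power_in_next_level_iff ..
  also have "\<dots> \<longleftrightarrow> f 0 = 0 \<and> (\<forall>m. int p dvd f m)"
    by (metis dvd_0_right)
  finally show ?thesis .
qed

lemma up_int_iff: "f \<in> up \<Z> \<longleftrightarrow> (\<exists>N. \<forall>m>N. f m = 0)"
  unfolding up_def bound_def by auto

lemma chern_hom_image: "chern_hom ` carrier (UP \<Z>) = carrier gr"
proof (intro equalityI subsetI)
  fix u assume "u \<in> chern_hom ` carrier (UP \<Z>)"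
  then obtain f where f: "f \<in> up \<Z>" "u = chern_hom f"
    by (auto simp: UP_def)
  then obtain N where N: "\<And>m. m > N \<Longrightarrow> f m = 0"
    by (auto simp: up_int_iff)
  have "n \<le> N * (p - 1)" if "chern_hom f n \<noteq> gamma_level (Suc n)" for n
  proof (rule ccontr)
    assume n: "\<not> n \<le> N * (p - 1)"
    have "poly_part f n = (\<lambda>g. 0)"
    proof (cases "(p - 1) dvd n")
      case True
      then obtain m where m: "n = m * (p - 1)"
        by (metis dvd_def mult.commute)
      then have "m > N"
        using n p_gt_1 by simp
      then show ?thesis
        using N by (simp only: m poly_part_multiple chern_power_zero)
    qed (simp add: poly_part_def)
    then show False
      using that by (simp add: chern_hom_def gcoset_zero)
  qed
  then have "{n. chern_hom f n \<noteq> gamma_level (Suc n)} \<subseteq> {..N * (p - 1)}"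
    by (simp only: subset_iff mem_Collect_eq atMost_iff) blast
  then have "finite {n. chern_hom f n \<noteq> gamma_level (Suc n)}"
    using finite_atMost by (rule finite_subset)
  then show "u \<in> carrier gr"
    unfolding gr_carrier f(2) graded_piece_carrier
    by (intro CollectI conjI allI) (simp_all only: chern_hom_def image_eqI[OF refl poly_part_in_level])
next
  fix u assume "u \<in> carrier gr"
  then have u: "\<And>n. u n \<in> carrier (graded_piece G n)" "finite {n. u n \<noteq> gamma_level (Suc n)}"
    by (auto simp: gr_carrier)
  \<comment> \<open>For m > 0 the integer k is determined only modulo p; taking 0 whenever the
    component is trivial makes the coefficient function finitely supported.\<close>
  have "\<exists>k. u (m * (p - 1)) = gcoset (m * (p - 1)) (chern_power k m) \<and>
      (u (m * (p - 1)) = gamma_level (Suc (m * (p - 1))) \<longrightarrow> k = 0)" for m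
  proof (cases "u (m * (p - 1)) = gamma_level (Suc (m * (p - 1)))")
    case True
    then show ?thesis
      by (intro exI[of _ 0]) (simp add: gcoset_zero)
  next
    case False
    then show ?thesis
      using graded_piece_multiple[OF u(1)] by blast
  qed
  then obtain f where f: "\<And>m. u (m * (p - 1)) = gcoset (m * (p - 1)) (chern_power (f m) m)"
      "\<And>m. u (m * (p - 1)) = gamma_level (Suc (m * (p - 1))) \<Longrightarrow> f m = 0"
    by metis
  obtain N where N: "\<And>n. u n \<noteq> gamma_level (Suc n) \<Longrightarrow> n \<le> N"
    using u(2) by (auto simp: finite_nat_set_iff_bounded_le)
  have "f m = 0" if "m > N" for m
  proof (rule f(2), rule ccontr)
    assume "u (m * (p - 1)) \<noteq> gamma_level (Suc (m * (p - 1)))"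
    then have "m * (p - 1) \<le> N"
      by (rule N)
    \<comment> \<open>p - 1 is at least 1, so a bound on the degrees also bounds the
      exponents.\<close>
    moreover have "m \<le> m * (p - 1)"
      using p_gt_1 by (cases "p - 1") auto
    ultimately show False
      using that by linarith
  qed
  then have "f \<in> carrier (UP \<Z>)"
    by (auto simp: UP_def up_int_iff)
  moreover have "u = chern_hom f"
  proof
    fix n
    show "u n = chern_hom f n"
    proof (cases "(p - 1) dvd n")
      case True
      then obtain m where m: "n = m * (p - 1)"
        by (metis dvd_def mult.commute)
      show ?thesis
        unfolding m chern_hom_def poly_part_multiple by (rule f(1))
    next
      case False
      then show ?thesis
        using graded_piece_not_multiple[OF u(1)] by (simp add: chern_hom_def poly_part_def gcoset_zero)
    qed
  qed
  ultimately show "u \<in> chern_hom ` carrier (UP \<Z>)"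
    by blast
qed

lemma chern_hom_add: "chern_hom (\<lambda>n. f n + g n) = chern_hom f \<oplus>\<^bsub>gr\<^esub> chern_hom g"
proof
  fix n
  have "poly_part (\<lambda>n. f n + g n) n = (\<lambda>x. poly_part f n x + poly_part g n x)"
    by (simp add: poly_part_def chern_power_add)
  then show "chern_hom (\<lambda>n. f n + g n) n = (chern_hom f \<oplus>\<^bsub>gr\<^esub> chern_hom g) n"
    by (simp add: chern_hom_def gr_add graded_piece_mult)
qed

text \<open>A term of the Cauchy product survives only if i and n - i are both multiples of p - 1.
  The identity holds for the representatives themselves, before passing to cosets.\<close>

lemma poly_part_mult:
  "(\<Sum>i\<le>n. poly_part f i x * poly_part g (n - i) x) = poly_part (\<lambda>n. \<Sum>i\<le>n. f i * g (n - i)) n x"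
proof (cases "(p - 1) dvd n")
  case True
  then obtain m where m: "n = m * (p - 1)"
    by (metis dvd_def mult.commute)
  have q: "p - 1 > 0"
    using p_gt_1 by simp
  let ?t = "\<lambda>i. poly_part f i x * poly_part g (n - i) x"
  have "(\<Sum>i\<le>n. ?t i) = (\<Sum>i\<in>(\<lambda>j. j * (p - 1)) ` {..m}. ?t i)"
  proof (rule sum.mono_neutral_right)
    show "(\<lambda>j. j * (p - 1)) ` {..m} \<subseteq> {..n}"
      by (auto simp: m)
    show "\<forall>i\<in>{..n} - (\<lambda>j. j * (p - 1)) ` {..m}. ?t i = 0"
    proof
      fix i assume i: "i \<in> {..n} - (\<lambda>j. j * (p - 1)) ` {..m}"
      have "\<not> (p - 1) dvd i"
      proof
        assume "(p - 1) dvd i"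
        then obtain j where j: "i = j * (p - 1)"
          by (metis dvd_def mult.commute)
        then have "j \<le> m"
          using i q by (simp add: m)
        then show False
          using i j by blast
      qed
      then show "?t i = 0"
        by (simp add: poly_part_def)
    qed
  qed simp
  also have "\<dots> = (\<Sum>j\<le>m. ?t (j * (p - 1)))"
    using q by (subst sum.reindex) (auto simp: inj_on_def)
  also have "\<dots> = (\<Sum>j\<le>m. chern_power (f j * g (m - j)) m x)"
  proof (rule sum.cong[OF refl])
    fix j assume "j \<in> {..m}"
    then have "n - j * (p - 1) = (m - j) * (p - 1)" "j + (m - j) = m"
      by (simp_all add: m diff_mult_distrib)
    then show "?t (j * (p - 1)) = chern_power (f j * g (m - j)) m x"
      by (simp only: poly_part_multiple chern_power_mult)
  qed
  also have "\<dots> = poly_part (\<lambda>n. \<Sum>i\<le>n. f i * g (n - i)) n x"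
    unfolding m poly_part_multiple by (rule chern_power_sum)
  finally show ?thesis .
next
  case False
  have "poly_part f i x * poly_part g (n - i) x = 0" if "i \<le> n" for i
  proof (rule ccontr)
    assume "poly_part f i x * poly_part g (n - i) x \<noteq> 0"
    then have "(p - 1) dvd i" "(p - 1) dvd n - i"
      by (auto simp: poly_part_def split: if_splits)
    then have "(p - 1) dvd i + (n - i)"
      by (rule dvd_add)
    then show False
      using False that by simp
  qed
  then have "(\<Sum>i\<le>n. poly_part f i x * poly_part g (n - i) x) = 0"
    by (intro sum.neutral) simp
  then show ?thesis
    using False by (simp only: poly_part_def if_False)
qed

lemma chern_hom_mult: "chern_hom (\<lambda>n. \<Sum>i\<le>n. f i * g (n - i)) = chern_hom f \<otimes>\<^bsub>gr\<^esub> chern_hom g"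
proof
  fix n
  interpret P: comm_group "graded_piece G n"
    by (rule comm_group_graded_piece)
  let ?a = "\<lambda>i g'. poly_part f i g' * poly_part g (n - i) g'"
  have a: "?a i \<in> gamma_level n" if "i \<in> {..n}" for i
    using gamma_level_mult[OF poly_part_in_level[of f i] poly_part_in_level[of g "n - i"]] that by simp
  have "(chern_hom f \<otimes>\<^bsub>gr\<^esub> chern_hom g) n = finprod (graded_piece G n)
      (\<lambda>i. rcoset_mult R (gamma_level (Suc n)) (chern_hom f i) (chern_hom g (n - i))) {..n}"
    by (simp add: gr_mult)
  also have "\<dots> = finprod (graded_piece G n) (\<lambda>i. gcoset n (?a i)) {..n}"
  proof (rule P.finprod_cong')
    show "(\<lambda>i. gcoset n (?a i)) \<in> {..n} \<rightarrow> carrier (graded_piece G n)"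
      using a by (auto simp: graded_piece_carrier)
    fix i assume "i \<in> {..n}"
    then show "rcoset_mult R (gamma_level (Suc n)) (chern_hom f i) (chern_hom g (n - i)) = gcoset n (?a i)"
      using rcoset_mult_gcoset[OF poly_part_in_level[of f i] poly_part_in_level[of g "n - i"]]
      by (simp add: chern_hom_def)
  qed simp
  also have "\<dots> = gcoset n (\<lambda>x. \<Sum>i\<le>n. poly_part f i x * poly_part g (n - i) x)"
    using a by (intro finprod_gcoset) auto
  finally show "chern_hom (\<lambda>n. \<Sum>i\<le>n. f i * g (n - i)) n = (chern_hom f \<otimes>\<^bsub>gr\<^esub> chern_hom g) n"
    by (simp add: chern_hom_def poly_part_mult)
qed

lemma chern_hom_one: "chern_hom (\<lambda>n. if n = 0 then 1 else 0) = \<one>\<^bsub>gr\<^esub>"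
proof
  fix n
  have "poly_part (\<lambda>n. if n = 0 then 1 else 0) n = (if n = 0 then vch 1 0 else (\<lambda>g. 0))"
    using p_gt_1 by (auto simp: poly_part_def chern_power_0 elim!: dvdE)
  then show "chern_hom (\<lambda>n. if n = 0 then 1 else 0) n = \<one>\<^bsub>gr\<^esub> n"
    by (simp add: chern_hom_def gr_one)
qed

lemma cring_UP_int: "cring (UP \<Z>)"
proof -
  have "UP_cring \<Z>"
    unfolding UP_cring_def by (rule int.is_cring)
  then show ?thesis
    by (rule UP_cring.UP_cring)
qed

lemma UP_int_carrier: "carrier (UP \<Z>) = up \<Z>"
  by (simp add: UP_def)

lemma UP_int_mult:
  "f \<in> up \<Z> \<Longrightarrow> g \<in> up \<Z> \<Longrightarrow> f \<otimes>\<^bsub>UP \<Z>\<^esub> g = (\<lambda>n. \<Sum>i\<le>n. f i * g (n - i))"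
  by (simp add: UP_def int_finsum_eq)

lemma UP_int_monom: "up_ring.monom (UP \<Z>) k m = (\<lambda>n. if n = m then k else 0)"
  by (simp add: UP_def cong: if_cong)

lemma ring_hom_chern_hom: "ring_hom_cring (UP \<Z>) gr chern_hom"
proof (rule ring_hom_cring_surjI[OF cring_UP_int chern_hom_image])
  fix f g assume "f \<in> carrier (UP \<Z>)" "g \<in> carrier (UP \<Z>)"
  then have fg: "f \<in> up \<Z>" "g \<in> up \<Z>"
    by (simp_all only: UP_int_carrier)
  show "chern_hom (f \<otimes>\<^bsub>UP \<Z>\<^esub> g) = chern_hom f \<otimes>\<^bsub>gr\<^esub> chern_hom g"
    by (simp only: UP_int_mult[OF fg] chern_hom_mult)
  have "f \<oplus>\<^bsub>UP \<Z>\<^esub> g = (\<lambda>n. f n + g n)"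
    using fg by (simp add: UP_def)
  then show "chern_hom (f \<oplus>\<^bsub>UP \<Z>\<^esub> g) = chern_hom f \<oplus>\<^bsub>gr\<^esub> chern_hom g"
    by (simp only: chern_hom_add)
next
  have "\<one>\<^bsub>UP \<Z>\<^esub> = (\<lambda>n. if n = 0 then 1 else 0)"
    by (simp add: UP_def cong: if_cong)
  then show "chern_hom \<one>\<^bsub>UP \<Z>\<^esub> = \<one>\<^bsub>gr\<^esub>"
    by (simp only: chern_hom_one)
  show "chern_hom \<zero>\<^bsub>UP \<Z>\<^esub> = \<zero>\<^bsub>gr\<^esub>"
    by (simp add: chern_hom_eq_zero_iff UP_def)
qed

lemma kernel_chern_hom:
  "a_kernel (UP \<Z>) gr chern_hom = genideal (UP \<Z>) {up_ring.monom (UP \<Z>) (int p) 1}"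
proof -
  interpret U: cring "UP \<Z>"
    by (rule cring_UP_int)
  let ?pX = "up_ring.monom (UP \<Z>) (int p) 1"
  have pX: "?pX = (\<lambda>n. if n = 1 then int p else 0)"
    by (rule UP_int_monom)
  have pX_mem: "?pX \<in> carrier (UP \<Z>)"
    unfolding pX UP_int_carrier up_int_iff by auto
  have mult: "(g \<otimes>\<^bsub>UP \<Z>\<^esub> ?pX) n = (if n = 0 then 0 else int p * g (n - 1))"
    if "g \<in> carrier (UP \<Z>)" for g n
  proof -
    have "(g \<otimes>\<^bsub>UP \<Z>\<^esub> ?pX) n = (\<Sum>i\<le>n. g i * ?pX (n - i))"
      using that pX_mem by (simp only: UP_int_carrier UP_int_mult)
    also have "\<dots> = (\<Sum>i\<le>n. if i = n - 1 \<and> n > 0 then int p * g i else 0)"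
      unfolding pX by (intro sum.cong) auto
    also have "\<dots> = (if n = 0 then 0 else int p * g (n - 1))"
      by (cases n) (auto simp: sum.delta)
    finally show ?thesis .
  qed
  have "a_kernel (UP \<Z>) gr chern_hom = {f \<in> carrier (UP \<Z>). f 0 = 0 \<and> (\<forall>m. int p dvd f m)}"
    by (simp add: a_kernel_def' chern_hom_eq_zero_iff)
  also have "\<dots> = {g \<otimes>\<^bsub>UP \<Z>\<^esub> ?pX | g. g \<in> carrier (UP \<Z>)}"
  proof (intro equalityI subsetI)
    fix f assume "f \<in> {f \<in> carrier (UP \<Z>). f 0 = 0 \<and> (\<forall>m. int p dvd f m)}"
    then have f: "f \<in> up \<Z>" "f 0 = 0" "\<And>m. int p dvd f m"
      by (auto simp: UP_def)
    \<comment> \<open>Division by p X: shift the coefficients down once and divide them by p, both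
      exact because f 0 = 0 and p divides every f m.\<close>
    define g where "g m = f (Suc m) div int p" for m
    obtain N where "\<forall>m>N. f m = 0"
      using f(1) unfolding up_int_iff by blast
    then have "\<forall>m>N. g m = 0"
      by (simp add: g_def)
    then have g: "g \<in> carrier (UP \<Z>)"
      unfolding UP_int_carrier up_int_iff by blast
    have "f = g \<otimes>\<^bsub>UP \<Z>\<^esub> ?pX"
    proof
      fix n
      show "f n = (g \<otimes>\<^bsub>UP \<Z>\<^esub> ?pX) n"
        unfolding mult[OF g] using f(2,3) by (cases n) (auto simp: g_def)
    qed
    then show "f \<in> {g \<otimes>\<^bsub>UP \<Z>\<^esub> ?pX | g. g \<in> carrier (UP \<Z>)}"
      using g by blast
  next
    fix f assume "f \<in> {g \<otimes>\<^bsub>UP \<Z>\<^esub> ?pX | g. g \<in> carrier (UP \<Z>)}"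
    then obtain g where g: "g \<in> carrier (UP \<Z>)" "f = g \<otimes>\<^bsub>UP \<Z>\<^esub> ?pX"
      by blast
    have "f \<in> carrier (UP \<Z>)"
      using g pX_mem by simp
    then show "f \<in> {f \<in> carrier (UP \<Z>). f 0 = 0 \<and> (\<forall>m. int p dvd f m)}"
      using mult[OF g(1)] g(2) by simp
  qed
  also have "\<dots> = genideal (UP \<Z>) {?pX}"
    using U.cgenideal_eq_genideal[OF pX_mem] by (simp add: cgenideal_def)
  finally show ?thesis .
qed

text \<open>The trace counts the fixed points of translation by g: all p elements for g = 0 and none
  otherwise.\<close>

lemma regular_character: "rep_character G (regular_rep G (map int [0..<p])) = vch (int p) 1"
proof -
  have "mat_trace (regular_rep G (map int [0..<p]) g) = (if g = 0 then of_nat p else 0)"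
    if g: "g \<in> carrier G" for g
  proof -
    have "(g + int i) mod int p = int i \<longleftrightarrow> g = 0" if "i < p" for i
    proof
      assume "(g + int i) mod int p = int i"
      then have "(g + int i) mod int p = int i mod int p"
        using that by simp
      then have "int p dvd g"
        by (metis add_diff_cancel_right' mod_eq_dvd_iff)
      then show "g = 0"
        using g zdvd_not_zless[of g "int p"] by (force simp: carrier_G)
    qed (use that in simp)
    then have "mat_trace (regular_rep G (map int [0..<p]) g) = (\<Sum>i<p. if g = 0 then 1 else 0)"
      unfolding mat_trace_def regular_rep_def by (intro sum.cong) auto
    then show ?thesis
      by simp
  qed
  then show ?thesis
    by (auto simp: rep_character_def vch_def fun_eq_iff)
qed

lemma chern_class_regular: "chern_class G (p - 1) (vch (int p) 1) = gcoset (p - 1) (vch 0 chern_sign)"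
proof -
  have "augmentation G (vch (int p) 1) = int p"
    by (simp add: augmentation_def)
  moreover have "vch (int p) 1 \<ominus>\<^bsub>R\<^esub> vch (int p) 0 = vch 0 1"
    by (simp add: a_minus_def a_inv_vch vch_add)
  ultimately show ?thesis
    by (simp only: chern_class_def Let_def gamma_filtration_eq const_char_eq gamma_op_top gcoset_def)
qed

lemma chern_hom_X:
  "chern_hom (up_ring.monom (UP \<Z>) 1 1) = graded_incl G (p - 1) (gcoset (p - 1) (vch 0 chern_sign))"
proof
  fix n
  have X: "up_ring.monom (UP \<Z>) 1 1 = (\<lambda>n. if n = 1 then 1 else 0 :: int)"
    by (rule UP_int_monom)
  have "poly_part (\<lambda>n. if n = 1 then 1 else 0) n = (if n = p - 1 then vch 0 chern_sign else (\<lambda>g. 0))"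
  proof (cases "(p - 1) dvd n")
    case True
    then obtain m where m: "n = m * (p - 1)"
      by (metis dvd_def mult.commute)
    have "m = 1 \<longleftrightarrow> n = p - 1"
      using p_gt_1 by (auto simp: m)
    then show ?thesis
      unfolding m poly_part_multiple using chern_power_1 by auto
  next
    case False
    then show ?thesis
      by (auto simp: poly_part_def)
  qed
  then show "chern_hom (up_ring.monom (UP \<Z>) 1 1) n =
      graded_incl G (p - 1) (gcoset (p - 1) (vch 0 chern_sign)) n"
    unfolding X chern_hom_def graded_incl_def by (simp add: graded_piece_one gcoset_zero)
qed

end

theorem corollary3p3:
  fixes p :: nat
  assumes "Factorial_Ring.prime p"
  defines "G \<equiv> integer_mod_group p"
  defines "\<chi> \<equiv> rep_character G (regular_rep G (map int [0..<p]))"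
  defines "x \<equiv> graded_incl G (p - 1) (chern_class G (p - 1) \<chi>)"
  shows "\<exists>h. ring_hom_cring (UP \<Z>) (graded_char_ring G) h \<and>
             h (up_ring.monom (UP \<Z>) 1 1) = x \<and>
             h ` carrier (UP \<Z>) = carrier (graded_char_ring G) \<and>
             a_kernel (UP \<Z>) (graded_char_ring G) h =
               genideal (UP \<Z>) {up_ring.monom (UP \<Z>) (int p) 1}"
proof -
  interpret prime_cyclic_group p
    by unfold_locales fact
  show ?thesis
    unfolding x_def \<chi>_def G_def regular_character chern_class_regular
    using ring_hom_chern_hom chern_hom_X chern_hom_image kernel_chern_hom by blast
qed

end
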